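(* Let $\theta,q>0$, let $\mu$ be a beta-gamma process with law $\mathcal{BG}(d\mu|\theta H,\theta-q)$, and let $P(\cdot)=T^{-1}\mu(\cdot)$, where $T=\mu(\mathcal Y)$; $P$ is a Dirichlet process with shape $\theta H$. Suppose that $\mathbf Y=\{Y_1,\dots,Y_n\}$ are, conditionally on $P$, i.i.d. with law $P$. Then the posterior distribution of $\mu$ given $\mathbf Y$ is $$\mathcal{BG}\Big(d\mu\Big|\theta H+\sum_{i=1}^n\delta_{Y_i},\theta+n-q\Big)=\frac{\Gamma(\theta+n)}{\Gamma(q)}T^{-(\theta+n-q)}\,\mathcal G\Big(d\mu\Big|\theta H+\sum_{i=1}^n\delta_{Y_i}\Big).$$ If $\theta+n-q>0$, then for every positive measurable $g$ with $\int_{\mathcal Y}\log[1+g(y)]\theta H(dy)<\infty$ the Laplace functional of the posterior distribution (the integral of $e^{-\mu(g)}$ with respect to it) is $$\int_0^1 e^{-\int_{\mathcal Y}\log[1+ug(y)]\theta H(dy)}\prod_{j=1}^{n(\mathbf p)}\big(1+ug(Y^*_j)\big)^{-e_{j,n}}\,\mathcal B(du|q,\theta+n-q).$$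
   Context: $\mathcal Y$ is a Polish space, $\mathcal M$ is the space of boundedly finite measures on $\mathcal Y$, and $H$ is a fixed non-atomic probability measure on $\mathcal Y$. Write $\mu(g)=\int_{\mathcal Y}g(y)\mu(dy)$. For a finite measure $\nu$ on $\mathcal Y$, $\mathcal G(d\mu|\nu)$ is the law on $\mathcal M$ of the gamma process with shape $\nu$, i.e. the random measure $\mu$ with independent values on disjoint sets and $\mu(A)$ gamma distributed with shape $\nu(A)$ and scale $1$. The Dirichlet process with shape $\theta H$ is $\mu/\mu(\mathcal Y)$ for $\mu$ with law $\mathcal G(d\mu|\theta H)$. The beta-gamma law is, for $\theta,q>0$, $$\mathcal{BG}(d\mu|\theta H,\theta-q)=\frac{\Gamma(\theta)}{\Gamma(q)}T^{-(\theta-q)}\mathcal G(d\mu|\theta H).$$ $Y^*_1,\dots,Y^*_{n(\mathbf p)}$ denote the distinct values among $Y_1,\dots,Y_n$; $\mathbf p=\{C_1,\dots,C_{n(\mathbf p)}\}$ is the induced partition of $\{1,\dots,n\}$ with $C_j=\{i:Y_i=Y^*_j\}$, and $e_{j,n}$ is the size of $C_j$. Beta law: $\mathcal B(du|a,b)=\frac{\Gamma(a+b)}{\Gamma(a)\Gamma(b)}u^{a-1}(1-u)^{b-1}du$, $0<u<1$.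
   Formalization: The Y_i are assumed i.i.d. with law P conditionally on μ (the usual sampling scheme), not only conditionally on P: given P alone they could still depend on T, and the stated posterior would then fail. *)

theory Defs
  imports "HOL-Probability.Probability"
begin

text \<open>
  The space of measures that are finite on bounded sets (with respect to the complete metric
  carried by the type class), with the sigma-algebra generated by the evaluations.  The
  construction is that of \<^const>\<open>subprob_algebra\<close>.
\<close>

definition boundedly_finite :: "'y::polish_space measure \<Rightarrow> bool" where
  "boundedly_finite \<mu> \<longleftrightarrow>
     sets \<mu> = sets borel \<and> (\<forall>A\<in>sets borel. bounded A \<longrightarrow> emeasure \<mu> A < \<infinity>)"

definition bfm_algebra :: "'y::polish_space measure measure" where
  "bfm_algebra =
     (SUP A\<in>sets borel. vimage_algebra {\<mu>. boundedly_finite \<mu>} (\<lambda>\<mu>. emeasure \<mu> A) borel)"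

definition non_atomic :: "'a measure \<Rightarrow> bool" where
  "non_atomic M \<longleftrightarrow>
     (\<forall>A\<in>sets M. 0 < emeasure M A \<longrightarrow>
        (\<exists>B\<in>sets M. B \<subseteq> A \<and> 0 < emeasure M B \<and> emeasure M B < emeasure M A))"

text \<open>Scale is 1; shape 0 is read as the point mass at 0.\<close>

definition gamma_distr :: "real \<Rightarrow> real measure" where
  "gamma_distr a =
     (if a = 0 then return borel 0
      else density lborel
        (\<lambda>x. ennreal (indicator {0<..} x * (x powr (a - 1) * exp (- x) / Gamma a))))"

definition beta_distr :: "real \<Rightarrow> real \<Rightarrow> real measure" where
  "beta_distr a b =
     density lborel
       (\<lambda>u. ennreal (indicator {0<..<1} u *
          (Gamma (a + b) / (Gamma a * Gamma b) * u powr (a - 1) * (1 - u) powr (b - 1))))"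

text \<open>
  \<open>gamma_process_law \<nu> G\<close> says that \<open>G\<close> is the law of the gamma process with shape \<open>\<nu>\<close>.
  Values \<open>\<mu>(A)\<close> are compared as extended nonnegative reals, so that \<open>\<mu>(A) = \<infinity>\<close>, which is
  possible for unbounded \<open>A\<close>, has probability 0.  A finite disjoint family is covered by
  padding it with empty sets.
\<close>

definition gamma_process_law :: "'y::polish_space measure \<Rightarrow> 'y measure measure \<Rightarrow> bool" where
  "gamma_process_law \<nu> G \<longleftrightarrow>
     sets G = sets bfm_algebra \<and> prob_space G \<and>
     (\<forall>A\<in>sets borel.
        distr G borel (\<lambda>\<mu>. emeasure \<mu> A) = distr (gamma_distr (measure \<nu> A)) borel ennreal) \<and>
     (\<forall>A :: nat \<Rightarrow> 'y set. range A \<subseteq> sets borel \<and> disjoint_family A \<longrightarrow>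
        prob_space.indep_vars G (\<lambda>_. borel) (\<lambda>i \<mu>. emeasure \<mu> (A i)) UNIV)"

text \<open>
  The law \<open>BG(\<nu>, m)\<close>: for \<open>\<nu> = \<theta>H\<close> and \<open>m = \<theta> - q\<close> the constant is \<open>\<Gamma>(\<theta>) / \<Gamma>(q)\<close>.
  The real number \<open>measure \<mu> UNIV\<close> is the total mass \<open>T\<close> except when \<open>T = \<infinity>\<close>, which is a null
  event under the gamma process law (and so is \<open>T = 0\<close> if \<open>\<nu>\<close> is not null).
\<close>

definition beta_gamma_law ::
    "'y::polish_space measure \<Rightarrow> real \<Rightarrow> 'y measure measure \<Rightarrow> bool" where
  "beta_gamma_law \<nu> m L \<longleftrightarrow>
     (\<exists>G. gamma_process_law \<nu> G \<and>
        L = density G (\<lambda>\<mu>. ennreal (Gamma (measure \<nu> UNIV) / Gamma (measure \<nu> UNIV - m)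
                                      * measure \<mu> UNIV powr (- m))))"

text \<open>
  On the null event that the total mass is 0 or \<open>\<infinity>\<close> the result is the null measure; the
  values therefore lie in \<^const>\<open>subprob_algebra\<close>.
\<close>

definition normalized :: "'y::polish_space measure \<Rightarrow> 'y measure" where
  "normalized \<mu> = scale_measure (1 / emeasure \<mu> UNIV) \<mu>"

definition dirichlet_process_law ::
    "'y::polish_space measure \<Rightarrow> 'y measure measure \<Rightarrow> bool" where
  "dirichlet_process_law \<nu> D \<longleftrightarrow>
     (\<exists>G. gamma_process_law \<nu> G \<and> D = distr G (subprob_algebra borel) normalized)"

text \<open>
  Conditionally on the random element \<open>X\<close> of \<open>N\<close>, the variables \<open>Y i\<close>, \<open>i \<in> I\<close>, are i.i.d.
  with law \<open>P\<close>.  For a posterior of \<open>\<mu>\<close> given samples from \<open>P = \<mu>/T\<close> one has to take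
  \<open>X = \<mu>\<close>: conditioning on \<open>P\<close> alone would leave the dependence of the \<open>Y i\<close> on \<open>T\<close> open.
\<close>

definition cond_iid ::
    "'w measure \<Rightarrow> ('w \<Rightarrow> 'x) \<Rightarrow> 'x measure \<Rightarrow> nat set \<Rightarrow> (nat \<Rightarrow> 'w \<Rightarrow> 'y::polish_space)
       \<Rightarrow> ('w \<Rightarrow> 'y measure) \<Rightarrow> bool" where
  "cond_iid M X N I Y P \<longleftrightarrow>
     (\<forall>i\<in>I. Y i \<in> borel_measurable M) \<and>
     (\<forall>A. (\<forall>i\<in>I. A i \<in> sets borel) \<longrightarrow>
        (AE \<omega> in M.
           real_cond_exp M (vimage_algebra (space M) X N)
             (indicator {\<omega>\<in>space M. \<forall>i\<in>I. Y i \<omega> \<in> A i}) \<omega>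
           = (\<Prod>i\<in>I. measure (P \<omega>) (A i))))"

text \<open>
  The Markov kernel \<open>K\<close> is a regular version of the conditional distribution of the random
  element \<open>X\<close> of \<open>N\<close> given the random element \<open>Z\<close> of \<open>S\<close>.
\<close>

definition posterior_distribution ::
    "'w measure \<Rightarrow> ('w \<Rightarrow> 'x) \<Rightarrow> 'x measure \<Rightarrow> ('w \<Rightarrow> 'z) \<Rightarrow> 'z measure
       \<Rightarrow> ('z \<Rightarrow> 'x measure) \<Rightarrow> bool" where
  "posterior_distribution M X N Z S K \<longleftrightarrow>
     K \<in> measurable S (prob_algebra N) \<and>
     (\<forall>B\<in>sets N. AE \<omega> in M.
        real_cond_exp M (vimage_algebra (space M) Z S) (indicator {\<omega>\<in>space M. X \<omega> \<in> B}) \<omega>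
        = measure (K (Z \<omega>)) B)"

definition updated_shape ::
    "'y::polish_space measure \<Rightarrow> nat \<Rightarrow> (nat \<Rightarrow> 'y) \<Rightarrow> 'y measure" where
  "updated_shape \<nu> n y =
     measure_of UNIV (sets borel)
       (\<lambda>A. emeasure \<nu> A + (\<Sum>i=1..n. emeasure (return borel (y i)) A))"

lemma sets_updated_shape: "sets (updated_shape \<nu> n y) = sets borel"
  unfolding updated_shape_def using sets.sigma_sets_eq[of "borel :: 'a measure"] by simp

lemma emeasure_updated_shape:
  assumes "sets \<nu> = sets borel" "A \<in> sets borel"
  shows "emeasure (updated_shape \<nu> n y) A
           = emeasure \<nu> A + (\<Sum>i=1..n. emeasure (return borel (y i)) A)"
proof (rule emeasure_measure_of[OF updated_shape_def])
  show "A \<in> sets (updated_shape \<nu> n y)"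
    using assms by (simp add: sets_updated_shape)
  let ?f = "\<lambda>A. emeasure \<nu> A + (\<Sum>i=1..n. emeasure (return borel (y i)) A)"
  show "positive (sets (updated_shape \<nu> n y)) ?f"
    by (simp add: positive_def)
  show "countably_additive (sets (updated_shape \<nu> n y)) ?f"
  proof (rule countably_additiveI)
    fix B :: "nat \<Rightarrow> 'a set"
    assume "range B \<subseteq> sets (updated_shape \<nu> n y)" and d: "disjoint_family B"
    then have r: "range B \<subseteq> sets borel" by (simp add: sets_updated_shape)
    have "(\<Sum>k. ?f (B k)) = (\<Sum>k. emeasure \<nu> (B k))
            + (\<Sum>i=1..n. (\<Sum>k. emeasure (return borel (y i)) (B k)))"
      by (subst suminf_add[symmetric]) (simp_all add: suminf_sum del: emeasure_return)
    also have "\<dots> = ?f (\<Union>k. B k)"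
      using r d assms(1) by (simp add: suminf_emeasure del: emeasure_return)
    finally show "(\<Sum>k. ?f (B k)) = ?f (\<Union>k. B k)" .
  qed
qed simp

text \<open>\<open>exp (- x)\<close>, with value 0 at \<open>\<infinity>\<close>.\<close>

definition exp_neg :: "ennreal \<Rightarrow> real" where
  "exp_neg x = (if x = \<infinity> then 0 else exp (- enn2real x))"

definition laplace_functional :: "'y measure measure \<Rightarrow> ('y \<Rightarrow> real) \<Rightarrow> real" where
  "laplace_functional L g = (\<integral>\<mu>. exp_neg (\<integral>\<^sup>+x. ennreal (g x) \<partial>\<mu>) \<partial>L)"

text \<open>The blocks \<open>C\<^sub>j\<close> of the partition induced by ties are indexed by the distinct values.\<close>

definition block :: "nat \<Rightarrow> (nat \<Rightarrow> 'y) \<Rightarrow> 'y \<Rightarrow> nat set" where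
  "block n y z = {i\<in>{1..n}. y i = z}"

end

theory Submission
  imports Defs
begin

text \<open>
  Sampling from \<open>P = \<mu>/T\<close> weights the law of \<open>\<mu>\<close> by \<open>\<mu>(A\<^sub>1) \<dots> \<mu>(A\<^sub>n) T\<^sup>-\<^sup>n\<close> on the event that
  \<open>Y\<^sub>i \<in> A\<^sub>i\<close> for all \<open>i\<close>.  The product \<open>\<mu>(A\<^sub>1) \<dots> \<mu>(A\<^sub>n)\<close> is dealt with by the Palm formula of the
  gamma process: weighting \<open>\<G>(d\<mu>|\<nu>)\<close> by \<open>\<mu>(dy)\<close> gives \<open>\<nu>(dy) \<G>(d\<mu>|\<nu> + \<delta>\<^sub>y)\<close>, because \<open>x\<close> times
  the gamma density of shape \<open>a\<close> is \<open>a\<close> times that of shape \<open>a + 1\<close> (\<open>gamma_process_mecke\<close>).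
  Iteration (\<open>gamma_process_palm\<close>) gives the shape \<open>\<theta>H + \<Sum>\<delta>\<^sub>y\<^sub>i\<close>, and the points \<open>y\<^sub>i\<close> are drawn from the
  Blackwell-MacQueen urn, up to the factor \<open>\<Gamma>(\<theta> + n)/\<Gamma>(\<theta>)\<close>.  The factor \<open>T\<^sup>-\<^sup>n\<close> joins the
  weight \<open>T\<^sup>-\<^sup>(\<^sup>\<theta>\<^sup>-\<^sup>q\<^sup>)\<close> of the beta-gamma law, and the constants combine to exactly \<open>\<Gamma>(\<theta> + n)/\<Gamma>(q)\<close>:
  the joint law of \<open>Y\<close> and \<open>\<mu>\<close> is the urn law times the kernel in the statement
  (\<open>beta_gamma_joint_rectangle\<close>), which is Bayes' theorem.

  Gamma processes of the updated shapes are built from that of shape \<open>\<theta>H\<close> by adding atoms with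
  independent exponential masses (\<open>gamma_process_attach_atom\<close>).  This makes the kernel measurable
  in \<open>y\<close>, and as the finite-dimensional laws determine the law (\<open>measure_eqI_bfm\<close>), any other gamma
  process law of the same shape gives the same kernel.

  That \<open>P\<close> is a Dirichlet process also under the beta-gamma law is the independence of \<open>T\<close> and
  \<open>P\<close> under the gamma process law, a consequence of the behaviour of that law under scaling
  (\<open>gamma_process_total_mass_independent\<close>).

  For the Laplace functional, write \<open>T\<^sup>-\<^sup>m\<close> with \<open>m = \<theta> + n - q > 0\<close> as a mixture of the
  exponentials \<open>exp (- s T)\<close>, apply the Laplace functional of the gamma process to \<open>g + s\<close>, and
  substitute \<open>u = 1/(1 + s)\<close> (\<open>beta_gamma_laplace\<close>); a unit atom of the shape at \<open>y\<close>
  contributes the factor \<open>(1 + u g(y))\<^sup>-\<^sup>1\<close>.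
\<close>

section \<open>The space of boundedly finite measures\<close>

lemma space_bfm_algebra: "space bfm_algebra = {\<mu>. boundedly_finite \<mu>}"
  by (auto simp: bfm_algebra_def space_Sup_eq_UN)

lemma measurable_emeasure_bfm [measurable]:
  "A \<in> sets borel \<Longrightarrow> (\<lambda>\<mu>. emeasure \<mu> A) \<in> borel_measurable bfm_algebra"
  by (auto intro!: measurable_Sup1 measurable_vimage_algebra1 simp: bfm_algebra_def)

lemma measurable_measure_bfm [measurable]:
  "A \<in> sets borel \<Longrightarrow> (\<lambda>\<mu>. measure \<mu> A) \<in> borel_measurable bfm_algebra"
  unfolding measure_def by (intro borel_measurable_enn2real measurable_emeasure_bfm)

lemma measurable_bfmI:
  assumes "\<And>x. x \<in> space M \<Longrightarrow> boundedly_finite (f x)"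
    and "\<And>A. A \<in> sets borel \<Longrightarrow> (\<lambda>x. emeasure (f x) A) \<in> borel_measurable M"
  shows "f \<in> measurable M bfm_algebra"
  using assms by (auto intro!: measurable_Sup2 measurable_vimage_algebra2 simp: bfm_algebra_def)

lemma sets_of_boundedly_finite: "\<mu> \<in> space bfm_algebra \<Longrightarrow> sets \<mu> = sets borel"
  by (simp add: space_bfm_algebra boundedly_finite_def)

section \<open>Gamma distributions on the extended half-line\<close>

definition gamma_ennreal :: "real \<Rightarrow> ennreal measure" where
  "gamma_ennreal a = distr (gamma_distr a) borel ennreal"

lemma sets_gamma_distr [simp, measurable_cong]: "sets (gamma_distr a) = sets borel"
  by (simp add: gamma_distr_def)

lemma space_gamma_distr [simp]: "space (gamma_distr a) = UNIV"
  by (simp add: gamma_distr_def)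

lemma sets_gamma_ennreal [simp, measurable_cong]: "sets (gamma_ennreal a) = sets borel"
  by (simp add: gamma_ennreal_def)

lemma space_gamma_ennreal [simp]: "space (gamma_ennreal a) = UNIV"
  by (simp add: gamma_ennreal_def)

lemma nn_integral_lborel_cong_except:
  assumes "\<And>x. x \<notin> {a, b} \<Longrightarrow> f x = g x"
  shows "(\<integral>\<^sup>+x. f x \<partial>lborel) = (\<integral>\<^sup>+x. g x \<partial>lborel)"
proof (rule nn_integral_cong_AE)
  show "AE x in lborel. f x = g x"
    using AE_lborel_singleton[of a] AE_lborel_singleton[of b] by eventually_elim (use assms in auto)
qed

lemma prob_space_gamma_distr:
  assumes "0 \<le> a" shows "prob_space (gamma_distr a)"
proof (cases "a = 0")
  case False
  then have a: "a > 0" using assms by simp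
  have "(\<integral>\<^sup>+x. ennreal (indicator {0<..} x * (x powr (a - 1) * exp (- x) / Gamma a)) \<partial>lborel)
      = (\<integral>\<^sup>+x. ennreal (1 / Gamma a) * ennreal (indicator {0..} x * x powr (a - 1) / exp x) \<partial>lborel)"
    using a Gamma_real_pos[OF a] by (intro nn_integral_lborel_cong_except[of 0 0])
      (auto simp: ennreal_mult[symmetric] exp_minus divide_inverse mult_ac split: split_indicator)
  also have "\<dots> = ennreal (1 / Gamma a) * ennreal (Gamma a)"
    using a by (simp add: nn_integral_cmult Gamma_conv_nn_integral_real)
  also have "\<dots> = 1"
    using Gamma_real_pos[OF a] by (simp add: ennreal_mult[symmetric])
  finally show ?thesis
    using False by (intro prob_spaceI) (simp add: gamma_distr_def emeasure_density)
qed (simp add: gamma_distr_def prob_space_return)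

lemma prob_space_gamma_ennreal: "0 \<le> a \<Longrightarrow> prob_space (gamma_ennreal a)"
  unfolding gamma_ennreal_def
  by (intro prob_space.prob_space_distr prob_space_gamma_distr) auto

lemma gamma_ennreal_0: "gamma_ennreal 0 = return borel 0"
  by (simp add: gamma_ennreal_def gamma_distr_def distr_return)

lemma nn_integral_gamma_distr:
  assumes "a \<noteq> 0" "f \<in> borel_measurable borel"
  shows "(\<integral>\<^sup>+x. f x \<partial>gamma_distr a)
    = (\<integral>\<^sup>+x. ennreal (indicator {0<..} x * (x powr (a - 1) * exp (- x) / Gamma a)) * f x \<partial>lborel)"
  using assms by (simp add: gamma_distr_def nn_integral_density)

lemma nn_integral_gamma_ennreal:
  assumes "f \<in> borel_measurable borel"
  shows "(\<integral>\<^sup>+x. f x \<partial>gamma_ennreal a) = (\<integral>\<^sup>+x. f (ennreal x) \<partial>gamma_distr a)"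
  using assms by (simp add: gamma_ennreal_def nn_integral_distr)

lemma AE_gamma_ennreal_finite: "AE x in gamma_ennreal a. x < \<infinity>"
  unfolding gamma_ennreal_def by (subst AE_distr_iff) auto

lemma AE_gamma_distr_pos:
  assumes "0 < a" shows "AE x in gamma_distr a. 0 < x"
proof -
  have eq: "gamma_distr a = density lborel
      (\<lambda>x. ennreal (indicator {0<..} x * (x powr (a - 1) * exp (- x) / Gamma a)))"
    using assms by (simp add: gamma_distr_def)
  have "0 < x" if "0 < ennreal (indicator {0<..} x * (x powr (a - 1) * exp (- x) / Gamma a))" for x
    using that by (cases "0 < x") simp_all
  note pos = this
  show ?thesis
    unfolding eq by (subst AE_density, simp, rule AE_I2, rule impI, erule pos)
qed

lemma ennreal_mult_assoc2: "0 \<le> p \<Longrightarrow> 0 \<le> r \<Longrightarrow> ennreal p * (ennreal r * z) = ennreal (p * r) * z"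
  by (simp add: ennreal_mult mult.assoc)

lemma gamma_size_bias:
  assumes a: "0 \<le> a" and [measurable]: "f \<in> borel_measurable borel"
  shows "(\<integral>\<^sup>+x. x * f x \<partial>gamma_ennreal a) = ennreal a * (\<integral>\<^sup>+x. f x \<partial>gamma_ennreal (a + 1))"
proof (cases "a = 0")
  case False
  then have a: "a > 0" "a + 1 > 0" using assms by simp_all
  have G: "Gamma (a + 1) = a * Gamma a" using a by (intro Gamma_plus1) (auto elim!: nonpos_Ints_cases)
  have "ennreal (indicator {0<..} x * (x powr (a - 1) * exp (- x) / Gamma a)) * (ennreal x * f (ennreal x))
     = ennreal a * (ennreal (indicator {0<..} x * (x powr (a + 1 - 1) * exp (- x) / Gamma (a + 1)))
         * f (ennreal x))" for x
  proof (cases "x > 0")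
    case True
    then have "x powr (a - 1) * exp (- x) / Gamma a * x
        = a * (x powr (a + 1 - 1) * exp (- x) / Gamma (a + 1))"
      using a G powr_add[of x "a - 1" 1] Gamma_real_pos[OF a(1)] by (simp add: field_simps)
    then show ?thesis
      using True a Gamma_real_pos[OF a(1)] Gamma_real_pos[OF a(2)]
      by (simp add: mult.assoc[symmetric] ennreal_mult[symmetric])
  qed simp
  then show ?thesis
    using a by (simp add: nn_integral_gamma_ennreal nn_integral_gamma_distr nn_integral_cmult)
qed (simp add: gamma_ennreal_0 nn_integral_return)

text \<open>
  Rescaling by \<open>c\<close> is the exponential tilt with parameter \<open>1/c - 1\<close>.  The normalizing constant
  \<open>c\<^sup>-\<^sup>a\<close> is multiplicative in the shape \<open>a\<close>, so this carries over to the whole gamma process.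
\<close>

lemma gamma_scaling:
  assumes a: "0 \<le> a" and c: "0 < c" and [measurable]: "f \<in> borel_measurable borel"
  shows "(\<integral>\<^sup>+x. f (ennreal c * x) \<partial>gamma_ennreal a)
    = (\<integral>\<^sup>+x. ennreal (c powr (- a) * exp (- (1 / c - 1) * enn2real x)) * f x \<partial>gamma_ennreal a)"
proof (cases "a = 0")
  case False
  then have a: "a > 0" using assms by simp
  note Gamma_real_pos[OF a, simp]
  then have [simp]: "0 \<le> Gamma a" by linarith
  let ?d = "\<lambda>x::real. indicator {0<..} x * (x powr (a - 1) * exp (- x) / Gamma a)"
  let ?t = "\<lambda>x::real. c powr (- a) * exp (- (1 / c - 1) * x)"
  have "(\<integral>\<^sup>+x. ennreal (?d x) * (ennreal (?t (enn2real (ennreal x))) * f (ennreal x)) \<partial>lborel)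
     = ennreal \<bar>c\<bar> * (\<integral>\<^sup>+x. ennreal (?d (0 + c * x)) *
           (ennreal (?t (enn2real (ennreal (0 + c * x)))) * f (ennreal (0 + c * x))) \<partial>lborel)"
    using c by (subst nn_integral_real_affine[where c = c and t = 0]) simp_all
  also have "\<dots> = (\<integral>\<^sup>+x. ennreal (?d x) * f (ennreal c * ennreal x) \<partial>lborel)"
  proof (subst nn_integral_cmult[symmetric], simp, intro nn_integral_cong)
    fix x :: real
    show "ennreal \<bar>c\<bar> * (ennreal (?d (0 + c * x)) *
           (ennreal (?t (enn2real (ennreal (0 + c * x)))) * f (ennreal (0 + c * x))))
        = ennreal (?d x) * f (ennreal c * ennreal x)"
    proof (cases "x > 0")
      case True
      have e: "exp (- (c * x)) * exp (- (1 / c - 1) * (c * x)) = exp (- x)"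
        using c by (simp add: exp_add[symmetric] field_simps)
      have p: "c * c powr (a - 1) * c powr (- a) = 1"
        using c powr_add[of c 1 "a - 1"] powr_add[of c a "- a"] by simp
      have "c * ((c * x) powr (a - 1) * exp (- (c * x)) / Gamma a) * ?t (c * x)
          = (c * c powr (a - 1) * c powr (- a)) * (x powr (a - 1) / Gamma a)
              * (exp (- (c * x)) * exp (- (1 / c - 1) * (c * x)))"
        using True c by (simp add: powr_mult)
      also have "\<dots> = x powr (a - 1) * exp (- x) / Gamma a"
        unfolding e p by simp
      finally have "c * ((c * x) powr (a - 1) * exp (- (c * x)) / Gamma a) * ?t (c * x)
          = x powr (a - 1) * exp (- x) / Gamma a" .
      note eq1 = this
      have eq2: "ennreal \<bar>c\<bar> * (ennreal (?d (0 + c * x)) *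
           (ennreal (?t (enn2real (ennreal (0 + c * x)))) * f (ennreal (0 + c * x))))
        = ennreal (c * ((c * x) powr (a - 1) * exp (- (c * x)) / Gamma a) * ?t (c * x))
           * f (ennreal (c * x))"
      proof -
        have e: "\<bar>c\<bar> = c" "0 + c * x = c * x" "enn2real (ennreal (c * x)) = c * x"
          "?d (c * x) = (c * x) powr (a - 1) * exp (- (c * x)) / Gamma a"
          using True c by simp_all
        have n: "0 \<le> c" "0 \<le> (c * x) powr (a - 1) * exp (- (c * x)) / Gamma a"
          "0 \<le> c * ((c * x) powr (a - 1) * exp (- (c * x)) / Gamma a)" "0 \<le> ?t (c * x)"
          using True c by simp_all
        show ?thesis
          unfolding e ennreal_mult_assoc2[OF n(1,2)] ennreal_mult_assoc2[OF n(3,4)] ..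
      qed
      show ?thesis
        unfolding eq2 eq1 using True c by (simp add: ennreal_mult)
    next
      case False
      then have "\<not> 0 < c * x" using c by (simp add: zero_less_mult_iff)
      with False show ?thesis by simp
    qed
  qed
  finally show ?thesis
    using a by (simp add: nn_integral_gamma_ennreal nn_integral_gamma_distr)
qed (use c in \<open>simp add: gamma_ennreal_0 nn_integral_return\<close>)

lemma gamma_laplace:
  assumes a: "0 \<le> a" and s: "0 \<le> s"
  shows "(\<integral>\<^sup>+x. ennreal (exp (- s * enn2real x)) \<partial>gamma_ennreal a) = ennreal ((1 + s) powr (- a))"
proof -
  interpret prob_space "gamma_ennreal a" by (rule prob_space_gamma_ennreal[OF a])
  define c where "c = 1 / (1 + s)"
  have c: "c > 0" "1 / c - 1 = s" using s by (auto simp: c_def)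
  have p: "(1 + s) powr (- a) * c powr (- a) = 1"
    using s by (simp add: c_def powr_divide powr_minus field_simps)
  have "1 = ennreal (c powr (- a)) * (\<integral>\<^sup>+x. ennreal (exp (- s * enn2real x)) \<partial>gamma_ennreal a)"
    using gamma_scaling[OF a c(1), of "\<lambda>_. 1"] emeasure_space_1
    by (simp add: c ennreal_mult nn_integral_cmult)
  then have "ennreal ((1 + s) powr (- a)) = ennreal ((1 + s) powr (- a)) * ennreal (c powr (- a))
      * (\<integral>\<^sup>+x. ennreal (exp (- s * enn2real x)) \<partial>gamma_ennreal a)"
    by (metis mult.assoc mult.right_neutral)
  also have "ennreal ((1 + s) powr (- a)) * ennreal (c powr (- a)) = 1"
    by (simp add: ennreal_mult[symmetric] p)
  finally show ?thesis by simp
qed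

lemma gamma_negative_moment:
  assumes a: "0 < a" and m: "0 < a - m"
  shows "(\<integral>\<^sup>+x. ennreal (enn2real x powr (- m)) \<partial>gamma_ennreal a) = ennreal (Gamma (a - m) / Gamma a)"
proof -
  note Gamma_real_pos[OF a, simp]
  then have [simp]: "0 \<le> Gamma a" by linarith
  have "(\<integral>\<^sup>+x. ennreal (indicator {0<..} x * (x powr (a - 1) * exp (- x) / Gamma a))
          * ennreal (enn2real (ennreal x) powr (- m)) \<partial>lborel)
      = (\<integral>\<^sup>+x. ennreal (1 / Gamma a) * ennreal (indicator {0..} x * x powr (a - m - 1) / exp x) \<partial>lborel)"
  proof (rule nn_integral_lborel_cong_except[of 0 0])
    fix x :: real assume "x \<notin> {0, 0}"
    show "ennreal (indicator {0<..} x * (x powr (a - 1) * exp (- x) / Gamma a))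
          * ennreal (enn2real (ennreal x) powr (- m))
        = ennreal (1 / Gamma a) * ennreal (indicator {0..} x * x powr (a - m - 1) / exp x)"
      using \<open>x \<notin> {0, 0}\<close> powr_add[of x "a - 1" "- m"]
      by (auto simp: ennreal_mult[symmetric] exp_minus divide_inverse algebra_simps split: split_indicator)
  qed
  also have "\<dots> = ennreal (1 / Gamma a) * ennreal (Gamma (a - m))"
    using m by (simp add: nn_integral_cmult Gamma_conv_nn_integral_real)
  finally show ?thesis
    using a m Gamma_real_pos[OF m]
    by (simp add: nn_integral_gamma_ennreal nn_integral_gamma_distr ennreal_mult[symmetric])
qed

lemma nn_integral_powr_0:
  assumes a: "0 < a" and v: "0 < v"
  shows "(\<integral>\<^sup>+x. ennreal (indicator {0<..<v} x * x powr (a - 1)) \<partial>lborel) = ennreal (v powr a / a)"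
proof -
  have "((\<lambda>x. x powr (a - 1)) has_integral (v powr (a - 1 + 1) / (a - 1 + 1))) {0..v}"
    using a v by (intro has_integral_powr_from_0) auto
  then have "(\<integral>\<^sup>+x. ennreal (indicator {0..v} x * x powr (a - 1)) \<partial>lborel) = ennreal (v powr a / a)"
    using nn_integral_has_integral_lebesgue[of "{0..v}" "\<lambda>x. x powr (a - 1)"] by simp
  also have "(\<integral>\<^sup>+x. ennreal (indicator {0..v} x * x powr (a - 1)) \<partial>lborel)
      = (\<integral>\<^sup>+x. ennreal (indicator {0<..<v} x * x powr (a - 1)) \<partial>lborel)"
    by (rule nn_integral_lborel_cong_except[of 0 v]) (auto split: split_indicator)
  finally show ?thesis .
qed

text \<open>
  Convolution with the exponential law \<open>gamma_distr 1\<close> is the one case of the additivity of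
  gamma laws that the proof uses: an observation adds a unit atom to the shape.
\<close>

lemma gamma_convolution_exponential:
  assumes a: "0 \<le> a" and [measurable]: "f \<in> borel_measurable borel"
  shows "(\<integral>\<^sup>+x. \<integral>\<^sup>+t. f (x + ennreal t) \<partial>gamma_distr 1 \<partial>gamma_ennreal a)
    = (\<integral>\<^sup>+x. f x \<partial>gamma_ennreal (a + 1))"
proof (cases "a = 0")
  case False
  then have a: "a > 0" "a + 1 > 0" using assms by simp_all
  have G: "Gamma (a + 1) = a * Gamma a" using a by (intro Gamma_plus1) (auto elim!: nonpos_Ints_cases)
  note Gamma_real_pos[OF a(1), simp]
  then have [simp]: "0 \<le> Gamma a" by linarith
  let ?d = "\<lambda>a x::real. indicator {0<..} x * (x powr (a - 1) * exp (- x) / Gamma a)"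
  let ?k = "\<lambda>x v. ennreal (indicator {0<..<v} x * x powr (a - 1) * (exp (- v) / Gamma a)) * f (ennreal v)"
  have [simp]: "sigma_finite_measure (gamma_distr 1)"
    using prob_space_gamma_distr[of 1] by (simp add: prob_space_imp_sigma_finite)
  have [measurable]: "(\<lambda>x. \<integral>\<^sup>+t. f (x + ennreal t) \<partial>gamma_distr 1) \<in> borel_measurable borel"
    by (intro sigma_finite_measure.borel_measurable_nn_integral) simp_all
  have "(\<integral>\<^sup>+x. \<integral>\<^sup>+t. f (x + ennreal t) \<partial>gamma_distr 1 \<partial>gamma_ennreal a)
     = (\<integral>\<^sup>+x. ennreal (?d a x) * (\<integral>\<^sup>+t. ennreal (?d 1 t) * f (ennreal x + ennreal t) \<partial>lborel) \<partial>lborel)"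
    using a by (simp add: nn_integral_gamma_ennreal nn_integral_gamma_distr)
  also have "\<dots> = (\<integral>\<^sup>+x. \<integral>\<^sup>+v. ?k x v \<partial>lborel \<partial>lborel)"
  proof (intro nn_integral_cong)
    fix x :: real
    have "ennreal (?d a x) * (\<integral>\<^sup>+t. ennreal (?d 1 t) * f (ennreal x + ennreal t) \<partial>lborel)
       = (\<integral>\<^sup>+t. ennreal (?d a x) * (ennreal (?d 1 t) * f (ennreal x + ennreal t)) \<partial>lborel)"
      by (simp add: nn_integral_cmult)
    also have "\<dots> = (\<integral>\<^sup>+v. ennreal (?d a x) * (ennreal (?d 1 (- x + 1 * v))
          * f (ennreal x + ennreal (- x + 1 * v))) \<partial>lborel)"
      by (subst nn_integral_real_affine[where c = 1 and t = "- x"]) simp_all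
    also have "\<dots> = (\<integral>\<^sup>+v. ?k x v \<partial>lborel)"
    proof (intro nn_integral_cong)
      fix v :: real
      show "ennreal (?d a x) * (ennreal (?d 1 (- x + 1 * v)) * f (ennreal x + ennreal (- x + 1 * v)))
        = ennreal (indicator {0<..<v} x * x powr (a - 1) * (exp (- v) / Gamma a)) * f (ennreal v)"
      proof (cases "0 < x \<and> x < v")
        case True
        have "x powr (a - 1) * exp (- x) / Gamma a * exp (- (- x + v))
            = x powr (a - 1) * (exp (- v) / Gamma a)"
          by (simp add: exp_diff exp_minus field_simps)
        then have e1: "?d a x * ?d 1 (- x + 1 * v)
            = indicator {0<..<v} x * x powr (a - 1) * (exp (- v) / Gamma a)"
          using True by simp
        have e2: "ennreal x + ennreal (- x + 1 * v) = ennreal v"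
          using True by (subst ennreal_plus[symmetric]) auto
        have n: "0 \<le> ?d a x" "0 \<le> ?d 1 (- x + 1 * v)"
          by simp_all
        show ?thesis
          unfolding ennreal_mult_assoc2[OF n] e1 e2 ..
      qed (auto split: split_indicator)
    qed
    finally show "ennreal (?d a x) * (\<integral>\<^sup>+t. ennreal (?d 1 t) * f (ennreal x + ennreal t) \<partial>lborel)
       = (\<integral>\<^sup>+v. ?k x v \<partial>lborel)" .
  qed
  also have "\<dots> = (\<integral>\<^sup>+v. \<integral>\<^sup>+x. ?k x v \<partial>lborel \<partial>lborel)"
  proof (rule lborel_pair.Fubini'[symmetric])
    have [measurable]: "(\<lambda>p :: real \<times> real. indicator {0<..<snd p} (fst p) :: real) \<in> borel_measurable (lborel \<Otimes>\<^sub>M lborel)"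
      unfolding indicator_def greaterThanLessThan_iff by measurable
    show "(\<lambda>(x, v). ?k x v) \<in> borel_measurable (lborel \<Otimes>\<^sub>M lborel)"
      by (simp add: split_beta')
  qed
  also have "\<dots> = (\<integral>\<^sup>+v. ennreal (?d (a + 1) v) * f (ennreal v) \<partial>lborel)"
  proof (intro nn_integral_cong)
    fix v :: real
    have "(\<integral>\<^sup>+x. ?k x v \<partial>lborel)
      = (\<integral>\<^sup>+x. ennreal (indicator {0<..<v} x * x powr (a - 1)) \<partial>lborel)
          * (ennreal (exp (- v) / Gamma a) * f (ennreal v))"
      by (subst nn_integral_multc[symmetric], simp, rule nn_integral_cong,
          subst ennreal_mult_assoc2) simp_all
    also have "\<dots> = ennreal (?d (a + 1) v) * f (ennreal v)"
    proof (cases "v > 0")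
      case True
      then show ?thesis
        using a G by (simp add: nn_integral_powr_0 mult.assoc[symmetric] ennreal_mult[symmetric])
    qed (simp split: split_indicator)
    finally show "(\<integral>\<^sup>+x. ?k x v \<partial>lborel) = ennreal (?d (a + 1) v) * f (ennreal v)" .
  qed
  also have "\<dots> = (\<integral>\<^sup>+x. f x \<partial>gamma_ennreal (a + 1))"
    using a by (simp add: nn_integral_gamma_ennreal nn_integral_gamma_distr)
  finally show ?thesis .
next
  case True
  have [simp]: "sigma_finite_measure (gamma_distr 1)"
    using prob_space_gamma_distr[of 1] by (simp add: prob_space_imp_sigma_finite)
  have "(\<lambda>x. \<integral>\<^sup>+t. f (x + ennreal t) \<partial>gamma_distr 1) \<in> borel_measurable borel"
    by (intro sigma_finite_measure.borel_measurable_nn_integral) simp_all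
  then show ?thesis
    using True by (simp add: gamma_ennreal_0 nn_integral_return nn_integral_gamma_ennreal)
qed

section \<open>Finite-dimensional laws of the gamma process\<close>

lemma gamma_process_lawD:
  assumes "gamma_process_law \<nu> G"
  shows "sets G = sets bfm_algebra" "space G = space bfm_algebra" "prob_space G"
  using assms sets_eq_imp_space_eq[of G bfm_algebra] by (simp_all add: gamma_process_law_def)

lemma gamma_process_marginal:
  assumes "gamma_process_law \<nu> G" "A \<in> sets borel"
  shows "distr G borel (\<lambda>\<mu>. emeasure \<mu> A) = gamma_ennreal (measure \<nu> A)"
  using assms by (simp add: gamma_process_law_def gamma_ennreal_def)

lemma gamma_process_nn_integral:
  assumes G: "gamma_process_law \<nu> G" and [measurable]: "A \<in> sets borel" "h \<in> borel_measurable borel"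
  shows "(\<integral>\<^sup>+\<mu>. h (emeasure \<mu> A) \<partial>G) = (\<integral>\<^sup>+x. h x \<partial>gamma_ennreal (measure \<nu> A))"
proof -
  note [measurable_cong] = gamma_process_lawD(1)[OF G]
  show ?thesis
    unfolding gamma_process_marginal[OF G assms(2), symmetric] by (subst nn_integral_distr) simp_all
qed

lemma gamma_process_AE:
  assumes G: "gamma_process_law \<nu> G" and [measurable]: "A \<in> sets borel" "Measurable.pred borel P"
    and "AE x in gamma_ennreal (measure \<nu> A). P x"
  shows "AE \<mu> in G. P (emeasure \<mu> A)"
proof -
  note [measurable_cong] = gamma_process_lawD(1)[OF G]
  show ?thesis
    using assms(4) unfolding gamma_process_marginal[OF G assms(2), symmetric]
    by (subst (asm) AE_distr_iff) simp_all
qed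

lemma gamma_process_AE_finite:
  assumes G: "gamma_process_law \<nu> G" and "A \<in> sets borel"
  shows "AE \<mu> in G. emeasure \<mu> A < \<infinity>"
  by (rule gamma_process_AE[OF assms _ AE_gamma_ennreal_finite]) measurable

lemma gamma_process_nn_integral_prod:
  assumes G: "gamma_process_law \<nu> G"
    and A: "\<And>j. A j \<in> sets borel" "disjoint_family (A :: nat \<Rightarrow> _)"
    and J: "finite J" and [measurable]: "\<And>j. h j \<in> borel_measurable borel"
  shows "(\<integral>\<^sup>+\<mu>. (\<Prod>j\<in>J. h j (emeasure \<mu> (A j))) \<partial>G)
    = (\<Prod>j\<in>J. \<integral>\<^sup>+x. h j x \<partial>gamma_ennreal (measure \<nu> (A j)))"
proof -
  interpret prob_space G using G by (rule gamma_process_lawD)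
  have "indep_vars (\<lambda>_. borel) (\<lambda>i \<mu>. emeasure \<mu> (A i)) UNIV"
    using G A unfolding gamma_process_law_def by blast
  then have "indep_vars (\<lambda>_. borel) (\<lambda>i \<mu>. h i (emeasure \<mu> (A i))) J"
    by (intro indep_vars_compose2[where Y = h] indep_vars_subset[of _ _ UNIV J]) auto
  then have "(\<integral>\<^sup>+\<mu>. (\<Prod>j\<in>J. h j (emeasure \<mu> (A j))) \<partial>G)
      = (\<Prod>j\<in>J. \<integral>\<^sup>+\<mu>. h j (emeasure \<mu> (A j)) \<partial>G)"
    using J by (intro indep_vars_nn_integral) auto
  then show ?thesis
    using A by (simp add: gamma_process_nn_integral[OF G])
qed

lemma indicator_all_eq_prod:
  "finite J \<Longrightarrow> indicator {x\<in>S. \<forall>j\<in>J. f j x \<in> C j} x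
     = (if x \<in> S then (\<Prod>j\<in>J. indicator (C j) (f j x)) else (0 :: ennreal))"
  by (induction J rule: finite_induct) (auto split: split_indicator)

lemma sets_event_bfm [measurable]:
  assumes "finite J" "\<And>j. j \<in> J \<Longrightarrow> A j \<in> sets borel" "\<And>j. j \<in> J \<Longrightarrow> C j \<in> sets borel"
  shows "{\<mu>\<in>space bfm_algebra. \<forall>j\<in>J. emeasure \<mu> (A j) \<in> C j} \<in> sets bfm_algebra"
proof (rule sets.sets_Collect_finite_All[OF _ assms(1)])
  fix j assume "j \<in> J"
  then show "{\<mu> \<in> space bfm_algebra. emeasure \<mu> (A j) \<in> C j} \<in> sets bfm_algebra"
    using measurable_sets[OF measurable_emeasure_bfm, of "A j" "C j"] assms
    by (auto simp: vimage_def Int_def conj_commute)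
qed

lemma gamma_process_event:
  assumes G: "gamma_process_law \<nu> G"
    and A: "\<And>j. A j \<in> sets borel" "disjoint_family (A :: nat \<Rightarrow> _)"
    and J: "finite J" and C [measurable]: "\<And>j. C j \<in> sets borel"
  shows "emeasure G {\<mu>\<in>space bfm_algebra. \<forall>j\<in>J. emeasure \<mu> (A j) \<in> C j}
    = (\<Prod>j\<in>J. emeasure (gamma_ennreal (measure \<nu> (A j))) (C j))"
proof -
  have "emeasure G {\<mu>\<in>space bfm_algebra. \<forall>j\<in>J. emeasure \<mu> (A j) \<in> C j}
      = (\<integral>\<^sup>+\<mu>. indicator {\<mu>\<in>space bfm_algebra. \<forall>j\<in>J. emeasure \<mu> (A j) \<in> C j} \<mu> \<partial>G)"
    using gamma_process_lawD(1)[OF G] A J C by (subst nn_integral_indicator) simp_all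
  also have "\<dots> = (\<integral>\<^sup>+\<mu>. (\<Prod>j\<in>J. indicator (C j) (emeasure \<mu> (A j))) \<partial>G)"
    using J gamma_process_lawD(2)[OF G] by (intro nn_integral_cong) (simp add: indicator_all_eq_prod)
  also have "\<dots> = (\<Prod>j\<in>J. emeasure (gamma_ennreal (measure \<nu> (A j))) (C j))"
    by (subst gamma_process_nn_integral_prod[OF G A J]) simp_all
  finally show ?thesis .
qed

text \<open>
  It suffices to check rectangles in the values on a finite disjoint family: one set gives the
  marginals, several give the independence.
\<close>

lemma gamma_process_lawI:
  fixes G :: "'y::polish_space measure measure"
  assumes sets [measurable_cong]: "sets G = sets bfm_algebra" and "prob_space G"
    and ev: "\<And>A (J :: nat set) C. (\<And>j. A j \<in> sets borel) \<Longrightarrow> disjoint_family A \<Longrightarrow> finite J \<Longrightarrow>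
      (\<And>j. C j \<in> sets borel) \<Longrightarrow>
      emeasure G {\<mu>\<in>space bfm_algebra. \<forall>j\<in>J. emeasure \<mu> (A j) \<in> C j}
        = (\<Prod>j\<in>J. emeasure (gamma_ennreal (measure \<nu> (A j))) (C j))"
  shows "gamma_process_law \<nu> G"
proof -
  interpret prob_space G by fact
  have sp: "space G = space bfm_algebra" using sets by (rule sets_eq_imp_space_eq)
  have marg: "distr G borel (\<lambda>\<mu>. emeasure \<mu> A) = gamma_ennreal (measure \<nu> A)"
    if [measurable]: "A \<in> sets borel" for A
  proof (rule measure_eqI)
    fix C assume "C \<in> sets (distr G borel (\<lambda>\<mu>. emeasure \<mu> A))"
    then have C: "C \<in> sets borel" by simp
    let ?A = "\<lambda>j::nat. if j = 0 then A else {}"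
    have "emeasure G {\<mu>\<in>space bfm_algebra. \<forall>j\<in>{0::nat}. emeasure \<mu> (?A j) \<in> C}
        = (\<Prod>j\<in>{0::nat}. emeasure (gamma_ennreal (measure \<nu> (?A j))) C)"
      using C by (intro ev) (auto simp: disjoint_family_on_def)
    then show "emeasure (distr G borel (\<lambda>\<mu>. emeasure \<mu> A)) C = emeasure (gamma_ennreal (measure \<nu> A)) C"
      using C by (simp add: emeasure_distr sp vimage_def Int_def conj_commute)
  qed simp
  moreover have "indep_vars (\<lambda>_. borel) (\<lambda>i \<mu>. emeasure \<mu> (A i)) UNIV"
    if r: "range A \<subseteq> sets borel" and d: "disjoint_family A" for A :: "nat \<Rightarrow> 'y set"
    unfolding indep_vars_def2
  proof (intro conjI ballI indep_setsI)
    have A: "A j \<in> sets borel" for j using r by auto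
    show rv: "(\<lambda>\<mu>. emeasure \<mu> (A i)) \<in> borel_measurable G" for i
      using A by simp
    then show "{(\<lambda>\<mu>. emeasure \<mu> (A i)) -` C \<inter> space G |C. C \<in> sets borel} \<subseteq> events" for i
      by (auto intro: measurable_sets)
    fix X J assume J: "J \<noteq> {}" "J \<subseteq> UNIV" "finite J"
      and X: "\<forall>j\<in>J. X j \<in> {(\<lambda>\<mu>. emeasure \<mu> (A j)) -` C \<inter> space G |C. C \<in> sets borel}"
    then obtain C where C: "\<And>j. j \<in> J \<Longrightarrow> X j = (\<lambda>\<mu>. emeasure \<mu> (A j)) -` C j \<inter> space G"
      "\<And>j. j \<in> J \<Longrightarrow> C j \<in> sets borel"
      by simp metis
    define D where "D j = (if j \<in> J then C j else {})" for j
    have D: "D j \<in> sets borel" for j using C by (simp add: D_def)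
    have XD: "X j = (\<lambda>\<mu>. emeasure \<mu> (A j)) -` D j \<inter> space G" if "j \<in> J" for j
      using C that by (simp add: D_def)
    have "(\<Inter>j\<in>J. X j) = {\<mu>\<in>space bfm_algebra. \<forall>j\<in>J. emeasure \<mu> (A j) \<in> D j}"
      using J XD sp by auto
    then have "emeasure G (\<Inter>j\<in>J. X j) = (\<Prod>j\<in>J. emeasure (gamma_ennreal (measure \<nu> (A j))) (D j))"
      using ev[OF A d J(3) D] by simp
    also have "\<dots> = (\<Prod>j\<in>J. emeasure G (X j))"
      using rv D A by (intro prod.cong refl) (simp add: marg[symmetric] emeasure_distr XD)
    finally show "prob (\<Inter>j\<in>J. X j) = (\<Prod>j\<in>J. prob (X j))"
      by (simp add: emeasure_eq_measure prod_ennreal prod_nonneg)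
  qed
  ultimately show ?thesis
    using assms(1,2) by (simp add: gamma_process_law_def gamma_ennreal_def)
qed

section \<open>Laws on the space of measures are determined by finite partitions\<close>

lemma finite_partition_refining:
  fixes \<A> :: "'a::topological_space set set"
  assumes "finite \<A>" "\<A> \<subseteq> sets borel"
  obtains m :: nat and B :: "nat \<Rightarrow> 'a set" where
    "\<And>j. B j \<in> sets borel" "disjoint_family B" "(\<Union>j<m. B j) = UNIV"
    "\<And>A. A \<in> \<A> \<Longrightarrow> \<exists>J\<subseteq>{..<m}. A = (\<Union>j\<in>J. B j)"
proof -
  have "\<exists>m B. (\<forall>j::nat. B j \<in> sets (borel :: 'a measure)) \<and> disjoint_family B \<and> (\<Union>j<m. B j) = UNIV \<and>
      (\<forall>A\<in>\<A>. \<exists>J\<subseteq>{..<m}. A = (\<Union>j\<in>J. B j))"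
    using assms
  proof (induction rule: finite_induct)
    case empty
    show ?case
      by (intro exI[of _ 1] exI[of _ "\<lambda>j. if j = 0 then UNIV else {}"])
        (auto simp: disjoint_family_on_def)
  next
    case (insert A \<A>)
    then obtain m :: nat and B :: "nat \<Rightarrow> 'a set" where B: "\<And>j. B j \<in> sets borel"
      and d: "disjoint_family B" and U: "(\<Union>j<m. B j) = UNIV"
      and J: "\<forall>A\<in>\<A>. \<exists>J\<subseteq>{..<m}. A = (\<Union>j\<in>J. B j)"
      by auto
    \<comment> \<open>split every cell \<open>B j\<close> into \<open>B j \<inter> A\<close> (even index) and \<open>B j - A\<close> (odd index)\<close>
    define B' where "B' j = (if even j then B (j div 2) \<inter> A else B (j div 2) - A)" for j
    have B'2: "B' (2 * j) = B j \<inter> A" "B' (2 * j + 1) = B j - A" for j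
      by (simp_all add: B'_def)
    have "B' j \<in> sets borel" for j
      using B insert.prems by (auto simp: B'_def)
    moreover have "disjoint_family B'"
      unfolding disjoint_family_on_def
    proof (intro ballI impI)
      fix i j :: nat assume ij: "i \<noteq> j"
      show "B' i \<inter> B' j = {}"
      proof (cases "i div 2 = j div 2")
        case True
        with ij have "even i \<noteq> even j" by presburger
        then show ?thesis by (auto simp: B'_def)
      next
        case False
        with d have "B (i div 2) \<inter> B (j div 2) = {}" by (auto simp: disjoint_family_on_def)
        then show ?thesis by (auto simp: B'_def)
      qed
    qed
    moreover have split: "\<exists>J'\<subseteq>{..<2 * m}. (\<Union>j\<in>J. B j) = (\<Union>j\<in>J'. B' j)" if "J \<subseteq> {..<m}" for J
    proof (intro exI[of _ "(\<lambda>j. 2 * j) ` J \<union> (\<lambda>j. 2 * j + 1) ` J"] conjI)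
      show "(\<Union>j\<in>J. B j) = (\<Union>j\<in>(\<lambda>j. 2 * j) ` J \<union> (\<lambda>j. 2 * j + 1) ` J. B' j)"
        unfolding UN_Un image_image UN_simps(10) B'2 by blast
      show "(\<lambda>j. 2 * j) ` J \<union> (\<lambda>j. 2 * j + 1) ` J \<subseteq> {..<2 * m}"
        using that by auto
    qed
    moreover have "(\<Union>j<2 * m. B' j) = UNIV"
    proof -
      from split[of "{..<m}"] obtain J' where "J' \<subseteq> {..<2 * m}" "UNIV = (\<Union>j\<in>J'. B' j)"
        using U by auto
      then show ?thesis by blast
    qed
    moreover have "\<exists>J'\<subseteq>{..<2 * m}. A = (\<Union>j\<in>J'. B' j)"
    proof (intro exI[of _ "(\<lambda>j. 2 * j) ` {..<m}"] conjI)
      show "A = (\<Union>j\<in>(\<lambda>j. 2 * j) ` {..<m}. B' j)"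
        unfolding UN_simps(10) B'2 using U by blast
    qed auto
    moreover have "\<exists>J'\<subseteq>{..<2 * m}. A' = (\<Union>j\<in>J'. B' j)" if "A' \<in> \<A>" for A'
    proof -
      from J that obtain J where "J \<subseteq> {..<m}" "A' = (\<Union>j\<in>J. B j)" by blast
      with split[of J] show ?thesis by simp
    qed
    ultimately show ?case
      by (intro exI[of _ "2 * m"] exI[of _ B']) simp
  qed
  then obtain m :: nat and B where *: "(\<forall>j. B j \<in> sets (borel :: 'a measure)) \<and> disjoint_family B \<and>
      (\<Union>j<m. B j) = UNIV \<and> (\<forall>A\<in>\<A>. \<exists>J\<subseteq>{..<m}. A = (\<Union>j\<in>J. B j))"
    by (elim exE)
  show ?thesis by (rule that[of B m]) (use * in simp_all)
qed

lemma emeasure_UN_finite_cells: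
  assumes "sets \<mu> = sets borel" "\<And>j. B j \<in> sets borel" "disjoint_family (B :: nat \<Rightarrow> _)" "finite J"
  shows "emeasure \<mu> (\<Union>j\<in>J. B j) = (\<Sum>j\<in>J. emeasure \<mu> (B j))"
  using assms by (subst sum_emeasure) (auto simp: disjoint_family_on_def)

text \<open>
  Any finite list of values \<open>\<mu>(A)\<close> is a sum of values on the cells of a common finite partition,
  so laws can be compared on partitions only; the partition may moreover be taken to resolve a
  set \<open>A\<^sub>0\<close> given in advance.
\<close>

lemma measure_eqI_bfm:
  fixes L L' :: "'y::polish_space measure measure"
  assumes L: "finite_measure L" "sets L = sets bfm_algebra" and L': "sets L' = sets bfm_algebra"
    and A0: "A0 \<in> sets borel"
    and eq: "\<And>m B C J. (\<And>j. B j \<in> sets borel) \<Longrightarrow> disjoint_family B \<Longrightarrow> (\<Union>j<m. B j) = UNIV \<Longrightarrow>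
      J \<subseteq> {..<m::nat} \<Longrightarrow> A0 = (\<Union>j\<in>J. B j) \<Longrightarrow> (\<And>j. C j \<in> sets borel) \<Longrightarrow>
      emeasure L {\<mu>\<in>space bfm_algebra. \<forall>j\<in>{..<m}. emeasure \<mu> (B j) \<in> C j}
      = emeasure L' {\<mu>\<in>space bfm_algebra. \<forall>j\<in>{..<m}. emeasure \<mu> (B j) \<in> C j}"
  shows "L = L'"
proof -
  note [measurable_cong] = L(2) L'
  let ?\<Omega> = "space (bfm_algebra :: 'y measure measure)"
  define ev where "ev F = {\<mu>\<in>?\<Omega>. \<forall>p\<in>F. emeasure \<mu> (fst p) \<in> snd p}" for F
  define E where "E = {ev F |F. finite F \<and> F \<subseteq> sets borel \<times> sets borel}"
  have sp: "space L = ?\<Omega>" "space L' = ?\<Omega>" using sets_eq_imp_space_eq[OF L(2)] sets_eq_imp_space_eq[OF L'] by simp_all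
  have ev_sets: "ev F \<in> sets bfm_algebra" if "finite F" "F \<subseteq> sets borel \<times> sets borel" for F
    unfolding ev_def using that by (intro sets_event_bfm) auto
  have E_Pow: "E \<subseteq> Pow ?\<Omega>" by (auto simp: E_def ev_def)
  have gen: "sets bfm_algebra = sigma_sets ?\<Omega> E"
  proof
    \<comment> \<open>The evaluations are measurable for \<open>sigma ?\<Omega> E\<close>, and hence so is the identity.\<close>
    have "(\<lambda>\<mu>. \<mu>) \<in> measurable (sigma ?\<Omega> E) bfm_algebra"
    proof (rule measurable_bfmI)
      fix A :: "'y set" assume A: "A \<in> sets borel"
      show "(\<lambda>\<mu>. emeasure \<mu> A) \<in> borel_measurable (sigma ?\<Omega> E)"
      proof (rule measurableI)
        fix C :: "ennreal set" assume "C \<in> sets borel"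
        with A have "ev {(A, C)} \<in> E" by (force simp: E_def)
        then have "ev {(A, C)} \<in> sets (sigma ?\<Omega> E)" using E_Pow by auto
        also have "ev {(A, C)} = (\<lambda>\<mu>. emeasure \<mu> A) -` C \<inter> space (sigma ?\<Omega> E)"
          using E_Pow by (auto simp: ev_def space_measure_of)
        finally show "(\<lambda>\<mu>. emeasure \<mu> A) -` C \<inter> space (sigma ?\<Omega> E) \<in> sets (sigma ?\<Omega> E)" .
      qed simp
    qed (use E_Pow in \<open>auto simp: space_bfm_algebra space_measure_of\<close>)
    then show "sets bfm_algebra \<subseteq> sigma_sets ?\<Omega> E"
    proof (intro subsetI)
      fix X assume m: "(\<lambda>\<mu>. \<mu>) \<in> measurable (sigma ?\<Omega> E) bfm_algebra"
        and X: "X \<in> sets (bfm_algebra :: 'y measure measure)"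
      from measurable_sets[OF m X] have "X \<inter> ?\<Omega> \<in> sigma_sets ?\<Omega> E"
        using E_Pow by (simp add: space_measure_of sets_measure_of)
      then show "X \<in> sigma_sets ?\<Omega> E"
        using sets.sets_into_space[OF X] by (simp add: Int_absorb2)
    qed
    show "sigma_sets ?\<Omega> E \<subseteq> sets bfm_algebra"
      by (intro sets.sigma_sets_subset) (auto simp: E_def ev_sets)
  qed
  show ?thesis
  proof (rule measure_eqI_generator_eq[where \<Omega> = ?\<Omega> and E = E and A = "\<lambda>_. ?\<Omega>"])
    show "Int_stable E"
    proof (rule Int_stableI)
      fix a b assume "a \<in> E" "b \<in> E"
      then obtain F F' where "a = ev F" "finite F" "F \<subseteq> sets borel \<times> sets borel"
        "b = ev F'" "finite F'" "F' \<subseteq> sets borel \<times> sets borel"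
        by (auto simp: E_def)
      moreover from this have "a \<inter> b = ev (F \<union> F')" by (auto simp: ev_def)
      ultimately show "a \<inter> b \<in> E" by (auto simp: E_def)
    qed
    show "sets L = sigma_sets ?\<Omega> E" "sets L' = sigma_sets ?\<Omega> E"
      using gen L L' by simp_all
    have "ev {} = ?\<Omega>" by (auto simp: ev_def)
    then show "range (\<lambda>_::nat. ?\<Omega>) \<subseteq> E" by (force simp: E_def)
    show "emeasure L ?\<Omega> \<noteq> \<infinity>" for i :: nat
      using finite_measure.emeasure_finite[OF L(1)] by simp
    fix X assume "X \<in> E"
    then obtain F where X: "X = ev F" and F: "finite F" "F \<subseteq> sets borel \<times> sets borel"
      by (auto simp: E_def)
    have "finite (insert A0 (fst ` F))" "insert A0 (fst ` F) \<subseteq> sets borel"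
      using F A0 by auto
    from finite_partition_refining[OF this] obtain m :: nat and B where
      B: "\<And>j. B j \<in> sets borel" and d: "disjoint_family B" and U: "(\<Union>j<m. B j) = UNIV" and
      R: "\<And>A. A \<in> insert A0 (fst ` F) \<Longrightarrow> \<exists>J\<subseteq>{..<m}. A = (\<Union>j\<in>J. B j)"
      by metis
    from R[of A0] obtain J0 where J0: "J0 \<subseteq> {..<m}" "A0 = (\<Union>j\<in>J0. B j)" by auto
    from R obtain J where J: "\<And>A. A \<in> fst ` F \<Longrightarrow> J A \<subseteq> {..<m} \<and> A = (\<Union>j\<in>J A. B j)"
      by (metis insertCI)
    let ?P = "Pi\<^sub>M {..<m} (\<lambda>_. borel :: ennreal measure)"
    let ?f = "\<lambda>\<mu>. \<lambda>j\<in>{..<m}. emeasure \<mu> (B j)"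
    have f [measurable]: "?f \<in> measurable bfm_algebra ?P"
      using B by (intro measurable_restrict) simp
    have f': "?f \<in> measurable L ?P" "?f \<in> measurable L' ?P" by measurable
    have "distr L ?P ?f = distr L' ?P ?f"
    proof (rule measure_eqI_PiM_finite[where A = "\<lambda>_. space ?P"])
      fix C :: "nat \<Rightarrow> ennreal set" assume C: "\<And>j. j \<in> {..<m} \<Longrightarrow> C j \<in> sets borel"
      \<comment> \<open>The hypothesis speaks of a measurable \<open>C j\<close> for every \<open>j\<close>, also beyond \<open>m\<close>.\<close>
      define D where "D j = (if j < m then C j else {})" for j
      have D: "D j \<in> sets borel" for j using C by (simp add: D_def)
      have "Pi\<^sub>E {..<m} C = Pi\<^sub>E {..<m} D" by (intro PiE_cong) (simp add: D_def)
      moreover have "?f -` Pi\<^sub>E {..<m} D \<inter> ?\<Omega> = {\<mu>\<in>?\<Omega>. \<forall>j\<in>{..<m}. emeasure \<mu> (B j) \<in> D j}"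
        by (rule set_eqI)
          (simp only: vimage_eq Int_iff mem_Collect_eq restrict_PiE_iff conj_commute)
      moreover have "Pi\<^sub>E {..<m} D \<in> sets ?P" using D by (intro sets_PiM_I_finite) auto
      ultimately show "emeasure (distr L ?P ?f) (Pi\<^sub>E {..<m} C) = emeasure (distr L' ?P ?f) (Pi\<^sub>E {..<m} C)"
        using eq[OF B d U J0 D] by (simp add: emeasure_distr[OF f'(1)] emeasure_distr[OF f'(2)] sp)
    next
      show "emeasure (distr L ?P ?f) (space ?P) \<noteq> \<infinity>" for i :: nat
        using finite_measure.emeasure_finite[OF L(1)] f'(1) by (simp add: emeasure_distr)
    qed (auto simp: space_PiM intro!: prod_algebraI_finite)
    moreover
    let ?D = "{x\<in>space ?P. \<forall>p\<in>F. (\<Sum>j\<in>J (fst p). x j) \<in> snd p}"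
    have D: "?D \<in> sets ?P"
    proof (rule sets.sets_Collect_finite_All[OF _ F(1)])
      fix p assume p: "p \<in> F"
      then have "J (fst p) \<subseteq> {..<m}" using J by auto
      then have "(\<lambda>x. \<Sum>j\<in>J (fst p). x j) \<in> borel_measurable ?P"
        by (intro borel_measurable_sum measurable_component_singleton) auto
      from measurable_sets[OF this, of "snd p"]
      show "{x \<in> space ?P. (\<Sum>j\<in>J (fst p). x j) \<in> snd p} \<in> sets ?P"
        using F(2) p by (auto simp: vimage_def Int_def conj_commute)
    qed
    moreover have "ev F = ?f -` ?D \<inter> ?\<Omega>"
    proof -
      have "emeasure \<mu> (fst p) = (\<Sum>j\<in>J (fst p). ?f \<mu> j)" if "\<mu> \<in> ?\<Omega>" "p \<in> F" for \<mu> p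
      proof -
        have *: "J (fst p) \<subseteq> {..<m}" "fst p = (\<Union>j\<in>J (fst p). B j)" using J that(2) by auto
        then have "finite (J (fst p))" by (auto intro: finite_subset)
        then have "emeasure \<mu> (\<Union>j\<in>J (fst p). B j) = (\<Sum>j\<in>J (fst p). emeasure \<mu> (B j))"
          using sets_of_boundedly_finite[OF that(1)] B d by (intro emeasure_UN_finite_cells) auto
        also have "\<dots> = (\<Sum>j\<in>J (fst p). ?f \<mu> j)"
          using * by (intro sum.cong) auto
        finally show ?thesis using *(2) by simp
      qed
      then show ?thesis
        unfolding ev_def by (auto simp: space_PiM)
    qed
    ultimately show "emeasure L X = emeasure L' X"
      unfolding X using emeasure_distr[OF f'(1) D] emeasure_distr[OF f'(2) D] sp by simp
  qed (use E_Pow in auto)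
qed

lemma gamma_process_law_unique:
  assumes G: "gamma_process_law \<nu> G" and G': "gamma_process_law \<nu> G'"
  shows "G = G'"
proof (rule measure_eqI_bfm[where ?A0.0 = UNIV])
  show "finite_measure G"
    using gamma_process_lawD(3)[OF G] by (rule prob_space.finite_measure)
qed (use gamma_process_lawD[OF G] gamma_process_lawD[OF G'] in
    \<open>simp_all add: gamma_process_event[OF G] gamma_process_event[OF G']\<close>)

section \<open>Adding an atom\<close>

definition add_atom :: "'y::polish_space measure \<Rightarrow> ennreal \<Rightarrow> 'y \<Rightarrow> 'y measure" where
  "add_atom \<mu> r z = measure_of UNIV (sets borel)
     (\<lambda>A. emeasure \<mu> A + emeasure (scale_measure r (return borel z)) A)"

lemma sets_add_atom [simp, measurable_cong]: "sets (add_atom \<mu> r z) = sets borel"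
  unfolding add_atom_def using sets.sigma_sets_eq[of "borel :: 'a measure"] by simp

lemma space_add_atom [simp]: "space (add_atom \<mu> r z) = UNIV"
  by (simp add: add_atom_def space_measure_of_conv)

lemma emeasure_add_atom:
  assumes "sets \<mu> = sets borel" "A \<in> sets borel"
  shows "emeasure (add_atom \<mu> r z) A = emeasure \<mu> A + r * indicator A z"
proof -
  let ?f = "\<lambda>A. emeasure \<mu> A + emeasure (scale_measure r (return borel z)) A"
  have "emeasure (add_atom \<mu> r z) A = ?f A"
  proof (rule emeasure_measure_of[OF add_atom_def])
    show "A \<in> sets (add_atom \<mu> r z)" using assms by simp
    show "positive (sets (add_atom \<mu> r z)) ?f" by (simp add: positive_def)
    show "countably_additive (sets (add_atom \<mu> r z)) ?f"
    proof (rule countably_additiveI)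
      fix B :: "nat \<Rightarrow> 'a set"
      assume r: "range B \<subseteq> sets (add_atom \<mu> r z)" and d: "disjoint_family B"
      have "(\<Sum>k. ?f (B k)) = (\<Sum>k. emeasure \<mu> (B k))
          + (\<Sum>k. emeasure (scale_measure r (return borel z)) (B k))"
        by (subst suminf_add) (simp_all del: emeasure_scale_measure)
      also have "\<dots> = ?f (\<Union>k. B k)"
        using r d assms(1) by (simp add: suminf_emeasure del: emeasure_scale_measure emeasure_return)
      finally show "(\<Sum>k. ?f (B k)) = ?f (\<Union>k. B k)" .
    qed
  qed simp
  then show ?thesis using assms by simp
qed

lemma nn_integral_add_atom:
  assumes \<mu> [measurable_cong]: "sets \<mu> = sets borel" and "h \<in> borel_measurable borel"
  shows "(\<integral>\<^sup>+x. h x \<partial>add_atom \<mu> r z) = (\<integral>\<^sup>+x. h x \<partial>\<mu>) + r * h z"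
  using assms(2)
proof (induction rule: borel_measurable_induct)
  case (cong f g)
  then have "f = g" by auto
  with cong show ?case by simp
next
  case (set A)
  then show ?case using \<mu> by (simp add: emeasure_add_atom)
next
  case (mult u c)
  then show ?case using \<mu> by (simp add: nn_integral_cmult distrib_left mult_ac)
next
  case (add u v)
  then show ?case using \<mu> by (simp add: nn_integral_add distrib_left add_ac)
next
  case (seq U)
  have [measurable]: "U i \<in> borel_measurable borel" for i by fact
  have mono: "incseq (\<lambda>i. U i x)" for x
    using \<open>incseq U\<close> by (auto simp: incseq_def le_fun_def)
  have inc: "incseq (\<lambda>i. \<integral>\<^sup>+x. U i x \<partial>\<mu>)"
    using mono by (auto simp: incseq_def intro!: nn_integral_mono)
  have "(\<integral>\<^sup>+x. (SUP i. U i) x \<partial>add_atom \<mu> r z) = (SUP i. \<integral>\<^sup>+x. U i x \<partial>add_atom \<mu> r z)"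
    unfolding SUP_apply by (rule nn_integral_monotone_convergence_SUP[OF \<open>incseq U\<close>]) simp
  also have "\<dots> = (SUP i. (\<integral>\<^sup>+x. U i x \<partial>\<mu>) + r * U i z)"
    using seq by simp
  also have "\<dots> = (SUP i. \<integral>\<^sup>+x. U i x \<partial>\<mu>) + (SUP i. r * U i z)"
    using mono by (intro ennreal_SUP_add inc) (auto simp: incseq_def intro!: mult_left_mono)
  also have "(SUP i. \<integral>\<^sup>+x. U i x \<partial>\<mu>) = (\<integral>\<^sup>+x. (SUP i. U i) x \<partial>\<mu>)"
    unfolding SUP_apply by (rule nn_integral_monotone_convergence_SUP[OF \<open>incseq U\<close>, symmetric]) simp
  also have "(SUP i. r * U i z) = r * (SUP i. U i) z"
    unfolding SUP_apply by (rule SUP_mult_left_ennreal[symmetric])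
  finally show ?case .
qed

lemma boundedly_finite_add_atom:
  "boundedly_finite \<mu> \<Longrightarrow> r < \<infinity> \<Longrightarrow> boundedly_finite (add_atom \<mu> r z)"
  by (auto simp: boundedly_finite_def emeasure_add_atom ennreal_mult_less_top
      split: split_indicator)

lemma measurable_add_atom [measurable (raw)]:
  assumes [measurable]: "m \<in> measurable S bfm_algebra" "t \<in> borel_measurable S" "z \<in> measurable S borel"
  shows "(\<lambda>x. add_atom (m x) (ennreal (t x)) (z x)) \<in> measurable S bfm_algebra"
proof (rule measurable_bfmI)
  fix x assume "x \<in> space S"
  then have "boundedly_finite (m x)"
    using measurable_space[OF assms(1)] by (simp add: space_bfm_algebra)
  then show "boundedly_finite (add_atom (m x) (ennreal (t x)) (z x))"
    by (intro boundedly_finite_add_atom) simp_all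
next
  fix A :: "'b set" assume A [measurable]: "A \<in> sets borel"
  have "(\<lambda>x. emeasure (m x) A + ennreal (t x) * indicator A (z x)) \<in> borel_measurable S"
    by measurable
  then show "(\<lambda>x. emeasure (add_atom (m x) (ennreal (t x)) (z x)) A) \<in> borel_measurable S"
  proof (rule measurable_cong[THEN iffD1, rotated])
    fix x assume "x \<in> space S"
    then have "sets (m x) = sets borel"
      using measurable_space[OF assms(1)] by (intro sets_of_boundedly_finite)
    then show "emeasure (m x) A + ennreal (t x) * indicator A (z x)
        = emeasure (add_atom (m x) (ennreal (t x)) (z x)) A"
      using A by (simp add: emeasure_add_atom)
  qed
qed

lemma measure_add_atom:
  assumes "finite_measure \<nu>" "sets \<nu> = sets borel" "A \<in> sets borel"
  shows "measure (add_atom \<nu> 1 z) A = measure \<nu> A + indicator A z"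
proof -
  interpret finite_measure \<nu> by fact
  show ?thesis
    using assms by (simp add: measure_def emeasure_add_atom enn2real_plus less_top[symmetric]
        split: split_indicator)
qed

lemma finite_measure_add_atom:
  assumes "finite_measure \<nu>" "sets \<nu> = sets borel"
  shows "finite_measure (add_atom \<nu> 1 z)"
proof -
  interpret finite_measure \<nu> by fact
  have "emeasure (add_atom \<nu> 1 z) UNIV = emeasure \<nu> UNIV + 1"
    using assms by (simp add: emeasure_add_atom)
  then show ?thesis by (intro finite_measureI) simp
qed

text \<open>
  A point mass at \<open>z\<close> added to the shape amounts to an independent gamma distributed mass of shape
  1 at \<open>z\<close> added to the random measure.
\<close>

definition attach_atom :: "'y::polish_space measure measure \<Rightarrow> 'y \<Rightarrow> 'y measure measure" where
  "attach_atom G z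
     = distr (G \<Otimes>\<^sub>M gamma_distr 1) bfm_algebra (\<lambda>(m, t). add_atom m (ennreal t) z)"

lemma sets_attach_atom [simp, measurable_cong]: "sets (attach_atom G z) = sets bfm_algebra"
  by (simp add: attach_atom_def)

lemma nn_integral_attach_atom:
  assumes G [measurable_cong]: "sets G = sets bfm_algebra" and [measurable]: "F \<in> borel_measurable bfm_algebra"
  shows "(\<integral>\<^sup>+m. F m \<partial>attach_atom G z)
      = (\<integral>\<^sup>+m. \<integral>\<^sup>+t. F (add_atom m (ennreal t) z) \<partial>gamma_distr 1 \<partial>G)"
proof -
  interpret prob_space "gamma_distr 1" by (rule prob_space_gamma_distr) simp
  show ?thesis
    unfolding attach_atom_def
    by (subst nn_integral_distr, simp_all, subst nn_integral_fst[symmetric]) (simp_all add: split_beta')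
qed

lemma gamma_process_attach_atom:
  fixes \<nu> :: "'y::polish_space measure"
  assumes \<nu>: "finite_measure \<nu>" "sets \<nu> = sets borel" and G: "gamma_process_law \<nu> G"
  shows "gamma_process_law (add_atom \<nu> 1 z) (attach_atom G z)"
proof (rule gamma_process_lawI)
  note [measurable_cong] = gamma_process_lawD(1)[OF G]
  interpret G: prob_space G by (rule gamma_process_lawD(3)[OF G])
  interpret E: prob_space "gamma_distr 1" by (rule prob_space_gamma_distr) simp
  interpret pair_prob_space G "gamma_distr 1" ..
  show "sets (attach_atom G z) = sets bfm_algebra" by simp
  show "prob_space (attach_atom G z)"
    unfolding attach_atom_def by (intro prob_space_distr) measurable
  fix A :: "nat \<Rightarrow> 'y set" and J :: "nat set" and C :: "nat \<Rightarrow> ennreal set"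
  assume A: "\<And>j. A j \<in> sets borel" "disjoint_family A" and J: "finite J"
    and C [measurable]: "\<And>j. C j \<in> sets borel"
  note A(1) [measurable]
  let ?X = "{\<mu>\<in>space bfm_algebra. \<forall>j\<in>J. emeasure \<mu> (A j) \<in> C j}"
  let ?a = "\<lambda>j. measure \<nu> (A j)"
  let ?I = "\<lambda>j t. \<integral>\<^sup>+x. indicator (C j) (x + ennreal t * indicator (A j) z) \<partial>gamma_ennreal (?a j)"
  have X [measurable]: "?X \<in> sets bfm_algebra" using A J C by (intro sets_event_bfm)
  have "emeasure (attach_atom G z) ?X
      = (\<integral>\<^sup>+m. \<integral>\<^sup>+t. indicator ?X (add_atom m (ennreal t) z) \<partial>gamma_distr 1 \<partial>G)"
    by (subst nn_integral_attach_atom[symmetric]) (simp_all add: gamma_process_lawD[OF G])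
  also have "\<dots> = (\<integral>\<^sup>+t. \<integral>\<^sup>+m. indicator ?X (add_atom m (ennreal t) z) \<partial>G \<partial>gamma_distr 1)"
    by (rule Fubini'[symmetric]) measurable
  also have "\<dots> = (\<integral>\<^sup>+t. (\<Prod>j\<in>J. ?I j t) \<partial>gamma_distr 1)"
  proof (rule nn_integral_cong)
    fix t :: real
    have "(\<integral>\<^sup>+m. indicator ?X (add_atom m (ennreal t) z) \<partial>G)
        = (\<integral>\<^sup>+m. (\<Prod>j\<in>J. indicator (C j) (emeasure m (A j) + ennreal t * indicator (A j) z)) \<partial>G)"
    proof (rule nn_integral_cong)
      fix m assume "m \<in> space G"
      then have m: "m \<in> space bfm_algebra" by (simp add: gamma_process_lawD[OF G])
      then have "add_atom m (ennreal t) z \<in> space bfm_algebra"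
        by (simp add: space_bfm_algebra boundedly_finite_add_atom)
      then show "indicator ?X (add_atom m (ennreal t) z)
          = (\<Prod>j\<in>J. indicator (C j) (emeasure m (A j) + ennreal t * indicator (A j) z) :: ennreal)"
        using A by (simp add: indicator_all_eq_prod[OF J] emeasure_add_atom sets_of_boundedly_finite[OF m])
    qed
    also have "\<dots> = (\<Prod>j\<in>J. ?I j t)"
      by (rule gamma_process_nn_integral_prod[OF G A J]) measurable
    finally show "(\<integral>\<^sup>+m. indicator ?X (add_atom m (ennreal t) z) \<partial>G) = (\<Prod>j\<in>J. ?I j t)" .
  qed
  also have "\<dots> = (\<Prod>j\<in>J. emeasure (gamma_ennreal (measure (add_atom \<nu> 1 z) (A j))) (C j))"
  proof (cases "\<exists>k\<in>J. z \<in> A k")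
    case True
    then obtain k where k: "k \<in> J" "z \<in> A k" by auto
    interpret K: prob_space "gamma_ennreal (?a k)" by (rule prob_space_gamma_ennreal) simp
    interpret KE: pair_prob_space "gamma_ennreal (?a k)" "gamma_distr 1" ..
    have nz: "z \<notin> A j" if "j \<in> J - {k}" for j
      using A(2) k that by (auto simp: disjoint_family_on_def)
    have "(\<integral>\<^sup>+t. (\<Prod>j\<in>J. ?I j t) \<partial>gamma_distr 1)
        = (\<integral>\<^sup>+t. ?I k t * (\<Prod>j\<in>J - {k}. emeasure (gamma_ennreal (?a j)) (C j)) \<partial>gamma_distr 1)"
      using nz by (intro nn_integral_cong) (simp add: prod.remove[OF J k(1)])
    also have "\<dots> = (\<integral>\<^sup>+t. ?I k t \<partial>gamma_distr 1) * (\<Prod>j\<in>J - {k}. emeasure (gamma_ennreal (?a j)) (C j))"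
      by (rule nn_integral_multc) measurable
    also have "(\<integral>\<^sup>+t. ?I k t \<partial>gamma_distr 1)
        = (\<integral>\<^sup>+x. \<integral>\<^sup>+t. indicator (C k) (x + ennreal t) \<partial>gamma_distr 1 \<partial>gamma_ennreal (?a k))"
      using k(2) by (subst KE.Fubini'[symmetric]) simp_all
    also have "\<dots> = emeasure (gamma_ennreal (?a k + 1)) (C k)"
      by (subst gamma_convolution_exponential) simp_all
    finally show ?thesis
      using k nz by (simp add: prod.remove[OF J k(1)] measure_add_atom[OF \<nu> A(1)])
  next
    case False
    then show ?thesis
      using E.emeasure_space_1 by (simp add: measure_add_atom[OF \<nu> A(1)])
  qed
  finally show "emeasure (attach_atom G z) ?X
      = (\<Prod>j\<in>J. emeasure (gamma_ennreal (measure (add_atom \<nu> 1 z) (A j))) (C j))" .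
qed

text \<open>
  The Mecke (Palm) formula of the gamma process.  On a cell \<open>B\<^sub>i\<close> of a partition, weighting by
  \<open>\<mu>(B\<^sub>i)\<close> turns the gamma law of shape \<open>\<nu>(B\<^sub>i)\<close> into \<open>\<nu>(B\<^sub>i)\<close> times the gamma law of shape
  \<open>\<nu>(B\<^sub>i) + 1\<close>, and leaves the other cells alone; this is what an additional unit atom of the
  shape at a point of \<open>B\<^sub>i\<close> does.
\<close>

theorem gamma_process_mecke:
  fixes \<nu> :: "'y::polish_space measure"
  assumes \<nu>: "finite_measure \<nu>" "sets \<nu> = sets borel" and G: "gamma_process_law \<nu> G"
    and A [measurable]: "A \<in> sets borel" and F [measurable]: "F \<in> borel_measurable bfm_algebra"
  shows "(\<integral>\<^sup>+m. emeasure m A * F m \<partial>G)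
    = (\<integral>\<^sup>+z. indicator A z * (\<integral>\<^sup>+m. F m \<partial>attach_atom G z) \<partial>\<nu>)"
proof -
  note [measurable_cong] = gamma_process_lawD(1)[OF G] \<nu>(2)
  interpret nu: finite_measure \<nu> by fact
  interpret G: prob_space G by (rule gamma_process_lawD(3)[OF G])
  interpret E: prob_space "gamma_distr 1" by (rule prob_space_gamma_distr) simp
  interpret GE: pair_prob_space G "gamma_distr 1" ..
  interpret GE: sigma_finite_measure "G \<Otimes>\<^sub>M gamma_distr 1" ..
  define L where "L = density G (\<lambda>m. emeasure m A)"
  \<comment> \<open>The right-hand side as a measure: a point \<open>z\<close> chosen by \<open>\<nu>\<close> on \<open>A\<close>, an independent process and
    an independent mass \<open>t\<close> for the atom at \<open>z\<close>.\<close>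
  define L' where "L' = distr (density \<nu> (indicator A) \<Otimes>\<^sub>M (G \<Otimes>\<^sub>M gamma_distr 1)) bfm_algebra
    (\<lambda>(z, m, t). add_atom m (ennreal t) z)"
  have int_L: "(\<integral>\<^sup>+m. f m \<partial>L) = (\<integral>\<^sup>+m. emeasure m A * f m \<partial>G)"
    if [measurable]: "f \<in> borel_measurable bfm_algebra" for f
    unfolding L_def by (simp add: nn_integral_density)
  have int_L': "(\<integral>\<^sup>+m. f m \<partial>L') = (\<integral>\<^sup>+z. indicator A z * (\<integral>\<^sup>+m. f m \<partial>attach_atom G z) \<partial>\<nu>)"
    if [measurable]: "f \<in> borel_measurable bfm_algebra" for f
  proof -
    have "(\<integral>\<^sup>+m. f m \<partial>L') = (\<integral>\<^sup>+x. f (case x of (z, m, t) \<Rightarrow> add_atom m (ennreal t) z)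
        \<partial>(density \<nu> (indicator A) \<Otimes>\<^sub>M (G \<Otimes>\<^sub>M gamma_distr 1)))"
      unfolding L'_def by (subst nn_integral_distr) simp_all
    also have "\<dots> = (\<integral>\<^sup>+z. \<integral>\<^sup>+p. f (add_atom (fst p) (ennreal (snd p)) z) \<partial>(G \<Otimes>\<^sub>M gamma_distr 1)
        \<partial>density \<nu> (indicator A))"
      by (subst GE.nn_integral_fst[symmetric]) (simp_all add: split_beta')
    also have "\<dots> = (\<integral>\<^sup>+z. indicator A z * (\<integral>\<^sup>+p. f (add_atom (fst p) (ennreal (snd p)) z)
        \<partial>(G \<Otimes>\<^sub>M gamma_distr 1)) \<partial>\<nu>)"
      by (subst nn_integral_density) simp_all
    also have "\<dots> = (\<integral>\<^sup>+z. indicator A z * (\<integral>\<^sup>+m. f m \<partial>attach_atom G z) \<partial>\<nu>)"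
      unfolding attach_atom_def by (subst nn_integral_distr) (simp_all add: split_beta')
    finally show ?thesis .
  qed
  have "L = L'"
  proof (rule measure_eqI_bfm[where ?A0.0 = A])
    show "sets L = sets bfm_algebra" "sets L' = sets bfm_algebra"
      by (simp_all add: L_def L'_def gamma_process_lawD[OF G])
    show "finite_measure L"
    proof (rule finite_measureI)
      interpret prob_space "gamma_ennreal (measure \<nu> A + 1)" by (rule prob_space_gamma_ennreal) simp
      have "emeasure L (space L) = (\<integral>\<^sup>+m. emeasure m A \<partial>G)"
        by (simp add: L_def emeasure_density cong: nn_integral_cong)
      also have "\<dots> = (\<integral>\<^sup>+x. x * 1 \<partial>gamma_ennreal (measure \<nu> A))"
        by (subst gamma_process_nn_integral[OF G A]) simp_all
      also have "\<dots> = ennreal (measure \<nu> A)"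
        using emeasure_space_1 by (subst gamma_size_bias) simp_all
      finally show "emeasure L (space L) \<noteq> \<infinity>" by simp
    qed
    fix m :: nat and B :: "nat \<Rightarrow> 'y set" and C :: "nat \<Rightarrow> ennreal set" and J
    assume B: "\<And>j. B j \<in> sets borel" "disjoint_family B" and U: "(\<Union>j<m. B j) = UNIV"
      and J: "J \<subseteq> {..<m}" "A = (\<Union>j\<in>J. B j)" and C [measurable]: "\<And>j. C j \<in> sets borel"
    note B(1) [measurable]
    let ?X = "{\<mu>\<in>space bfm_algebra. \<forall>j\<in>{..<m}. emeasure \<mu> (B j) \<in> C j}"
    let ?b = "\<lambda>j. measure \<nu> (B j)"
    let ?P = "\<lambda>i. \<Prod>j<m. emeasure (gamma_ennreal (?b j + (if j = i then 1 else 0))) (C j)"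
    have X [measurable]: "?X \<in> sets bfm_algebra" using B C by (intro sets_event_bfm) auto
    have fin: "finite J" using J(1) by (rule finite_subset) simp
    have "emeasure L ?X = (\<integral>\<^sup>+\<mu>. emeasure \<mu> A * indicator ?X \<mu> \<partial>G)"
      by (subst int_L[symmetric]) (simp_all add: L_def)
    also have "\<dots> = (\<integral>\<^sup>+\<mu>. (\<Sum>i\<in>J. \<Prod>j<m. (if j = i then emeasure \<mu> (B j) else 1)
        * indicator (C j) (emeasure \<mu> (B j))) \<partial>G)"
    proof (rule nn_integral_cong)
      fix \<mu> assume "\<mu> \<in> space G"
      then have \<mu>: "\<mu> \<in> space bfm_algebra" by (simp add: gamma_process_lawD[OF G])
      have i: "(\<Prod>j<m. (if j = i then emeasure \<mu> (B j) else 1)) = emeasure \<mu> (B i)" if "i \<in> J" for i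
        using J that by (subst prod.delta) auto
      have "emeasure \<mu> A = (\<Sum>i\<in>J. emeasure \<mu> (B i))"
        unfolding J(2) using sets_of_boundedly_finite[OF \<mu>] B fin by (rule emeasure_UN_finite_cells)
      then show "emeasure \<mu> A * indicator ?X \<mu> = (\<Sum>i\<in>J. \<Prod>j<m. (if j = i then emeasure \<mu> (B j) else 1)
        * indicator (C j) (emeasure \<mu> (B j)))"
        using \<mu> i by (simp add: indicator_all_eq_prod sum_distrib_right prod.distrib)
    qed
    also have "\<dots> = (\<Sum>i\<in>J. \<integral>\<^sup>+\<mu>. (\<Prod>j<m. (if j = i then emeasure \<mu> (B j) else 1)
        * indicator (C j) (emeasure \<mu> (B j))) \<partial>G)"
      by (rule nn_integral_sum) measurable
    also have "\<dots> = (\<Sum>i\<in>J. ennreal (?b i) * ?P i)"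
    proof (rule sum.cong)
      fix i assume i: "i \<in> J"
      have "(\<integral>\<^sup>+\<mu>. (\<Prod>j<m. (if j = i then emeasure \<mu> (B j) else 1)
          * indicator (C j) (emeasure \<mu> (B j))) \<partial>G)
        = (\<Prod>j<m. \<integral>\<^sup>+x. (if j = i then x else 1) * indicator (C j) x \<partial>gamma_ennreal (?b j))"
        by (rule gamma_process_nn_integral_prod[OF G B, where
            h = "\<lambda>j x. (if j = i then x else 1) * indicator (C j) x"]) simp_all
      also have "\<dots> = (\<Prod>j<m. (if j = i then ennreal (?b j) else 1)
          * emeasure (gamma_ennreal (?b j + (if j = i then 1 else 0))) (C j))"
        by (intro prod.cong refl) (simp add: gamma_size_bias)
      also have "\<dots> = ennreal (?b i) * ?P i"
        using J i by (subst prod.distrib, subst prod.delta) auto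
      finally show "(\<integral>\<^sup>+\<mu>. (\<Prod>j<m. (if j = i then emeasure \<mu> (B j) else 1)
          * indicator (C j) (emeasure \<mu> (B j))) \<partial>G) = ennreal (?b i) * ?P i" .
    qed simp
    also have "\<dots> = (\<Sum>i\<in>J. \<integral>\<^sup>+z. indicator (B i) z * ?P i \<partial>\<nu>)"
      by (simp add: nn_integral_multc nu.emeasure_eq_measure)
    also have "\<dots> = (\<integral>\<^sup>+z. (\<Sum>i\<in>J. indicator (B i) z * ?P i) \<partial>\<nu>)"
      by (rule nn_integral_sum[symmetric]) measurable
    also have "\<dots> = (\<integral>\<^sup>+z. indicator A z * (\<integral>\<^sup>+\<mu>. indicator ?X \<mu> \<partial>attach_atom G z) \<partial>\<nu>)"
    proof (rule nn_integral_cong)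
      fix z
      show "(\<Sum>i\<in>J. indicator (B i) z * ?P i)
          = indicator A z * (\<integral>\<^sup>+\<mu>. indicator ?X \<mu> \<partial>attach_atom G z)"
      proof (cases "z \<in> A")
        case True
        then obtain k where k: "k \<in> J" "z \<in> B k" using J(2) by auto
        have B_iff: "z \<in> B j \<longleftrightarrow> j = k" for j
          using B(2) k by (auto simp: disjoint_family_on_def)
        have "(\<Sum>i\<in>J. indicator (B i) z * ?P i) = (\<Sum>i\<in>J. if i = k then ?P k else 0)"
          by (intro sum.cong refl) (simp add: B_iff split: split_indicator)
        also have "\<dots> = ?P k" using k fin by simp
        also have "\<dots> = emeasure (attach_atom G z) ?X"
          by (subst gamma_process_event[OF gamma_process_attach_atom[OF \<nu> G] B])
            (auto simp: measure_add_atom[OF \<nu> B(1)] B_iff indicator_def intro!: prod.cong)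
        finally show ?thesis using True by simp
      next
        case False
        then show ?thesis using J(2) by (auto intro!: sum.neutral)
      qed
    qed
    also have "\<dots> = emeasure L' ?X"
      by (subst int_L'[symmetric]) (simp_all add: L'_def)
    finally show "emeasure L ?X = emeasure L' ?X" .
  qed (use A in simp)
  then show ?thesis
    using int_L[OF F] int_L'[OF F] by simp
qed

section \<open>Scaling, and independence of the total mass from the normalized measure\<close>

lemma emeasure_normalized: "emeasure (normalized \<mu>) A = 1 / emeasure \<mu> UNIV * emeasure \<mu> A"
  by (simp add: normalized_def)

lemma sets_normalized [simp]: "sets (normalized \<mu>) = sets \<mu>"
  by (simp add: normalized_def)

lemma measurable_normalized [measurable]:
  "normalized \<in> measurable bfm_algebra (subprob_algebra borel)"
proof (rule measurable_subprob_algebra)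
  fix \<mu> :: "'a measure" assume \<mu>: "\<mu> \<in> space bfm_algebra"
  then have s: "sets \<mu> = sets borel" by (rule sets_of_boundedly_finite)
  then show "sets (normalized \<mu>) = sets borel" by simp
  have sp: "space \<mu> = UNIV" using sets_eq_imp_space_eq[OF s] by simp
  show "subprob_space (normalized \<mu>)"
  proof (rule subprob_spaceI)
    have "1 / T * T \<le> 1" for T :: ennreal
      by (cases "T = 0 \<or> T = \<infinity>") (auto simp: ennreal_divide_times ennreal_divide_self less_top[symmetric])
    then show "emeasure (normalized \<mu>) (space (normalized \<mu>)) \<le> 1"
      by (simp add: normalized_def sp space_scale_measure)
  qed (simp add: normalized_def sp space_scale_measure)
next
  fix A :: "'a set" assume [measurable]: "A \<in> sets borel"
  show "(\<lambda>\<mu>. emeasure (normalized \<mu>) A) \<in> borel_measurable bfm_algebra"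
    unfolding emeasure_normalized by measurable
qed

lemma measurable_scale_bfm [measurable]:
  "scale_measure (ennreal c) \<in> measurable bfm_algebra bfm_algebra"
proof (rule measurable_bfmI)
  fix \<mu> :: "'a measure" assume "\<mu> \<in> space bfm_algebra"
  then show "boundedly_finite (scale_measure (ennreal c) \<mu>)"
    by (auto simp: space_bfm_algebra boundedly_finite_def ennreal_mult_less_top)
qed simp

lemma normalized_scale:
  assumes c: "0 < c"
  shows "normalized (scale_measure (ennreal c) \<mu>) = normalized \<mu>"
proof -
  have "1 / (ennreal c * T) * ennreal c = 1 / T" for T :: ennreal
  proof (cases "T = 0 \<or> T = \<infinity>")
    case True
    then show ?thesis using c by (auto simp: ennreal_mult_eq_top_iff ennreal_mult_top ennreal_top_mult)
  next
    case False
    then obtain t where t: "T = ennreal t" "t > 0"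
      by (cases T) (auto simp: less_top[symmetric] ennreal_eq_0_iff not_le)
    then show ?thesis
      using c by (simp add: ennreal_mult[symmetric] ennreal_1[symmetric] divide_ennreal
          del: ennreal_1)
  qed
  then show ?thesis
    by (simp add: normalized_def scale_scale_measure)
qed

lemma measure_UNIV_cells:
  assumes "finite_measure \<mu>" "sets \<mu> = sets borel" "\<And>j. B j \<in> sets borel"
    "disjoint_family (B :: nat \<Rightarrow> _)" "(\<Union>j<m. B j) = UNIV"
  shows "measure \<mu> UNIV = (\<Sum>j<m. measure \<mu> (B j))"
proof -
  interpret finite_measure \<mu> by fact
  have "emeasure \<mu> UNIV = (\<Sum>j<m. emeasure \<mu> (B j))"
    using emeasure_UN_finite_cells[OF assms(2-4), of "{..<m}"] assms(5) by simp
  then show ?thesis by (simp add: emeasure_eq_measure sum_nonneg)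
qed

lemma gamma_process_AE_finite_measure:
  assumes G: "gamma_process_law \<nu> G"
  shows "AE \<mu> in G. finite_measure \<mu>"
proof -
  have "AE \<mu> in G. emeasure \<mu> UNIV < \<infinity>" by (rule gamma_process_AE_finite[OF G]) simp
  with AE_space show ?thesis
  proof eventually_elim
    case (elim \<mu>)
    then have "space \<mu> = UNIV"
      using gamma_process_lawD[OF G] sets_eq_imp_space_eq[of \<mu> borel]
      by (simp add: sets_of_boundedly_finite)
    then show ?case using elim by (intro finite_measureI) simp
  qed
qed

lemma gamma_process_AE_pos:
  assumes G: "gamma_process_law \<nu> G" and pos: "0 < measure \<nu> UNIV"
  shows "AE \<mu> in G. 0 < measure \<mu> UNIV"
proof -
  have "AE x in gamma_ennreal (measure \<nu> UNIV). 0 < x"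
    unfolding gamma_ennreal_def using AE_gamma_distr_pos[OF pos]
    by (subst AE_distr_iff) simp_all
  from gamma_process_AE[OF G _ _ this] have "AE \<mu> in G. 0 < emeasure \<mu> UNIV" by simp
  with gamma_process_AE_finite_measure[OF G] show ?thesis
    by eventually_elim (simp add: finite_measure.emeasure_eq_measure)
qed

lemma gamma_process_scaling:
  fixes \<nu> :: "'y::polish_space measure"
  assumes \<nu>: "finite_measure \<nu>" "sets \<nu> = sets borel" and G: "gamma_process_law \<nu> G"
    and c: "0 < c" and F [measurable]: "F \<in> borel_measurable bfm_algebra"
  shows "(\<integral>\<^sup>+m. F (scale_measure (ennreal c) m) \<partial>G)
    = (\<integral>\<^sup>+m. ennreal (c powr (- measure \<nu> UNIV) * exp (- (1 / c - 1) * measure m UNIV)) * F m \<partial>G)"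
proof -
  note [measurable_cong] = gamma_process_lawD(1)[OF G] \<nu>(2)
  interpret G: prob_space G by (rule gamma_process_lawD(3)[OF G])
  let ?t = "\<lambda>a x. ennreal (c powr (- a) * exp (- (1 / c - 1) * x))"
  define L where "L = distr G bfm_algebra (scale_measure (ennreal c))"
  define L' where "L' = density G (\<lambda>m. ?t (measure \<nu> UNIV) (measure m UNIV))"
  have "L = L'"
  proof (rule measure_eqI_bfm[where ?A0.0 = UNIV])
    show "finite_measure L"
      unfolding L_def by (intro prob_space.finite_measure G.prob_space_distr) measurable
    show "sets L = sets bfm_algebra" "sets L' = sets bfm_algebra"
      by (simp_all add: L_def L'_def gamma_process_lawD[OF G])
    fix m :: nat and B :: "nat \<Rightarrow> 'y set" and C :: "nat \<Rightarrow> ennreal set"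
    assume B: "\<And>j. B j \<in> sets borel" "disjoint_family B" and U: "(\<Union>j<m. B j) = UNIV"
      and C [measurable]: "\<And>j. C j \<in> sets borel"
    note B(1) [measurable]
    let ?X = "{\<mu>\<in>space bfm_algebra. \<forall>j\<in>{..<m}. emeasure \<mu> (B j) \<in> C j}"
    let ?b = "\<lambda>j. measure \<nu> (B j)"
    have X [measurable]: "?X \<in> sets bfm_algebra" using B C by (intro sets_event_bfm) auto
    have "emeasure L ?X = (\<integral>\<^sup>+\<mu>. indicator ?X \<mu> \<partial>L)"
      by (simp add: L_def)
    also have "\<dots> = (\<integral>\<^sup>+\<mu>. indicator ?X (scale_measure (ennreal c) \<mu>) \<partial>G)"
      unfolding L_def by (rule nn_integral_distr) simp_all
    also have "\<dots> = (\<integral>\<^sup>+\<mu>. (\<Prod>j<m. indicator (C j) (ennreal c * emeasure \<mu> (B j))) \<partial>G)"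
    proof (rule nn_integral_cong)
      fix \<mu> assume "\<mu> \<in> space G"
      then have "\<mu> \<in> space bfm_algebra" by (simp add: gamma_process_lawD[OF G])
      then have "scale_measure (ennreal c) \<mu> \<in> space bfm_algebra"
        by (rule measurable_space[OF measurable_scale_bfm])
      then show "indicator ?X (scale_measure (ennreal c) \<mu>)
          = (\<Prod>j<m. indicator (C j) (ennreal c * emeasure \<mu> (B j)) :: ennreal)"
        by (simp add: indicator_all_eq_prod)
    qed
    also have "\<dots> = (\<Prod>j<m. \<integral>\<^sup>+x. indicator (C j) (ennreal c * x) \<partial>gamma_ennreal (?b j))"
      by (rule gamma_process_nn_integral_prod[OF G B]) simp_all
    also have "\<dots> = (\<Prod>j<m. \<integral>\<^sup>+x. ?t (?b j) (enn2real x) * indicator (C j) x \<partial>gamma_ennreal (?b j))"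
      by (intro prod.cong refl gamma_scaling c) simp_all
    also have "\<dots> = (\<integral>\<^sup>+\<mu>. (\<Prod>j<m. ?t (?b j) (enn2real (emeasure \<mu> (B j)))
        * indicator (C j) (emeasure \<mu> (B j))) \<partial>G)"
      by (rule gamma_process_nn_integral_prod[OF G B, symmetric, where
            h = "\<lambda>j x. ?t (?b j) (enn2real x) * indicator (C j) x"]) simp_all
    also have "\<dots> = (\<integral>\<^sup>+\<mu>. ?t (measure \<nu> UNIV) (measure \<mu> UNIV) * indicator ?X \<mu> \<partial>G)"
    proof (rule nn_integral_cong_AE)
      show "AE \<mu> in G. (\<Prod>j<m. ?t (?b j) (enn2real (emeasure \<mu> (B j))) * indicator (C j) (emeasure \<mu> (B j)))
          = ?t (measure \<nu> UNIV) (measure \<mu> UNIV) * indicator ?X \<mu>"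
        using gamma_process_AE_finite_measure[OF G] AE_space
      proof eventually_elim
        case (elim \<mu>)
        then have \<mu>: "\<mu> \<in> space bfm_algebra" by (simp add: gamma_process_lawD[OF G])
        have T: "measure \<mu> UNIV = (\<Sum>j<m. measure \<mu> (B j))"
          using elim(1) sets_of_boundedly_finite[OF \<mu>] B U by (rule measure_UNIV_cells)
        have V: "measure \<nu> UNIV = (\<Sum>j<m. ?b j)"
          using \<nu> B U by (rule measure_UNIV_cells)
        have "(\<Prod>j<m. ?t (?b j) (enn2real (emeasure \<mu> (B j))))
            = ennreal (\<Prod>j<m. c powr (- ?b j) * exp (- (1 / c - 1) * measure \<mu> (B j)))"
          by (subst prod_ennreal) (simp_all add: measure_def)
        also have "(\<Prod>j<m. c powr (- ?b j) * exp (- (1 / c - 1) * measure \<mu> (B j)))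
            = c powr (- measure \<nu> UNIV) * exp (- (1 / c - 1) * measure \<mu> UNIV)"
          unfolding T V prod.distrib sum_distrib_left sum_negf[symmetric]
          using c by (simp add: powr_sum exp_sum)
        finally show ?case
          using \<mu> by (simp add: prod.distrib indicator_all_eq_prod)
      qed
    qed
    also have "\<dots> = emeasure L' ?X"
      unfolding L'_def by (subst emeasure_density) simp_all
    finally show "emeasure L ?X = emeasure L' ?X" .
  qed simp
  then have "(\<integral>\<^sup>+m. F m \<partial>L) = (\<integral>\<^sup>+m. F m \<partial>L')" by simp
  then show ?thesis
    unfolding L_def L'_def by (simp add: nn_integral_distr nn_integral_density)
qed

text \<open>
  Let \<open>Q\<close> be the law of \<open>T\<close> on the event \<open>P \<in> E\<close>, weighted by \<open>exp T\<close>.  Scaling does not change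
  \<open>P\<close>, so the scaling property says that \<open>Q{..t} = t\<^sup>\<theta> Q{..1}\<close> for \<open>t > 0\<close>, where \<open>\<theta> = \<nu>(\<Y>)\<close>: up to a
  factor, \<open>Q\<close> does not depend on \<open>E\<close>, which is independence.
\<close>

theorem gamma_process_total_mass_independent:
  fixes \<nu> :: "'y::polish_space measure"
  assumes \<nu>: "finite_measure \<nu>" "sets \<nu> = sets borel" "0 < measure \<nu> UNIV"
    and G: "gamma_process_law \<nu> G"
    and E [measurable]: "E \<in> sets (subprob_algebra borel)" and h [measurable]: "h \<in> borel_measurable borel"
  shows "(\<integral>\<^sup>+m. indicator E (normalized m) * h (measure m UNIV) \<partial>G)
    = (\<integral>\<^sup>+m. indicator E (normalized m) \<partial>G) * (\<integral>\<^sup>+m. h (measure m UNIV) \<partial>G)"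
proof -
  note [measurable_cong] = gamma_process_lawD(1)[OF G] \<nu>(2)
  interpret G: prob_space G by (rule gamma_process_lawD(3)[OF G])
  define T where "T m = measure m (UNIV :: 'y set)" for m
  have T [measurable]: "T \<in> borel_measurable bfm_algebra"
    unfolding T_def by measurable
  have T_scale: "T (scale_measure (ennreal t) m) = t * T m" if "0 < t" for t m
    using that by (simp add: T_def measure_def enn2real_mult)
  \<comment> \<open>\<open>\<kappa> D\<close> is the factor by which \<open>Q D\<close> differs from a measure that is the same for all \<open>D\<close>.\<close>
  define Q where "Q D = distr (density G (\<lambda>m. indicator D (normalized m) * ennreal (exp (T m)))) borel T"
    for D
  define \<kappa> where "\<kappa> D = emeasure (Q D) {..1}" for D
  have int_Q: "(\<integral>\<^sup>+t. f t \<partial>Q D) = (\<integral>\<^sup>+m. indicator D (normalized m) * ennreal (exp (T m)) * f (T m) \<partial>G)"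
    if [measurable]: "D \<in> sets (subprob_algebra borel)" "f \<in> borel_measurable borel" for D f
    unfolding Q_def by (subst nn_integral_distr) (simp_all add: nn_integral_density)
  have Q_atMost: "emeasure (Q D) {..t}
      = (\<integral>\<^sup>+m. indicator D (normalized m) * ennreal (exp (T m)) * indicator {..t} (T m) \<partial>G)"
    if "D \<in> sets (subprob_algebra borel)" for D t
    by (subst int_Q[OF that, symmetric]) (simp_all add: Q_def)
  have homogeneous: "emeasure (Q D) {..t} = ennreal (t powr measure \<nu> UNIV) * \<kappa> D"
    if D [measurable]: "D \<in> sets (subprob_algebra borel)" and t: "0 < t" for D t
  proof -
    \<comment> \<open>Scaled by \<open>t\<close>, the integrand \<open>?F\<close> becomes that of \<open>Q{..1}\<close>; with the density of the scaled
      law, it becomes that of \<open>Q{..t}\<close>.\<close>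
    let ?F = "\<lambda>m. indicator D (normalized m) * ennreal (exp (T m / t)) * indicator {..t} (T m)"
    have "\<kappa> D = (\<integral>\<^sup>+m. ?F (scale_measure (ennreal t) m) \<partial>G)"
      unfolding \<kappa>_def Q_atMost[OF D] using t
      by (intro nn_integral_cong) (simp add: normalized_scale T_scale split: split_indicator)
    also have "\<dots> = (\<integral>\<^sup>+m. ennreal (t powr (- measure \<nu> UNIV) * exp (- (1 / t - 1) * T m)) * ?F m \<partial>G)"
      unfolding T_def[of _, symmetric] using gamma_process_scaling[OF \<nu>(1,2) G t, of ?F]
      by (simp add: T_def)
    also have "\<dots> = (\<integral>\<^sup>+m. ennreal (t powr (- measure \<nu> UNIV)) *
        (indicator D (normalized m) * ennreal (exp (T m)) * indicator {..t} (T m)) \<partial>G)"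
    proof (rule nn_integral_cong)
      fix m
      have "exp (- (1 / t - 1) * T m) * exp (T m / t) = exp (T m)"
        using t by (simp add: exp_add[symmetric] field_simps)
      then have "ennreal (t powr (- measure \<nu> UNIV) * exp (- (1 / t - 1) * T m)) * ennreal (exp (T m / t))
          = ennreal (t powr (- measure \<nu> UNIV)) * ennreal (exp (T m))"
        by (simp add: ennreal_mult[symmetric] mult.assoc)
      then show "ennreal (t powr (- measure \<nu> UNIV) * exp (- (1 / t - 1) * T m)) * ?F m
        = ennreal (t powr (- measure \<nu> UNIV)) *
          (indicator D (normalized m) * ennreal (exp (T m)) * indicator {..t} (T m))"
        by (simp only: mult_1_left mult_1_right split: split_indicator) (simp add: mult.commute)
    qed
    also have "\<dots> = ennreal (t powr (- measure \<nu> UNIV)) * emeasure (Q D) {..t}"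
      unfolding Q_atMost[OF D] by (rule nn_integral_cmult) measurable
    finally have "ennreal (t powr measure \<nu> UNIV) * \<kappa> D
        = ennreal (t powr measure \<nu> UNIV * t powr (- measure \<nu> UNIV)) * emeasure (Q D) {..t}"
      by (simp add: ennreal_mult mult.assoc)
    also have "t powr measure \<nu> UNIV * t powr (- measure \<nu> UNIV) = 1"
      using t by (simp add: powr_minus)
    finally show ?thesis by simp
  qed
  have Q_neg: "emeasure (Q D) {..t} = 0" if D: "D \<in> sets (subprob_algebra borel)" and t: "t \<le> 0" for D t
  proof -
    have "emeasure (Q D) {..t} = (\<integral>\<^sup>+m. 0 \<partial>G)"
      unfolding Q_atMost[OF D]
    proof (rule nn_integral_cong_AE)
      show "AE m in G. indicator D (normalized m) * ennreal (exp (T m)) * indicator {..t} (T m) = 0"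
        using gamma_process_AE_pos[OF G \<nu>(3)]
        by eventually_elim (use t in \<open>simp add: T_def split: split_indicator\<close>)
    qed
    then show ?thesis by simp
  qed
  have fin: "emeasure (Q D) {..t} < \<infinity>" if D: "D \<in> sets (subprob_algebra borel)" for D t
  proof -
    have "emeasure (Q D) {..t} \<le> (\<integral>\<^sup>+m. ennreal (exp t) \<partial>G)"
      unfolding Q_atMost[OF D] by (intro nn_integral_mono) (auto split: split_indicator)
    also have "\<dots> = ennreal (exp t)" by (simp add: G.emeasure_space_1)
    finally show ?thesis by (simp add: le_less_trans)
  qed
  let ?U = "space (subprob_algebra borel) :: 'y measure set"
  have ind_U: "indicator ?U (normalized m) = (1 :: ennreal)" if "m \<in> space G" for m
    using that measurable_space[OF measurable_normalized, of m] by (simp add: gamma_process_lawD[OF G])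
  have proportional: "scale_measure (\<kappa> ?U) (Q E) = scale_measure (\<kappa> E) (Q ?U)"
  proof (rule measure_eqI_generator_eq[where E = "range atMost" and \<Omega> = UNIV and A = "\<lambda>i. {..real i}"])
    show "Int_stable (range (atMost :: real \<Rightarrow> _))"
      by (auto simp: Int_stable_def)
    show "sets (scale_measure (\<kappa> ?U) (Q E)) = sigma_sets UNIV (range atMost)"
      "sets (scale_measure (\<kappa> E) (Q ?U)) = sigma_sets UNIV (range atMost)"
      by (simp_all add: Q_def borel_eq_atMost)
    show "(\<Union>i. {..real i}) = UNIV" by (auto simp: real_arch_simple)
    show "emeasure (scale_measure (\<kappa> ?U) (Q E)) {..real i} \<noteq> \<infinity>" for i
      using fin[of ?U 1] fin[of E "real i"] by (simp add: \<kappa>_def ennreal_mult_eq_top_iff less_top)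
    fix X :: "real set" assume "X \<in> range atMost"
    then obtain t where t: "X = {..t}" by auto
    show "emeasure (scale_measure (\<kappa> ?U) (Q E)) X = emeasure (scale_measure (\<kappa> E) (Q ?U)) X"
      unfolding t by (cases "t \<le> 0") (simp_all add: Q_neg homogeneous mult_ac)
  qed auto
  have ratio: "\<kappa> ?U * (\<integral>\<^sup>+m. indicator E (normalized m) * f (T m) \<partial>G) = \<kappa> E * (\<integral>\<^sup>+m. f (T m) \<partial>G)"
    if [measurable]: "f \<in> borel_measurable borel" for f
  proof -
    have c: "ennreal (exp x) * (ennreal (exp (- x)) * y) = y" for x y
      by (subst mult.assoc[symmetric], subst ennreal_mult[symmetric]) (simp_all add: exp_minus)
    have i: "(\<integral>\<^sup>+t. ennreal (exp (- t)) * f t \<partial>Q D) = (\<integral>\<^sup>+m. indicator D (normalized m) * f (T m) \<partial>G)"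
      if D: "D \<in> sets (subprob_algebra borel)" for D
      by (subst int_Q[OF D]) (simp_all add: mult.assoc c)
    have sQ [measurable_cong]: "sets (Q D) = sets borel" for D by (simp add: Q_def)
    have "\<kappa> ?U * (\<integral>\<^sup>+t. ennreal (exp (- t)) * f t \<partial>Q E)
        = (\<integral>\<^sup>+t. ennreal (exp (- t)) * f t \<partial>scale_measure (\<kappa> ?U) (Q E))"
      by (rule nn_integral_scale_measure[symmetric]) measurable
    also have "\<dots> = \<kappa> E * (\<integral>\<^sup>+t. ennreal (exp (- t)) * f t \<partial>Q ?U)"
      unfolding proportional by (rule nn_integral_scale_measure) measurable
    finally show ?thesis
      unfolding i[OF E] i[OF sets.top] by (simp add: ind_U cong: nn_integral_cong)
  qed
  \<comment> \<open>Otherwise \<open>Q ?U\<close> would be null, by homogeneity, although \<open>exp T > 0\<close>.\<close>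
  have "\<kappa> ?U \<noteq> 0"
  proof
    assume 0: "\<kappa> ?U = 0"
    have "0 < (\<integral>\<^sup>+m. ennreal (exp (T m)) \<partial>G)"
      using G.emeasure_space_1 by (subst zero_less_iff_neq_zero, subst nn_integral_0_iff) auto
    also have "(\<integral>\<^sup>+m. ennreal (exp (T m)) \<partial>G) = emeasure (Q ?U) (\<Union>i. {..real i})"
    proof -
      have "(\<Union>i. {..real i}) = UNIV" by (auto simp: real_arch_simple)
      then show ?thesis
        using int_Q[of ?U "\<lambda>_. 1"] by (simp add: ind_U Q_def cong: nn_integral_cong)
    qed
    also have "\<dots> \<le> (\<Sum>i. emeasure (Q ?U) {..real i})"
      by (rule emeasure_subadditive_countably) (auto simp: Q_def)
    also have "\<dots> = (\<Sum>i. 0)"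
    proof (rule suminf_cong)
      show "emeasure (Q ?U) {..real i} = 0" for i
        using homogeneous[of ?U "real i"] Q_neg[of ?U "real i"] 0 by (cases "i = 0") auto
    qed
    finally show False by simp
  qed
  moreover have "\<kappa> ?U \<noteq> \<infinity>"
    using fin[of ?U 1] by (simp add: \<kappa>_def)
  moreover have "\<kappa> ?U * (\<integral>\<^sup>+m. indicator E (normalized m) * h (T m) \<partial>G)
      = \<kappa> ?U * ((\<integral>\<^sup>+m. indicator E (normalized m) \<partial>G) * (\<integral>\<^sup>+m. h (T m) \<partial>G))"
    using ratio[OF h] ratio[of "\<lambda>_. 1"] G.emeasure_space_1 by (simp add: mult.assoc[symmetric])
  ultimately show ?thesis
    unfolding T_def[symmetric] by (simp add: ennreal_mult_cancel_left)
qed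

lemma gamma_process_negative_moment:
  assumes G: "gamma_process_law \<nu> G" and a: "0 < measure \<nu> UNIV" and m: "0 < measure \<nu> UNIV - m"
  shows "(\<integral>\<^sup>+\<mu>. ennreal (Gamma (measure \<nu> UNIV) / Gamma (measure \<nu> UNIV - m)
      * measure \<mu> UNIV powr (- m)) \<partial>G) = 1"
proof -
  define c where "c = Gamma (measure \<nu> UNIV) / Gamma (measure \<nu> UNIV - m)"
  have c: "0 < c" "Gamma (measure \<nu> UNIV - m) / Gamma (measure \<nu> UNIV) = 1 / c"
    using Gamma_real_pos[OF a] Gamma_real_pos[OF m] by (simp_all add: c_def)
  have "(\<integral>\<^sup>+\<mu>. ennreal (c * measure \<mu> UNIV powr (- m)) \<partial>G)
      = (\<integral>\<^sup>+\<mu>. ennreal c * ennreal (enn2real (emeasure \<mu> UNIV) powr (- m)) \<partial>G)"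
    using c by (simp add: measure_def ennreal_mult)
  also have "\<dots> = (\<integral>\<^sup>+x. ennreal c * ennreal (enn2real x powr (- m)) \<partial>gamma_ennreal (measure \<nu> UNIV))"
    by (rule gamma_process_nn_integral[OF G]) simp_all
  also have "\<dots> = ennreal c * ennreal (1 / c)"
    using gamma_negative_moment[OF a m] by (simp add: nn_integral_cmult c)
  also have "\<dots> = 1"
    using c by (simp add: ennreal_mult[symmetric])
  finally show ?thesis unfolding c_def .
qed

text \<open>
  The beta-gamma law differs from that of the gamma process only by a weight in \<open>T\<close>, and \<open>P\<close> is
  independent of \<open>T\<close>.
\<close>

lemma dirichlet_process_law_of_beta_gamma:
  fixes \<nu> :: "'y::polish_space measure"
  assumes \<nu>: "finite_measure \<nu>" "sets \<nu> = sets borel" "0 < measure \<nu> UNIV"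
    and L: "beta_gamma_law \<nu> m L" and m: "0 < measure \<nu> UNIV - m"
  shows "dirichlet_process_law \<nu> (distr L (subprob_algebra borel) normalized)"
proof -
  let ?w = "\<lambda>x. ennreal (Gamma (measure \<nu> UNIV) / Gamma (measure \<nu> UNIV - m) * x powr (- m))"
  from L obtain G where G: "gamma_process_law \<nu> G" and LG: "L = density G (\<lambda>\<mu>. ?w (measure \<mu> UNIV))"
    by (auto simp: beta_gamma_law_def)
  note [measurable_cong] = gamma_process_lawD(1)[OF G]
  have "distr L (subprob_algebra borel) normalized = distr G (subprob_algebra borel) normalized"
  proof (rule measure_eqI)
    fix E assume "E \<in> sets (distr L (subprob_algebra borel) (normalized :: 'y measure \<Rightarrow> _))"
    then have E [measurable]: "E \<in> sets (subprob_algebra borel)" by simp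
    have "emeasure (distr L (subprob_algebra borel) normalized) E
        = (\<integral>\<^sup>+\<mu>. indicator E (normalized \<mu>) \<partial>L)"
      unfolding LG by (subst nn_integral_indicator[symmetric], simp, subst nn_integral_distr) simp_all
    also have "\<dots> = (\<integral>\<^sup>+\<mu>. indicator E (normalized \<mu>) * ?w (measure \<mu> UNIV) \<partial>G)"
      unfolding LG by (subst nn_integral_density) (simp_all add: mult.commute)
    also have "\<dots> = (\<integral>\<^sup>+\<mu>. indicator E (normalized \<mu>) \<partial>G) * (\<integral>\<^sup>+\<mu>. ?w (measure \<mu> UNIV) \<partial>G)"
      by (rule gamma_process_total_mass_independent[OF \<nu> G E]) measurable
    also have "(\<integral>\<^sup>+\<mu>. ?w (measure \<mu> UNIV) \<partial>G) = 1"
      by (rule gamma_process_negative_moment[OF G \<nu>(3) m])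
    also have "(\<integral>\<^sup>+\<mu>. indicator E (normalized \<mu>) \<partial>G) * 1 = (\<integral>\<^sup>+\<mu>. indicator E (normalized \<mu>) \<partial>G)"
      by simp
    also have "\<dots> = emeasure (distr G (subprob_algebra borel) normalized) E"
      by (subst nn_integral_indicator[symmetric], simp, subst nn_integral_distr) simp_all
    finally show "emeasure (distr L (subprob_algebra borel) normalized) E
      = emeasure (distr G (subprob_algebra borel) normalized) E" .
  qed simp
  then show ?thesis using G by (auto simp: dirichlet_process_law_def)
qed

section \<open>Laplace functionals\<close>

lemma exp_neg_0 [simp]: "exp_neg 0 = 1"
  by (simp add: exp_neg_def)

lemma exp_neg_nonneg [simp]: "0 \<le> exp_neg x"
  by (simp add: exp_neg_def)

lemma exp_neg_le_1 [simp]: "exp_neg x \<le> 1"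
  by (simp add: exp_neg_def)

lemma exp_neg_ennreal: "0 \<le> x \<Longrightarrow> exp_neg (ennreal x) = exp (- x)"
  by (simp add: exp_neg_def)

lemma exp_neg_add: "exp_neg (x + y) = exp_neg x * exp_neg y"
  by (auto simp: exp_neg_def enn2real_plus less_top[symmetric] exp_add[symmetric] algebra_simps)

lemma exp_neg_sum: "exp_neg (\<Sum>i\<in>I. f i) = (\<Prod>i\<in>I. exp_neg (f i))"
  by (induction I rule: infinite_finite_induct) (simp_all add: exp_neg_add)

lemma measurable_exp_neg [measurable]: "exp_neg \<in> borel_measurable borel"
  unfolding exp_neg_def by measurable

lemma exp_neg_le: "ennreal r \<le> x \<Longrightarrow> 0 \<le> r \<Longrightarrow> exp_neg x \<le> exp (- r)"
  by (cases x) (auto simp: exp_neg_def)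

lemma tendsto_exp_neg:
  assumes "(f \<longlongrightarrow> x) F" shows "((\<lambda>i. exp_neg (f i)) \<longlongrightarrow> exp_neg x) F"
proof (cases "x = \<infinity>")
  case False
  then have x: "x < \<infinity>" by (simp add: less_top)
  have "\<forall>\<^sub>F i in F. f i < \<infinity>"
    using assms x by (rule order_tendstoD)
  then have e: "\<forall>\<^sub>F i in F. exp (- enn2real (f i)) = exp_neg (f i)"
    by eventually_elim (auto simp: exp_neg_def)
  have "((\<lambda>i. exp (- enn2real (f i))) \<longlongrightarrow> exp (- enn2real x)) F"
    using x assms by (intro tendsto_intros) simp_all
  then have "((\<lambda>i. exp_neg (f i)) \<longlongrightarrow> exp (- enn2real x)) F"
    by (rule Lim_transform_eventually[OF _ e])
  then show ?thesis using False by (simp add: exp_neg_def)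
next
  case True
  have "((\<lambda>i. exp_neg (f i)) \<longlongrightarrow> 0) F"
  proof (rule order_tendstoI)
    fix a :: real assume "a < 0"
    then show "\<forall>\<^sub>F i in F. a < exp_neg (f i)"
      by (intro always_eventually allI less_le_trans[OF _ exp_neg_nonneg])
  next
    fix a :: real assume a: "0 < a"
    define r where "r = max 0 (- ln a + 1)"
    have r: "0 \<le> r" "exp (- r) < a"
    proof -
      have "exp (- r) < exp (ln a)" unfolding exp_less_cancel_iff by (simp add: r_def)
      then show "exp (- r) < a" using a by simp
    qed (simp add: r_def)
    have "\<forall>\<^sub>F i in F. ennreal r < f i"
      using assms True by (intro order_tendstoD(1)[of f top]) (simp_all add: less_top[symmetric])
    then show "\<forall>\<^sub>F i in F. exp_neg (f i) < a"
      by eventually_elim (use r in \<open>auto intro: le_less_trans[OF exp_neg_le[of r]]\<close>)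
  qed
  then show ?thesis using True by (simp add: exp_neg_def)
qed

lemma measurable_nn_integral_bfm [measurable]:
  assumes "f \<in> borel_measurable borel"
  shows "(\<lambda>\<mu>. \<integral>\<^sup>+x. f x \<partial>\<mu>) \<in> borel_measurable bfm_algebra"
  using assms
proof (induction rule: borel_measurable_induct)
  case (cong f g)
  then have "f = g" by auto
  with cong show ?case by simp
next
  case (set A)
  have "(\<lambda>\<mu>. emeasure \<mu> A) \<in> borel_measurable bfm_algebra" using set by simp
  then show ?case
    by (rule measurable_cong[THEN iffD1, rotated]) (simp add: set sets_of_boundedly_finite)
next
  case (mult u c)
  then have "(\<lambda>\<mu>. c * (\<integral>\<^sup>+x. u x \<partial>\<mu>)) \<in> borel_measurable bfm_algebra" by simp
  then show ?case
  proof (rule measurable_cong[THEN iffD1, rotated])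
    fix \<mu> assume "\<mu> \<in> space (bfm_algebra :: 'a measure measure)"
    then have [measurable_cong]: "sets \<mu> = sets borel" by (rule sets_of_boundedly_finite)
    show "c * (\<integral>\<^sup>+x. u x \<partial>\<mu>) = (\<integral>\<^sup>+x. c * u x \<partial>\<mu>)"
      using mult by (simp add: nn_integral_cmult)
  qed
next
  case (add u v)
  then have "(\<lambda>\<mu>. (\<integral>\<^sup>+x. v x \<partial>\<mu>) + (\<integral>\<^sup>+x. u x \<partial>\<mu>)) \<in> borel_measurable bfm_algebra" by simp
  then show ?case
  proof (rule measurable_cong[THEN iffD1, rotated])
    fix \<mu> assume "\<mu> \<in> space (bfm_algebra :: 'a measure measure)"
    then have [measurable_cong]: "sets \<mu> = sets borel" by (rule sets_of_boundedly_finite)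
    show "(\<integral>\<^sup>+x. v x \<partial>\<mu>) + (\<integral>\<^sup>+x. u x \<partial>\<mu>) = (\<integral>\<^sup>+x. v x + u x \<partial>\<mu>)"
      using add by (simp add: nn_integral_add)
  qed
next
  case (seq U)
  have "(\<lambda>\<mu>. SUP i. \<integral>\<^sup>+x. U i x \<partial>\<mu>) \<in> borel_measurable bfm_algebra"
    using seq by (intro borel_measurable_SUP) auto
  then show ?case
  proof (rule measurable_cong[THEN iffD1, rotated])
    fix \<mu> assume "\<mu> \<in> space (bfm_algebra :: 'a measure measure)"
    then have [measurable_cong]: "sets \<mu> = sets borel" by (rule sets_of_boundedly_finite)
    show "(SUP i. \<integral>\<^sup>+x. U i x \<partial>\<mu>) = (\<integral>\<^sup>+x. (SUP i. U i) x \<partial>\<mu>)"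
      unfolding SUP_apply
      by (rule nn_integral_monotone_convergence_SUP[OF \<open>incseq U\<close>, symmetric]) (use seq in simp)
  qed
qed

lemma gamma_laplace_exp_neg:
  assumes "0 \<le> a" "0 \<le> s"
  shows "(\<integral>\<^sup>+x. ennreal (exp_neg (ennreal s * x)) \<partial>gamma_ennreal a) = ennreal ((1 + s) powr (- a))"
proof -
  have "(\<integral>\<^sup>+x. ennreal (exp_neg (ennreal s * x)) \<partial>gamma_ennreal a)
      = (\<integral>\<^sup>+x. ennreal (exp (- s * enn2real x)) \<partial>gamma_ennreal a)"
    using AE_gamma_ennreal_finite[of a]
    by (intro nn_integral_cong_AE, eventually_elim)
      (use assms in \<open>auto simp: exp_neg_def enn2real_mult ennreal_mult_eq_top_iff\<close>)
  then show ?thesis using assms gamma_laplace by simp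
qed

text \<open>
  On the level sets of a simple function the process takes independent gamma values.
\<close>

lemma gamma_process_laplace_simple:
  fixes \<nu> :: "'y::polish_space measure"
  assumes \<nu>: "finite_measure \<nu>" "sets \<nu> = sets borel" and G: "gamma_process_law \<nu> G"
    and s: "simple_function borel s" "\<And>x. 0 \<le> s x"
  shows "(\<integral>\<mu>. exp_neg (\<integral>\<^sup>+x. ennreal (s x) \<partial>\<mu>) \<partial>G) = exp (- (\<integral>x. ln (1 + s x) \<partial>\<nu>))"
proof -
  note [measurable_cong] = gamma_process_lawD(1)[OF G] \<nu>(2)
  interpret nu: finite_measure \<nu> by fact
  interpret G: prob_space G by (rule gamma_process_lawD(3)[OF G])
  have [measurable]: "s \<in> borel_measurable borel" using s(1) by (rule borel_measurable_simple_function)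
  have "finite (range s)" using simple_functionD(1)[OF s(1)] by simp
  then obtain e :: "nat \<Rightarrow> real" and m where e: "bij_betw e {0..<m} (range s)"
    using ex_bij_betw_nat_finite by blast
  \<comment> \<open>The level sets of \<open>s\<close>, padded by empty sets to a disjoint sequence.\<close>
  define B where "B j = (if j < m then s -` {e j} else {})" for j
  define v where "v j = (if j < m then e j else 0)" for j
  have B [measurable]: "B j \<in> sets borel" for j
    using simple_functionD(2)[OF s(1), of "{e j}"] by (simp add: B_def)
  have inj: "inj_on e {0..<m}" using e by (auto simp: bij_betw_def)
  have d: "disjoint_family B"
    using inj by (auto simp: B_def disjoint_family_on_def inj_on_def)
  have v0: "0 \<le> v j" for j
  proof (cases "j < m")
    case True
    then have "e j \<in> range s" using e by (auto simp: bij_betw_def)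
    then show ?thesis using s(2) True by (auto simp: v_def)
  qed (simp add: v_def)
  have decomp: "f (s x) = (\<Sum>j<m. f (v j) * indicator (B j) x)" for f :: "real \<Rightarrow> real" and x
  proof -
    have "s x \<in> e ` {0..<m}" using e by (simp add: bij_betw_def)
    then obtain k where k: "k < m" "e k = s x" by auto
    have "(\<Sum>j<m. f (v j) * indicator (B j) x) = (\<Sum>j<m. if j = k then f (v k) else 0)"
      using k inj by (intro sum.cong) (auto simp: B_def v_def inj_on_def split: split_indicator)
    then show ?thesis using k by (simp add: v_def)
  qed
  have "(\<integral>\<^sup>+\<mu>. ennreal (exp_neg (\<integral>\<^sup>+x. ennreal (s x) \<partial>\<mu>)) \<partial>G)
      = (\<integral>\<^sup>+\<mu>. (\<Prod>j<m. ennreal (exp_neg (ennreal (v j) * emeasure \<mu> (B j)))) \<partial>G)"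
  proof (rule nn_integral_cong)
    fix \<mu> assume "\<mu> \<in> space G"
    then have [measurable_cong]: "sets \<mu> = sets borel"
      by (simp add: gamma_process_lawD[OF G] sets_of_boundedly_finite)
    have "ennreal (s x) = (\<Sum>j<m. ennreal (v j) * indicator (B j) x)" for x
    proof -
      have "ennreal (s x) = ennreal (\<Sum>j<m. v j * indicator (B j) x)"
        using decomp[of "\<lambda>x. x" x] by simp
      also have "\<dots> = (\<Sum>j<m. ennreal (v j * indicator (B j) x))"
        using v0 by (intro sum_ennreal[symmetric]) simp
      finally show ?thesis
        using v0 by (simp add: ennreal_mult ennreal_indicator)
    qed
    then have "(\<integral>\<^sup>+x. ennreal (s x) \<partial>\<mu>) = (\<integral>\<^sup>+x. (\<Sum>j<m. ennreal (v j) * indicator (B j) x) \<partial>\<mu>)"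
      by simp
    also have "\<dots> = (\<Sum>j<m. ennreal (v j) * emeasure \<mu> (B j))"
      by (subst nn_integral_sum) (simp_all add: nn_integral_cmult)
    finally show "ennreal (exp_neg (\<integral>\<^sup>+x. ennreal (s x) \<partial>\<mu>))
        = (\<Prod>j<m. ennreal (exp_neg (ennreal (v j) * emeasure \<mu> (B j))))"
      by (simp add: exp_neg_sum prod_ennreal)
  qed
  also have "\<dots> = (\<Prod>j<m. \<integral>\<^sup>+x. ennreal (exp_neg (ennreal (v j) * x)) \<partial>gamma_ennreal (measure \<nu> (B j)))"
    by (rule gamma_process_nn_integral_prod[OF G B d, where
          h = "\<lambda>j x. ennreal (exp_neg (ennreal (v j) * x))"]) simp_all
  also have "\<dots> = (\<Prod>j<m. ennreal ((1 + v j) powr (- measure \<nu> (B j))))"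
    using v0 by (simp add: gamma_laplace_exp_neg)
  also have "\<dots> = ennreal (exp (- (\<integral>x. ln (1 + s x) \<partial>\<nu>)))"
  proof -
    have "(\<integral>x. ln (1 + s x) \<partial>\<nu>) = (\<Sum>j<m. ln (1 + v j) * measure \<nu> (B j))"
    proof -
      have B_int: "integrable \<nu> (indicator (B j) :: _ \<Rightarrow> real)" for j
        by (rule nu.integrable_const_bound[of _ 1]) auto
      have "B j \<inter> space \<nu> = B j" for j
        using sets_eq_imp_space_eq[OF \<nu>(2)] by simp
      with B_int show ?thesis
        unfolding decomp[of "\<lambda>x. ln (1 + x)"] by (subst Bochner_Integration.integral_sum) simp_all
    qed
    moreover have "(1 + v j) powr (- measure \<nu> (B j)) = exp (- (ln (1 + v j) * measure \<nu> (B j)))" for j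
      using v0[of j] by (simp add: powr_def mult.commute)
    ultimately show ?thesis
      by (simp add: prod_ennreal exp_sum sum_negf[symmetric])
  qed
  finally show ?thesis
    by (subst integral_eq_nn_integral) simp_all
qed

text \<open>
  Simple functions increasing to \<open>g\<close>; the limits pass through both integrals by domination, by 1
  and by \<open>ln (1 + g)\<close>.  The case \<open>\<mu>(g) = \<infinity>\<close> is covered, since \<open>exp_neg\<close> is continuous also there.
\<close>

lemma gamma_process_laplace:
  fixes \<nu> :: "'y::polish_space measure"
  assumes \<nu>: "finite_measure \<nu>" "sets \<nu> = sets borel" and G: "gamma_process_law \<nu> G"
    and g [measurable]: "g \<in> borel_measurable borel" and g0: "\<And>x. 0 \<le> g x"
    and int: "integrable \<nu> (\<lambda>x. ln (1 + g x))"
  shows "laplace_functional G g = exp (- (\<integral>x. ln (1 + g x) \<partial>\<nu>))"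
proof -
  note [measurable_cong] = gamma_process_lawD(1)[OF G] \<nu>(2)
  interpret nu: finite_measure \<nu> by fact
  interpret G: prob_space G by (rule gamma_process_lawD(3)[OF G])
  from borel_measurable_implies_simple_function_sequence_real[of g borel, OF g g0]
  obtain s where s: "\<And>i. simple_function borel (s i)" and inc: "incseq s"
    and bd: "\<And>x. bdd_above (range (\<lambda>i. s i x))" and s0: "\<And>i x. 0 \<le> s i x" and gs: "g = (SUP i. s i)"
    by (auto simp: le_fun_def)
  have [measurable]: "s i \<in> borel_measurable borel" for i
    using s by (rule borel_measurable_simple_function)
  have gx: "g x = (SUP i. s i x)" for x unfolding gs by (rule SUP_apply)
  have mono: "incseq (\<lambda>i. s i x)" for x using inc by (auto simp: incseq_def le_fun_def)
  have lim: "(\<lambda>i. s i x) \<longlonglongrightarrow> g x" for x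
    unfolding gx by (rule LIMSEQ_incseq_SUP[OF bd mono])
  have le: "s i x \<le> g x" for i x using mono lim by (rule incseq_le)
  have "(\<lambda>i. \<integral>\<mu>. exp_neg (\<integral>\<^sup>+x. ennreal (s i x) \<partial>\<mu>) \<partial>G)
      \<longlonglongrightarrow> (\<integral>\<mu>. exp_neg (\<integral>\<^sup>+x. ennreal (g x) \<partial>\<mu>) \<partial>G)"
  proof (rule integral_dominated_convergence[where w = "\<lambda>_. 1"])
    show "AE \<mu> in G. (\<lambda>i. exp_neg (\<integral>\<^sup>+x. ennreal (s i x) \<partial>\<mu>)) \<longlonglongrightarrow> exp_neg (\<integral>\<^sup>+x. ennreal (g x) \<partial>\<mu>)"
    proof (rule AE_I2)
      fix \<mu> assume "\<mu> \<in> space G"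
      then have [measurable_cong]: "sets \<mu> = sets borel"
        by (simp add: gamma_process_lawD[OF G] sets_of_boundedly_finite)
      show "(\<lambda>i. exp_neg (\<integral>\<^sup>+x. ennreal (s i x) \<partial>\<mu>)) \<longlonglongrightarrow> exp_neg (\<integral>\<^sup>+x. ennreal (g x) \<partial>\<mu>)"
        using lim mono by (intro tendsto_exp_neg nn_integral_LIMSEQ)
          (auto simp: incseq_def le_fun_def intro: ennreal_leI)
    qed
  qed simp_all
  moreover have "(\<lambda>i. exp (- (\<integral>x. ln (1 + s i x) \<partial>\<nu>))) \<longlonglongrightarrow> exp (- (\<integral>x. ln (1 + g x) \<partial>\<nu>))"
  proof (intro tendsto_intros integral_dominated_convergence[where w = "\<lambda>x. ln (1 + g x)"])
    show "AE x in \<nu>. (\<lambda>i. ln (1 + s i x)) \<longlonglongrightarrow> ln (1 + g x)"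
    proof (rule AE_I2)
      fix x show "(\<lambda>i. ln (1 + s i x)) \<longlonglongrightarrow> ln (1 + g x)"
        using lim[of x] g0[of x] by (intro tendsto_ln tendsto_intros) auto
    qed
    show "AE x in \<nu>. norm (ln (1 + s i x)) \<le> ln (1 + g x)" for i
    proof (rule AE_I2)
      fix x show "norm (ln (1 + s i x)) \<le> ln (1 + g x)"
        using s0[of i x] le[of i x] by simp
    qed
  qed (use int in simp_all)
  moreover have "(\<integral>\<mu>. exp_neg (\<integral>\<^sup>+x. ennreal (s i x) \<partial>\<mu>) \<partial>G) = exp (- (\<integral>x. ln (1 + s i x) \<partial>\<nu>))" for i
    by (rule gamma_process_laplace_simple[OF \<nu> G s s0])
  ultimately show ?thesis
    unfolding laplace_functional_def by (intro LIMSEQ_unique) simp_all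
qed

lemma integrable_ln_1_plus:
  fixes g :: "'y::polish_space \<Rightarrow> real" and u s :: real
  assumes "finite_measure \<nu>" "sets \<nu> = sets borel" "g \<in> borel_measurable borel" "\<And>x. 0 \<le> g x"
    "integrable \<nu> (\<lambda>x. ln (1 + g x))" and "0 \<le> u" "0 \<le> s"
  shows "integrable \<nu> (\<lambda>x. ln (1 + (u * g x + s)))"
proof -
  note [measurable_cong] = assms(2) and [measurable] = assms(3)
  interpret finite_measure \<nu> by fact
  show ?thesis
  proof (rule Bochner_Integration.integrable_bound)
    show "integrable \<nu> (\<lambda>x. ln (1 + g x) + ln (1 + (u + s)))"
      using assms(5) by simp
    show "AE x in \<nu>. norm (ln (1 + (u * g x + s))) \<le> norm (ln (1 + g x) + ln (1 + (u + s)))"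
    proof (rule AE_I2)
      fix x
      have g: "0 \<le> g x" by fact
      have p: "0 \<le> u * g x" "0 \<le> s * g x" using mult_nonneg_nonneg[OF assms(6) g] mult_nonneg_nonneg[OF assms(7) g] .
      have "ln (1 + (u * g x + s)) \<le> ln ((1 + g x) * (1 + (u + s)))"
      proof (rule ln_mono)
        show "0 < 1 + (u * g x + s)" using p assms(7) by linarith
        show "1 + (u * g x + s) \<le> (1 + g x) * (1 + (u + s))"
          using p g assms(6) by (simp add: algebra_simps)
      qed
      also have "\<dots> = ln (1 + g x) + ln (1 + (u + s))"
        using g assms(6,7) by (intro ln_mult_pos) linarith+
      finally show "norm (ln (1 + (u * g x + s))) \<le> norm (ln (1 + g x) + ln (1 + (u + s)))"
        using p assms(7) by simp
    qed
  qed measurable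
qed

text \<open>The substitution \<open>u = 1 / (1 + s)\<close>.\<close>

lemma nn_integral_beta_substitution:
  fixes \<Psi> :: "real \<Rightarrow> real"
  assumes [measurable]: "\<Psi> \<in> borel_measurable borel" and \<Psi>: "\<And>u. 0 \<le> \<Psi> u" "\<And>u. \<Psi> u \<le> 1"
    and m: "0 < m" and q: "0 < q"
  shows "(\<integral>\<^sup>+s. ennreal (indicator {0<..} s * (s powr (m - 1) * (1 + s) powr (- (q + m)) * \<Psi> (1 / (1 + s)))) \<partial>lborel)
    = ennreal (\<integral>u. indicator {0<..<1} u * (u powr (q - 1) * (1 - u) powr (m - 1) * \<Psi> u) \<partial>lborel)"
proof -
  define f where "f s = s powr (m - 1) * (1 + s) powr (- (q + m)) * \<Psi> (1 / (1 + s))" for s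
  define k where "k u = u powr (q - 1) * (1 - u) powr (m - 1) * \<Psi> u" for u
  have [measurable]: "f \<in> borel_measurable borel" "k \<in> borel_measurable borel"
    unfolding f_def k_def by measurable
  let ?g = "\<lambda>u::real. 1 / u - 1"
  have img: "?g ` {0<..<1} = {0<..}"
  proof (intro set_eqI iffI)
    fix s :: real assume "s \<in> {0<..}"
    then show "s \<in> ?g ` {0<..<1}"
      by (intro image_eqI[of _ _ "1 / (1 + s)"]) (auto simp: field_simps)
  qed (auto simp: field_simps)
  have jac: "\<bar>- 1 / u\<^sup>2\<bar> * f (?g u) = k u" if u: "u \<in> {0<..<1}" for u
  proof -
    have a: "?g u = (1 - u) / u" "1 + ?g u = 1 / u" using u by (auto simp: field_simps)
    have b: "(1 / u) powr (- (q + m)) = u powr (q + m)"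
      using u by (simp add: powr_def ln_div algebra_simps)
    have c: "u powr (q + m) = u powr (q - 1) * u powr (m - 1) * u\<^sup>2"
    proof -
      have "u powr (q + m) = u powr ((q - 1) + ((m - 1) + 2))" by simp
      also have "\<dots> = u powr (q - 1) * (u powr (m - 1) * u powr 2)"
        unfolding powr_add ..
      finally show ?thesis using u by simp
    qed
    have "\<bar>- 1 / u\<^sup>2\<bar> * f (?g u) = 1 / u\<^sup>2 * (((1 - u) / u) powr (m - 1) * u powr (q + m) * \<Psi> u)"
      unfolding f_def a(2) b unfolding a(1) by simp
    also have "\<dots> = k u"
    proof -
      have cancel: "1 / v * (x / y * (w * y * v) * z) = w * x * z" if "v \<noteq> 0" "y \<noteq> 0" for v w x y z :: real
        using that by simp
      have p: "((1 - u) / u) powr (m - 1) = (1 - u) powr (m - 1) / u powr (m - 1)"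
        by (rule powr_divide)
      show ?thesis
        unfolding c k_def p using u by (intro cancel) auto
    qed
    finally show ?thesis .
  qed
  have "set_integrable lborel {0..1} (\<lambda>u. u powr (q - 1) * (1 - u) powr (m - 1))"
    by (rule integrable_Beta[OF q m])
  then have "set_integrable lborel {0<..<1} (\<lambda>u. u powr (q - 1) * (1 - u) powr (m - 1))"
    by (rule set_integrable_subset) auto
  then have k_int: "set_integrable lborel {0<..<1} k"
    unfolding set_integrable_def
    by (rule Bochner_Integration.integrable_bound)
      (auto simp: k_def abs_mult \<Psi> intro!: mult_left_le split: split_indicator)
  then have k_abs: "k absolutely_integrable_on {0<..<1}"
    unfolding set_integrable_def by (subst integrable_completion) simp_all
  then have "(\<lambda>u. \<bar>- 1 / u\<^sup>2\<bar> * f (?g u)) absolutely_integrable_on {0<..<1}"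
    by (rule set_integrable_cong[THEN iffD1, rotated -1]) (simp_all add: jac[simplified])
  moreover have "integral {0<..<1} (\<lambda>u. \<bar>- 1 / u\<^sup>2\<bar> * f (?g u)) = integral {0<..<1} k"
    by (intro integral_cong jac)
  moreover have "(?g has_field_derivative - 1 / u\<^sup>2) (at u within {0<..<1})" if "u \<in> {0<..<1}" for u
    using that by (auto intro!: derivative_eq_intros simp: power2_eq_square)
  moreover have "inj_on ?g {0<..<1}"
    by (auto intro!: inj_onI)
  ultimately have fk: "f absolutely_integrable_on {0<..}" "integral {0<..} f = integral {0<..<1} k"
    using has_absolute_integral_change_of_variables_1'[of "{0<..<1}" ?g "\<lambda>u. - 1 / u\<^sup>2" f "integral {0<..<1} k"]
    unfolding img by simp_all
  have f_int: "set_integrable lborel {0<..} f"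
    using fk(1) unfolding set_integrable_def by (subst (asm) integrable_completion) simp_all
  have "(\<integral>\<^sup>+s. ennreal (indicator {0<..} s * f s) \<partial>lborel) = ennreal (\<integral>s. indicator {0<..} s * f s \<partial>lborel)"
    using f_int by (intro nn_integral_eq_integral) (auto simp: set_integrable_def f_def \<Psi> split: split_indicator)
  also have "(\<integral>s. indicator {0<..} s * f s \<partial>lborel) = integral {0<..} f"
    using set_borel_integral_eq_integral(2)[OF f_int] by (simp add: set_lebesgue_integral_def)
  also have "\<dots> = (\<integral>u. indicator {0<..<1} u * k u \<partial>lborel)"
    using set_borel_integral_eq_integral(2)[OF k_int] fk(2) by (simp add: set_lebesgue_integral_def)
  finally show ?thesis unfolding f_def k_def .
qed

text \<open>
  Since \<open>\<Gamma>(m) T\<^sup>-\<^sup>m\<close> is the integral of \<open>s\<^sup>m\<^sup>-\<^sup>1 exp (- s T)\<close>, the Laplace functional of a beta-gamma law is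
  an integral of those of the gamma process at \<open>g + s\<close>, and
  \<open>ln (1 + g + s) = ln (1 + s) + ln (1 + g / (1 + s))\<close>.
\<close>

theorem beta_gamma_laplace:
  fixes \<nu> :: "'y::polish_space measure"
  assumes \<nu>: "finite_measure \<nu>" "sets \<nu> = sets borel" and G: "gamma_process_law \<nu> G"
    and g [measurable]: "g \<in> borel_measurable borel" and g0: "\<And>x. 0 \<le> g x"
    and int: "integrable \<nu> (\<lambda>x. ln (1 + g x))"
    and m: "0 < m" and q: "0 < q" and a: "measure \<nu> UNIV = q + m"
  shows "laplace_functional (density G (\<lambda>\<mu>. ennreal (Gamma (q + m) / Gamma q * measure \<mu> UNIV powr (- m)))) g
    = (\<integral>u. exp (- (\<integral>x. ln (1 + u * g x) \<partial>\<nu>)) \<partial>beta_distr q m)"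
proof -
  note [measurable_cong] = gamma_process_lawD(1)[OF G] \<nu>(2)
  interpret nu: finite_measure \<nu> by fact
  interpret G: prob_space G by (rule gamma_process_lawD(3)[OF G])
  interpret GL: pair_sigma_finite G lborel ..
  have pos: "0 < Gamma (q + m)" "0 < Gamma q" "0 < Gamma m"
    using m q by (simp_all add: Gamma_real_pos)
  define \<phi> where "\<phi> \<mu> = exp_neg (\<integral>\<^sup>+x. ennreal (g x) \<partial>\<mu>)" for \<mu>
  have [measurable]: "\<phi> \<in> borel_measurable bfm_algebra" unfolding \<phi>_def by measurable
  have \<phi>0: "0 \<le> \<phi> \<mu>" for \<mu> by (simp add: \<phi>_def)
  \<comment> \<open>Cut off at negative \<open>u\<close> so that \<open>\<Psi> \<le> 1\<close> holds throughout; \<open>beta_distr\<close> lives on \<open>{0<..<1}\<close>.\<close>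
  define \<Psi> where "\<Psi> u = (if 0 \<le> u then exp (- (\<integral>x. ln (1 + u * g x) \<partial>\<nu>)) else 0)" for u
  have [measurable]: "\<Psi> \<in> borel_measurable borel"
  proof -
    have "(\<lambda>(u, x). ln (1 + u * g x)) \<in> borel_measurable (borel \<Otimes>\<^sub>M \<nu>)" by measurable
    then have h [measurable]: "(\<lambda>u. \<integral>x. ln (1 + u * g x) \<partial>\<nu>) \<in> borel_measurable borel"
      by (rule nu.borel_measurable_lebesgue_integral)
    show ?thesis unfolding \<Psi>_def by measurable
  qed
  have \<Psi>: "0 \<le> \<Psi> u" "\<Psi> u \<le> 1" for u
    using g0 by (auto simp: \<Psi>_def intro!: integral_nonneg_AE AE_I2 ln_ge_zero mult_nonneg_nonneg)
  define e where "e s \<mu> = exp_neg ((\<integral>\<^sup>+x. ennreal (g x) \<partial>\<mu>) + ennreal s * emeasure \<mu> UNIV)" for s \<mu>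
  have [measurable]: "(\<lambda>(\<mu>, s). e s \<mu>) \<in> borel_measurable (G \<Otimes>\<^sub>M lborel)"
    unfolding e_def by measurable
  have [measurable]: "(\<lambda>\<mu>. e s \<mu>) \<in> borel_measurable G" "(\<lambda>s. e s \<mu>) \<in> borel_measurable lborel" for s \<mu>
    unfolding e_def by measurable
  have e_eq: "e s \<mu> = exp_neg (\<integral>\<^sup>+x. ennreal (g x + s) \<partial>\<mu>)" if s: "0 < s" and \<mu>: "\<mu> \<in> space G" for s \<mu>
  proof -
    have s\<mu> [measurable_cong]: "sets \<mu> = sets borel"
      using \<mu> by (simp add: gamma_process_lawD[OF G] sets_of_boundedly_finite)
    have "(\<integral>\<^sup>+x. ennreal (g x + s) \<partial>\<mu>) = (\<integral>\<^sup>+x. ennreal (g x) + ennreal s \<partial>\<mu>)"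
      using g0 s by (intro nn_integral_cong) simp
    also have "\<dots> = (\<integral>\<^sup>+x. ennreal (g x) \<partial>\<mu>) + ennreal s * emeasure \<mu> UNIV"
      using sets_eq_imp_space_eq[OF s\<mu>] by (subst nn_integral_add) simp_all
    finally show ?thesis by (simp add: e_def)
  qed
  let ?I = "\<integral>u. indicator {0<..<1} u * (u powr (q - 1) * (1 - u) powr (m - 1) * \<Psi> u) \<partial>lborel"
  have laplace_shift: "(\<integral>\<^sup>+\<mu>. ennreal (e s \<mu>) \<partial>G)
      = ennreal ((1 + s) powr (- (q + m)) * \<Psi> (1 / (1 + s)))" if s: "0 < s" for s
  proof -
    have int_s: "integrable \<nu> (\<lambda>x. ln (1 + (g x + s)))" and
      int_u: "integrable \<nu> (\<lambda>x. ln (1 + 1 / (1 + s) * g x))"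
      using integrable_ln_1_plus[OF \<nu> g g0 int, of 1 s] integrable_ln_1_plus[OF \<nu> g g0 int, of "1 / (1 + s)" 0] s
      by simp_all
    have "(\<integral>\<mu>. exp_neg (\<integral>\<^sup>+x. ennreal (g x + s) \<partial>\<mu>) \<partial>G) = exp (- (\<integral>x. ln (1 + (g x + s)) \<partial>\<nu>))"
      using gamma_process_laplace[OF \<nu> G _ _ int_s] g0 s
      by (simp add: laplace_functional_def add_nonneg_nonneg)
    also have "(\<integral>x. ln (1 + (g x + s)) \<partial>\<nu>) = (\<integral>x. ln (1 + s) + ln (1 + 1 / (1 + s) * g x) \<partial>\<nu>)"
    proof (rule Bochner_Integration.integral_cong)
      fix x
      have "0 < 1 + 1 / (1 + s) * g x" using s g0[of x] by (intro add_pos_nonneg) simp_all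
      then have "ln (1 + s) + ln (1 + 1 / (1 + s) * g x) = ln ((1 + s) * (1 + 1 / (1 + s) * g x))"
        using s by (intro ln_mult_pos[symmetric]) simp_all
      also have "(1 + s) * (1 + 1 / (1 + s) * g x) = 1 + (g x + s)"
        using s by (simp add: field_simps)
      finally show "ln (1 + (g x + s)) = ln (1 + s) + ln (1 + 1 / (1 + s) * g x)" ..
    qed simp
    also have "\<dots> = ln (1 + s) * (q + m) + (\<integral>x. ln (1 + 1 / (1 + s) * g x) \<partial>\<nu>)"
    proof -
      have "measure \<nu> (space \<nu>) = q + m"
        using a sets_eq_imp_space_eq[OF \<nu>(2)] by simp
      then show ?thesis using int_u by simp
    qed
    also have "exp (- \<dots>) = (1 + s) powr (- (q + m)) * \<Psi> (1 / (1 + s))"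
      using s by (simp add: powr_def \<Psi>_def exp_add[symmetric] exp_minus[symmetric] algebra_simps)
    finally have "(\<integral>\<mu>. e s \<mu> \<partial>G) = (1 + s) powr (- (q + m)) * \<Psi> (1 / (1 + s))"
      using s by (simp add: e_eq cong: Bochner_Integration.integral_cong)
    moreover have "(\<integral>\<^sup>+\<mu>. ennreal (e s \<mu>) \<partial>G) = ennreal (\<integral>\<mu>. e s \<mu> \<partial>G)"
      by (rule nn_integral_eq_integral[OF G.integrable_const_bound[of _ 1]]) (simp_all add: e_def)
    ultimately show ?thesis by simp
  qed
  have T_powr: "ennreal (t powr (- m)) = ennreal (1 / Gamma m)
      * (\<integral>\<^sup>+s. ennreal (indicator {0<..} s * s powr (m - 1) * exp (- s * t)) \<partial>lborel)" if t: "0 < t" for t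
  proof -
    let ?J = "\<integral>\<^sup>+s. ennreal (indicator {0<..} s * s powr (m - 1) * exp (- s * t)) \<partial>lborel"
    have "(\<integral>\<^sup>+s. ennreal (indicator {0..} s * s powr (m - 1) / exp s) \<partial>lborel)
        = ennreal t * (\<integral>\<^sup>+s. ennreal (indicator {0..} (0 + t * s) * (0 + t * s) powr (m - 1) / exp (0 + t * s)) \<partial>lborel)"
      using t by (subst nn_integral_real_affine[of _ t 0]) simp_all
    also have "\<dots> = ennreal t * (\<integral>\<^sup>+s. ennreal (t powr (m - 1))
        * ennreal (indicator {0<..} s * s powr (m - 1) * exp (- s * t)) \<partial>lborel)"
      using t by (intro arg_cong2[where f = "(*)"] refl nn_integral_lborel_cong_except[of 0 0])
        (auto simp: ennreal_mult[symmetric] powr_mult exp_minus field_simps zero_le_mult_iff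
          split: split_indicator)
    also have "\<dots> = ennreal (t powr m)
        * ?J"
      using t powr_add[of t 1 "m - 1"]
      by (subst nn_integral_cmult, simp, subst mult.assoc[symmetric], subst ennreal_mult[symmetric]) simp_all
    finally have e: "ennreal (Gamma m) = ennreal (t powr m)
        * ?J"
      using Gamma_conv_nn_integral_real[OF m] by simp
    have "ennreal (t powr (- m)) = ennreal (t powr (- m) / Gamma m) * ennreal (Gamma m)"
      using pos by (subst ennreal_mult[symmetric]) simp_all
    also have "\<dots> = ennreal (t powr (- m) / Gamma m * t powr m)
        * ?J"
      unfolding e using pos by (subst ennreal_mult) (simp_all add: mult.assoc)
    also have "t powr (- m) / Gamma m * t powr m = 1 / Gamma m"
      using t by (simp add: powr_minus field_simps)
    finally show ?thesis .
  qed
  define c where "c = Gamma (q + m) / (Gamma q * Gamma m)"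
  have c: "0 < c" using pos by (simp add: c_def)
  have "(\<integral>\<^sup>+\<mu>. ennreal (Gamma (q + m) / Gamma q * measure \<mu> UNIV powr (- m)) * ennreal (\<phi> \<mu>) \<partial>G)
      = (\<integral>\<^sup>+\<mu>. ennreal c * (\<integral>\<^sup>+s. ennreal (indicator {0<..} s * s powr (m - 1))
          * ennreal (e s \<mu>) \<partial>lborel) \<partial>G)"
  proof (rule nn_integral_cong_AE)
    have "AE \<mu> in G. 0 < measure \<mu> UNIV" using gamma_process_AE_pos[OF G] a m q by simp
    then show "AE \<mu> in G. ennreal (Gamma (q + m) / Gamma q * measure \<mu> UNIV powr (- m)) * ennreal (\<phi> \<mu>)
        = ennreal c * (\<integral>\<^sup>+s. ennreal (indicator {0<..} s * s powr (m - 1))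
          * ennreal (e s \<mu>) \<partial>lborel)"
      using gamma_process_AE_finite_measure[OF G] AE_space
    proof eventually_elim
      case (elim \<mu>)
      then interpret mu: finite_measure \<mu> by simp
      have s\<mu> [measurable_cong]: "sets \<mu> = sets borel"
        using elim by (simp add: gamma_process_lawD[OF G] sets_of_boundedly_finite)
      let ?T = "measure \<mu> UNIV"
      have shift: "e s \<mu> = \<phi> \<mu> * exp (- s * ?T)" if "0 < s" for s
        using that by (simp add: e_def \<phi>_def exp_neg_add mu.emeasure_eq_measure
            ennreal_mult[symmetric] exp_neg_ennreal)
      have "ennreal (Gamma (q + m) / Gamma q * ?T powr (- m)) * ennreal (\<phi> \<mu>)
          = ennreal (Gamma (q + m) / Gamma q) * ennreal (?T powr (- m)) * ennreal (\<phi> \<mu>)"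
        using pos by (subst ennreal_mult) simp_all
      also have "\<dots> = ennreal (Gamma (q + m) / Gamma q) * ennreal (1 / Gamma m)
          * ((\<integral>\<^sup>+s. ennreal (indicator {0<..} s * s powr (m - 1) * exp (- s * ?T)) \<partial>lborel) * ennreal (\<phi> \<mu>))"
        using elim by (subst T_powr) (simp_all add: mult.assoc)
      also have "ennreal (Gamma (q + m) / Gamma q) * ennreal (1 / Gamma m) = ennreal c"
        using pos by (simp add: ennreal_mult[symmetric] c_def)
      also have "(\<integral>\<^sup>+s. ennreal (indicator {0<..} s * s powr (m - 1) * exp (- s * ?T)) \<partial>lborel) * ennreal (\<phi> \<mu>)
          = (\<integral>\<^sup>+s. ennreal (indicator {0<..} s * s powr (m - 1)) * ennreal (e s \<mu>) \<partial>lborel)"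
        by (subst nn_integral_multc[symmetric], simp, intro nn_integral_cong)
          (auto simp: ennreal_mult[symmetric] shift \<phi>0 mult_ac split: split_indicator)
      finally show ?case .
    qed
  qed
  also have "\<dots> = ennreal c * (\<integral>\<^sup>+\<mu>. \<integral>\<^sup>+s. ennreal (indicator {0<..} s * s powr (m - 1))
          * ennreal (e s \<mu>) \<partial>lborel \<partial>G)"
    by (rule nn_integral_cmult) measurable
  also have "\<dots> = ennreal c * (\<integral>\<^sup>+s. \<integral>\<^sup>+\<mu>. ennreal (indicator {0<..} s * s powr (m - 1))
          * ennreal (e s \<mu>) \<partial>G \<partial>lborel)"
    by (subst GL.Fubini') (simp_all add: split_beta')
  also have "\<dots> = ennreal c * (\<integral>\<^sup>+s. ennreal (indicator {0<..} s * (s powr (m - 1) * (1 + s) powr (- (q + m))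
      * \<Psi> (1 / (1 + s)))) \<partial>lborel)"
  proof (intro arg_cong2[where f = "(*)"] refl nn_integral_cong)
    fix s :: real
    show "(\<integral>\<^sup>+\<mu>. ennreal (indicator {0<..} s * s powr (m - 1)) * ennreal (e s \<mu>) \<partial>G)
        = ennreal (indicator {0<..} s * (s powr (m - 1) * (1 + s) powr (- (q + m)) * \<Psi> (1 / (1 + s))))"
      using laplace_shift[of s] \<Psi>
      by (cases "0 < s") (simp_all add: nn_integral_cmult ennreal_mult[symmetric] mult.assoc)
  qed
  also have "\<dots> = ennreal c * ennreal ?I"
    by (subst nn_integral_beta_substitution[OF _ \<Psi> m q]) simp_all
  finally have lhs: "(\<integral>\<^sup>+\<mu>. ennreal (Gamma (q + m) / Gamma q * measure \<mu> UNIV powr (- m)) * ennreal (\<phi> \<mu>) \<partial>G)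
      = ennreal (c * ?I)"
    using c \<Psi> by (subst ennreal_mult) (auto intro!: integral_nonneg_AE)
  have "laplace_functional (density G (\<lambda>\<mu>. ennreal (Gamma (q + m) / Gamma q * measure \<mu> UNIV powr (- m)))) g
      = (\<integral>\<mu>. \<phi> \<mu> \<partial>density G (\<lambda>\<mu>. ennreal (Gamma (q + m) / Gamma q * measure \<mu> UNIV powr (- m))))"
    by (simp add: laplace_functional_def \<phi>_def)
  also have "\<dots> = enn2real (\<integral>\<^sup>+\<mu>. ennreal (Gamma (q + m) / Gamma q * measure \<mu> UNIV powr (- m)) * ennreal (\<phi> \<mu>) \<partial>G)"
    by (subst integral_eq_nn_integral) (simp_all add: \<phi>0 nn_integral_density)
  also have "\<dots> = c * ?I"
    unfolding lhs using c \<Psi> by (subst enn2real_ennreal) (auto intro!: mult_nonneg_nonneg integral_nonneg_AE)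
  also have "\<dots> = (\<integral>u. (indicator {0<..<1} u * (Gamma (q + m) / (Gamma q * Gamma m) * u powr (q - 1) * (1 - u) powr (m - 1)))
      * \<Psi> u \<partial>lborel)"
    by (subst integral_mult_right_zero[symmetric]) (simp add: c_def mult_ac)
  also have "\<dots> = (\<integral>u. \<Psi> u \<partial>beta_distr q m)"
    unfolding beta_distr_def using pos by (subst integral_real_density) (auto split: split_indicator)
  also have "\<dots> = (\<integral>u. exp (- (\<integral>x. ln (1 + u * g x) \<partial>\<nu>)) \<partial>beta_distr q m)"
  proof (rule integral_cong_AE)
    show "AE u in beta_distr q m. \<Psi> u = exp (- (\<integral>x. ln (1 + u * g x) \<partial>\<nu>))"
      unfolding beta_distr_def
      by (subst AE_density, simp) (auto simp: \<Psi>_def intro!: AE_I2 split: split_indicator)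
  qed (simp_all add: beta_distr_def)
  finally show ?thesis .
qed

section \<open>Adding the atoms of a sample\<close>

lemma updated_shape_0: "sets \<nu> = sets borel \<Longrightarrow> updated_shape \<nu> 0 y = \<nu>"
  by (rule measure_eqI) (simp_all add: sets_updated_shape emeasure_updated_shape)

lemma updated_shape_Suc:
  assumes "sets \<nu> = sets borel"
  shows "updated_shape \<nu> (Suc n) y = add_atom (updated_shape \<nu> n y) 1 (y (Suc n))"
  using assms
  by (intro measure_eqI)
    (simp_all add: sets_updated_shape emeasure_updated_shape emeasure_add_atom add.assoc)

lemma nn_integral_updated_shape:
  assumes "sets \<nu> = sets borel" "h \<in> borel_measurable borel"
  shows "(\<integral>\<^sup>+x. h x \<partial>updated_shape \<nu> n y) = (\<integral>\<^sup>+x. h x \<partial>\<nu>) + (\<Sum>i=1..n. h (y i))"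
  using assms
  by (induction n)
    (simp_all add: updated_shape_0 updated_shape_Suc nn_integral_add_atom sets_updated_shape add.assoc)

lemma finite_measure_updated_shape:
  "finite_measure \<nu> \<Longrightarrow> sets \<nu> = sets borel \<Longrightarrow> finite_measure (updated_shape \<nu> n y)"
  by (induction n)
    (simp_all add: updated_shape_0 updated_shape_Suc finite_measure_add_atom sets_updated_shape)

lemma measure_updated_shape_UNIV:
  "finite_measure \<nu> \<Longrightarrow> sets \<nu> = sets borel \<Longrightarrow>
     measure (updated_shape \<nu> n y) UNIV = measure \<nu> UNIV + real n"
  by (induction n)
    (simp_all add: updated_shape_0 updated_shape_Suc measure_add_atom finite_measure_updated_shape
      sets_updated_shape)

lemma integral_updated_shape:
  fixes h :: "'y::polish_space \<Rightarrow> real"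
  assumes \<nu>: "sets \<nu> = sets borel" and h [measurable]: "h \<in> borel_measurable borel" "\<And>x. 0 \<le> h x"
    and int: "integrable \<nu> h"
  shows "integrable (updated_shape \<nu> n y) h"
    and "(\<integral>x. h x \<partial>updated_shape \<nu> n y) = (\<integral>x. h x \<partial>\<nu>) + (\<Sum>i=1..n. h (y i))"
proof -
  note [measurable_cong] = \<nu> sets_updated_shape
  have "(\<integral>\<^sup>+x. ennreal (h x) \<partial>updated_shape \<nu> n y) = (\<integral>\<^sup>+x. ennreal (h x) \<partial>\<nu>) + (\<Sum>i=1..n. ennreal (h (y i)))"
    using \<nu> by (rule nn_integral_updated_shape) simp
  also have "\<dots> = ennreal ((\<integral>x. h x \<partial>\<nu>) + (\<Sum>i=1..n. h (y i)))"
    using int h by (simp add: nn_integral_eq_integral sum_nonneg)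
  finally have e: "(\<integral>\<^sup>+x. ennreal (h x) \<partial>updated_shape \<nu> n y) = ennreal ((\<integral>x. h x \<partial>\<nu>) + (\<Sum>i=1..n. h (y i)))" .
  show "integrable (updated_shape \<nu> n y) h"
    using e h by (intro integrableI_nonneg) auto
  show "(\<integral>x. h x \<partial>updated_shape \<nu> n y) = (\<integral>x. h x \<partial>\<nu>) + (\<Sum>i=1..n. h (y i))"
    using h by (subst integral_eq_nn_integral) (simp_all add: e sum_nonneg del: ennreal_plus sum_ennreal)
qed

primrec attach_atoms ::
    "'y::polish_space measure measure \<Rightarrow> nat \<Rightarrow> (nat \<Rightarrow> 'y) \<Rightarrow> 'y measure measure" where
  "attach_atoms G 0 y = G"
| "attach_atoms G (Suc n) y = attach_atom (attach_atoms G n y) (y (Suc n))"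

lemma attach_atoms_cong:
  "(\<And>i. i \<in> {1..n} \<Longrightarrow> y i = y' i) \<Longrightarrow> attach_atoms G n y = attach_atoms G n y'"
  by (induction n) simp_all

lemma gamma_process_attach_atoms:
  assumes "finite_measure \<nu>" "sets \<nu> = sets borel" "gamma_process_law \<nu> G"
  shows "gamma_process_law (updated_shape \<nu> n y) (attach_atoms G n y)"
  using assms
  by (induction n)
    (simp_all add: updated_shape_0 updated_shape_Suc gamma_process_attach_atom
      finite_measure_updated_shape sets_updated_shape)

lemma measurable_attach_atom [measurable (raw)]:
  assumes [measurable]: "g \<in> measurable S (prob_algebra bfm_algebra)" "z \<in> measurable S borel"
  shows "(\<lambda>x. attach_atom (g x) (z x)) \<in> measurable S (prob_algebra bfm_algebra)"
proof -
  have "gamma_distr 1 \<in> space (prob_algebra borel)"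
    by (simp add: space_prob_algebra prob_space_gamma_distr)
  then have [measurable]: "(\<lambda>x. gamma_distr 1) \<in> measurable S (prob_algebra borel)" by simp
  show ?thesis
    unfolding attach_atom_def
  proof (rule measurable_distr_prob_space2[where M = "bfm_algebra \<Otimes>\<^sub>M borel"])
    show "(\<lambda>x. g x \<Otimes>\<^sub>M gamma_distr 1) \<in> measurable S (prob_algebra (bfm_algebra \<Otimes>\<^sub>M borel))"
      by measurable
    show "(\<lambda>(x, p). case p of (m, t) \<Rightarrow> add_atom m (ennreal t) (z x))
        \<in> measurable (S \<Otimes>\<^sub>M (bfm_algebra \<Otimes>\<^sub>M borel)) bfm_algebra"
      by (simp add: split_beta')
  qed
qed

lemma measurable_attach_atoms:
  assumes G: "gamma_process_law \<nu> G" and "\<And>i. i \<in> {1..n} \<Longrightarrow> (\<lambda>x. Y x i) \<in> measurable S borel"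
  shows "(\<lambda>x. attach_atoms G n (Y x)) \<in> measurable S (prob_algebra bfm_algebra)"
  using assms(2)
proof (induction n)
  case 0
  have "G \<in> space (prob_algebra bfm_algebra)"
    using gamma_process_lawD[OF G] by (simp add: space_prob_algebra)
  then show ?case by simp
next
  case (Suc n)
  then have [measurable]: "(\<lambda>x. attach_atoms G n (Y x)) \<in> measurable S (prob_algebra bfm_algebra)"
    "(\<lambda>x. Y x (Suc n)) \<in> measurable S borel" by auto
  show ?case by simp
qed

lemma measurable_nn_integral_attach_atoms:
  assumes "gamma_process_law \<nu> G" "F \<in> borel_measurable bfm_algebra"
    and "\<And>i. i \<in> {1..n} \<Longrightarrow> (\<lambda>x. Y x i) \<in> measurable S borel"
  shows "(\<lambda>x. \<integral>\<^sup>+m. F m \<partial>attach_atoms G n (Y x)) \<in> borel_measurable S"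
  using measurable_compose[OF measurable_prob_algebraD[OF measurable_attach_atoms[OF assms(1,3)]]
      nn_integral_measurable_subprob_algebra[OF assms(2)]] by simp

section \<open>The Blackwell-MacQueen urn\<close>

definition predictive :: "'y::polish_space measure \<Rightarrow> nat \<Rightarrow> (nat \<Rightarrow> 'y) \<Rightarrow> 'y measure" where
  "predictive \<nu> n y = scale_measure (ennreal (1 / (measure \<nu> UNIV + real n))) (updated_shape \<nu> n y)"

text \<open>
  The law of the first \<open>n\<close> points of the urn scheme in which the next point is drawn from the
  normalized updated shape.  It is the marginal law of a sample from the Dirichlet process.
\<close>

primrec urn :: "'y::polish_space measure \<Rightarrow> nat \<Rightarrow> (nat \<Rightarrow> 'y) measure" where
  "urn \<nu> 0 = Pi\<^sub>M {1..0} (\<lambda>_. borel)"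
| "urn \<nu> (Suc n) = urn \<nu> n \<bind>
     (\<lambda>y. distr (predictive \<nu> n y) (Pi\<^sub>M {1..Suc n} (\<lambda>_. borel)) (\<lambda>z. y(Suc n := z)))"

lemma measurable_predictive:
  fixes \<nu> :: "'y::polish_space measure"
  assumes \<nu>: "finite_measure \<nu>" "sets \<nu> = sets borel" "0 < measure \<nu> UNIV"
  shows "predictive \<nu> n \<in> measurable (Pi\<^sub>M {1..n} (\<lambda>_. borel)) (prob_algebra borel)"
proof (intro measurable_prob_algebraI measurable_subprob_algebra)
  interpret finite_measure \<nu> by fact
  show "sets (predictive \<nu> n y) = sets borel" for y
    by (simp add: predictive_def sets_updated_shape)
  show prob: "prob_space (predictive \<nu> n y)" for y
  proof (rule prob_spaceI)
    interpret up: finite_measure "updated_shape \<nu> n y"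
      by (rule finite_measure_updated_shape[OF \<nu>(1,2)])
    have "space (updated_shape \<nu> n y) = UNIV"
      using sets_eq_imp_space_eq[OF sets_updated_shape[of \<nu> n y]] by simp
    then show "emeasure (predictive \<nu> n y) (space (predictive \<nu> n y)) = 1"
      using \<nu> by (simp add: predictive_def space_scale_measure up.emeasure_eq_measure
          measure_updated_shape_UNIV ennreal_mult[symmetric] del: ennreal_plus)
  qed
  then show "subprob_space (predictive \<nu> n y)" for y by (rule prob_space_imp_subprob_space)
  fix A :: "'y set" assume A [measurable]: "A \<in> sets borel"
  show "(\<lambda>y. emeasure (predictive \<nu> n y) A) \<in> borel_measurable (Pi\<^sub>M {1..n} (\<lambda>_. borel))"
    unfolding predictive_def using A \<nu>(2) by (simp add: emeasure_updated_shape)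
qed

lemma measurable_urn_step:
  assumes \<nu>: "finite_measure \<nu>" "sets \<nu> = sets borel" "0 < measure \<nu> UNIV"
  shows "(\<lambda>y. distr (predictive \<nu> n y) (Pi\<^sub>M {1..Suc n} (\<lambda>_. borel)) (\<lambda>z. y(Suc n := z)))
    \<in> measurable (Pi\<^sub>M {1..n} (\<lambda>_. borel)) (prob_algebra (Pi\<^sub>M {1..Suc n} (\<lambda>_. borel)))"
proof (rule measurable_distr_prob_space2[where M = borel, OF measurable_predictive[OF \<nu>]])
  show "(\<lambda>(y, z). y(Suc n := z)) \<in> measurable (Pi\<^sub>M {1..n} (\<lambda>_. borel) \<Otimes>\<^sub>M borel) (Pi\<^sub>M {1..Suc n} (\<lambda>_. borel))"
    using measurable_add_dim[of "Suc n" "{1..n}" "\<lambda>_. borel"]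
    by (simp add: atLeastAtMostSuc_conv)
qed

lemma urn_in_prob_algebra:
  assumes \<nu>: "finite_measure \<nu>" "sets \<nu> = sets borel" "0 < measure \<nu> UNIV"
  shows "urn \<nu> n \<in> space (prob_algebra (Pi\<^sub>M {1..n} (\<lambda>_. borel)))"
proof (induction n)
  case 0
  have "prob_space (Pi\<^sub>M {1..0::nat} (\<lambda>_. borel :: 'a measure))"
    by (rule prob_spaceI) (simp add: emeasure_PiM_empty space_PiM_empty)
  then show ?case by (simp add: space_prob_algebra)
next
  case (Suc n)
  then have "(\<lambda>_. urn \<nu> n) \<in> measurable (count_space UNIV) (prob_algebra (Pi\<^sub>M {1..n} (\<lambda>_. borel)))"
    by simp
  from measurable_space[OF measurable_bind_prob_space[OF this measurable_urn_step[OF \<nu>]], of undefined]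
  show ?case by simp
qed

text \<open>
  Multiplying by the total mass \<open>\<nu>(\<Y>) + n\<close> of the updated shape undoes the normalization of the
  predictive law; these factors accumulate to the Pochhammer symbol of the Palm formula.
\<close>

lemma nn_integral_urn_Suc:
  assumes \<nu>: "finite_measure \<nu>" "sets \<nu> = sets borel" "0 < measure \<nu> UNIV"
    and h [measurable]: "h \<in> borel_measurable (Pi\<^sub>M {1..Suc n} (\<lambda>_. borel))"
  shows "ennreal (measure \<nu> UNIV + real n) * (\<integral>\<^sup>+y. h y \<partial>urn \<nu> (Suc n))
    = (\<integral>\<^sup>+y. \<integral>\<^sup>+z. h (y(Suc n := z)) \<partial>updated_shape \<nu> n y \<partial>urn \<nu> n)"
proof -
  have su: "sets (urn \<nu> n) = sets (Pi\<^sub>M {1..n} (\<lambda>_. borel))"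
    using urn_in_prob_algebra[OF \<nu>, of n] by (simp add: space_prob_algebra)
  note [measurable_cong] = su sets_updated_shape
  have upd: "(\<lambda>z. y(Suc n := z)) \<in> measurable borel (Pi\<^sub>M {1..Suc n} (\<lambda>_. borel))"
    if "y \<in> space (urn \<nu> n)" for y
  proof -
    have "y \<in> space (Pi\<^sub>M {1..n} (\<lambda>_. borel))" using that sets_eq_imp_space_eq[OF su] by simp
    then have "(\<lambda>z. (y, z)) \<in> measurable borel (Pi\<^sub>M {1..n} (\<lambda>_. borel) \<Otimes>\<^sub>M borel)" by simp
    from measurable_compose[OF this measurable_add_dim[of "Suc n" "{1..n}" "\<lambda>_. borel"]]
    show ?thesis by (simp add: atLeastAtMostSuc_conv)
  qed
  have k: "(\<lambda>y. distr (predictive \<nu> n y) (Pi\<^sub>M {1..Suc n} (\<lambda>_. borel)) (\<lambda>z. y(Suc n := z)))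
    \<in> measurable (urn \<nu> n) (subprob_algebra (Pi\<^sub>M {1..Suc n} (\<lambda>_. borel)))"
    using measurable_prob_algebraD[OF measurable_urn_step[OF \<nu>]] su by (simp cong: measurable_cong_sets)
  let ?c = "measure \<nu> UNIV + real n"
  have c: "0 < ?c" using \<nu>(3) by simp
  have step: "(\<integral>\<^sup>+z. h z \<partial>distr (predictive \<nu> n y) (Pi\<^sub>M {1..Suc n} (\<lambda>_. borel)) (\<lambda>z. y(Suc n := z)))
      = ennreal (1 / ?c) * (\<integral>\<^sup>+z. h (y(Suc n := z)) \<partial>updated_shape \<nu> n y)"
    if y: "y \<in> space (urn \<nu> n)" for y
  proof -
    have [measurable_cong]: "sets (predictive \<nu> n y) = sets borel"
      by (simp add: predictive_def sets_updated_shape)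
    note upd[OF y, measurable]
    have "(\<integral>\<^sup>+z. h z \<partial>distr (predictive \<nu> n y) (Pi\<^sub>M {1..Suc n} (\<lambda>_. borel)) (\<lambda>z. y(Suc n := z)))
        = (\<integral>\<^sup>+z. h (y(Suc n := z)) \<partial>predictive \<nu> n y)"
      by (rule nn_integral_distr) measurable
    also have "\<dots> = ennreal (1 / ?c) * (\<integral>\<^sup>+z. h (y(Suc n := z)) \<partial>updated_shape \<nu> n y)"
      unfolding predictive_def by (rule nn_integral_scale_measure) measurable
    finally show ?thesis .
  qed
  have "(\<integral>\<^sup>+y. h y \<partial>urn \<nu> (Suc n)) = (\<integral>\<^sup>+y. \<integral>\<^sup>+z. h z
      \<partial>distr (predictive \<nu> n y) (Pi\<^sub>M {1..Suc n} (\<lambda>_. borel)) (\<lambda>z. y(Suc n := z)) \<partial>urn \<nu> n)"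
    unfolding urn.simps by (rule nn_integral_bind[OF h k])
  also have "\<dots> = (\<integral>\<^sup>+y. ennreal (1 / ?c) * (\<integral>\<^sup>+z. h (y(Suc n := z)) \<partial>updated_shape \<nu> n y) \<partial>urn \<nu> n)"
    by (rule nn_integral_cong) (rule step)
  also have "ennreal ?c * \<dots> = (\<integral>\<^sup>+y. ennreal ?c * (ennreal (1 / ?c) *
      (\<integral>\<^sup>+z. h (y(Suc n := z)) \<partial>updated_shape \<nu> n y)) \<partial>urn \<nu> n)"
  proof (rule nn_integral_cmult[symmetric])
    have "(\<lambda>y. \<integral>\<^sup>+z. h z \<partial>distr (predictive \<nu> n y) (Pi\<^sub>M {1..Suc n} (\<lambda>_. borel)) (\<lambda>z. y(Suc n := z)))
        \<in> borel_measurable (urn \<nu> n)"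
      by (rule measurable_compose[OF k nn_integral_measurable_subprob_algebra[OF h]])
    then show "(\<lambda>y. ennreal (1 / ?c) * (\<integral>\<^sup>+z. h (y(Suc n := z)) \<partial>updated_shape \<nu> n y))
        \<in> borel_measurable (urn \<nu> n)"
      by (rule measurable_cong[THEN iffD1, rotated]) (rule step)
  qed
  also have "\<dots> = (\<integral>\<^sup>+y. \<integral>\<^sup>+z. h (y(Suc n := z)) \<partial>updated_shape \<nu> n y \<partial>urn \<nu> n)"
    using c by (simp add: mult.assoc[symmetric] ennreal_mult[symmetric] del: ennreal_plus)
  finally show ?thesis .
qed

text \<open>
  The \<open>n\<close>-fold Palm formula, by iterating the Mecke formula: the \<open>n\<close>th moment measure of the gamma
  process is a multiple of the urn law, since the Mecke formula at the shape updated by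
  \<open>y\<^sub>1, \<dots>, y\<^sub>n\<close> draws the next point from that shape.
\<close>

theorem gamma_process_palm:
  fixes \<nu> :: "'y::polish_space measure"
  assumes \<nu>: "finite_measure \<nu>" "sets \<nu> = sets borel" "0 < measure \<nu> UNIV"
    and G: "gamma_process_law \<nu> G"
    and A: "\<And>i. i \<in> {1..n} \<Longrightarrow> A i \<in> sets borel" and F: "F \<in> borel_measurable bfm_algebra"
  shows "(\<integral>\<^sup>+m. (\<Prod>i=1..n. emeasure m (A i)) * F m \<partial>G)
    = ennreal (pochhammer (measure \<nu> UNIV) n)
      * (\<integral>\<^sup>+y. (\<Prod>i=1..n. indicator (A i) (y i)) * (\<integral>\<^sup>+m. F m \<partial>attach_atoms G n y) \<partial>urn \<nu> n)"
  using A F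
proof (induction n arbitrary: F)
  case 0
  interpret prob_space "urn \<nu> 0"
    using urn_in_prob_algebra[OF \<nu>, of 0] by (simp add: space_prob_algebra del: urn.simps)
  show ?case using emeasure_space_1 by (simp del: urn.simps)
next
  case (Suc n)
  note [measurable_cong] = gamma_process_lawD(1)[OF G] \<nu>(2) sets_updated_shape
  note [measurable] = Suc.prems(2)
  have A: "\<And>i. i \<in> {1..n} \<Longrightarrow> A i \<in> sets borel" and [measurable]: "A (Suc n) \<in> sets borel"
    using Suc.prems(1) by auto
  have su: "sets (urn \<nu> n) = sets (Pi\<^sub>M {1..n} (\<lambda>_. borel))"
    using urn_in_prob_algebra[OF \<nu>, of n] by (simp add: space_prob_algebra)
  let ?h = "\<lambda>y. (\<Prod>i=1..Suc n. indicator (A i) (y i)) * (\<integral>\<^sup>+m. F m \<partial>attach_atoms G (Suc n) y)"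
  have h: "?h \<in> borel_measurable (Pi\<^sub>M {1..Suc n} (\<lambda>_. borel))"
  proof (intro borel_measurable_times_ennreal borel_measurable_prod_ennreal measurable_nn_integral_attach_atoms[OF G])
    show "F \<in> borel_measurable bfm_algebra" by fact
    fix i assume i: "i \<in> {1..Suc n}"
    show c: "(\<lambda>y. y i) \<in> borel_measurable (Pi\<^sub>M {1..Suc n} (\<lambda>_. borel))"
      using i by (rule measurable_component_singleton)
    show "(\<lambda>y. indicator (A i) (y i)) \<in> borel_measurable (Pi\<^sub>M {1..Suc n} (\<lambda>_. borel))"
      using Suc.prems(1)[OF i] c by measurable
  qed
  \<comment> \<open>The last factor joins \<open>F\<close>, and is removed by the Mecke formula at the updated shape.\<close>
  have "(\<integral>\<^sup>+m. (\<Prod>i=1..Suc n. emeasure m (A i)) * F m \<partial>G)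
      = (\<integral>\<^sup>+m. (\<Prod>i=1..n. emeasure m (A i)) * (emeasure m (A (Suc n)) * F m) \<partial>G)"
    by (simp add: mult_ac)
  also have "\<dots> = ennreal (pochhammer (measure \<nu> UNIV) n)
      * (\<integral>\<^sup>+y. (\<Prod>i=1..n. indicator (A i) (y i))
          * (\<integral>\<^sup>+m. emeasure m (A (Suc n)) * F m \<partial>attach_atoms G n y) \<partial>urn \<nu> n)"
    using A by (intro Suc.IH) auto
  also have "(\<integral>\<^sup>+y. (\<Prod>i=1..n. indicator (A i) (y i))
          * (\<integral>\<^sup>+m. emeasure m (A (Suc n)) * F m \<partial>attach_atoms G n y) \<partial>urn \<nu> n)
      = (\<integral>\<^sup>+y. \<integral>\<^sup>+z. ?h (y(Suc n := z)) \<partial>updated_shape \<nu> n y \<partial>urn \<nu> n)"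
  proof (rule nn_integral_cong)
    fix y assume "y \<in> space (urn \<nu> n)"
    have fu: "finite_measure (updated_shape \<nu> n y)"
      by (rule finite_measure_updated_shape[OF \<nu>(1,2)])
    have aa: "attach_atoms G n (y(Suc n := z)) = attach_atoms G n y" for z
      by (rule attach_atoms_cong) auto
    have pr: "(\<Prod>i=1..n. indicator (A i) ((y(Suc n := z)) i)) = (\<Prod>i=1..n. indicator (A i) (y i) :: ennreal)" for z
      by (rule prod.cong) auto
    have m: "(\<lambda>z. \<integral>\<^sup>+m. F m \<partial>attach_atom (attach_atoms G n y) z) \<in> borel_measurable borel"
    proof -
      have "attach_atoms G n y \<in> space (prob_algebra bfm_algebra)"
        using gamma_process_lawD[OF gamma_process_attach_atoms[OF \<nu>(1,2) G]]
        by (simp add: space_prob_algebra)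
      then have "(\<lambda>z. attach_atom (attach_atoms G n y) z) \<in> measurable borel (prob_algebra bfm_algebra)"
        by (intro measurable_attach_atom measurable_const measurable_ident) auto
      from measurable_compose[OF measurable_prob_algebraD[OF this] nn_integral_measurable_subprob_algebra]
      show ?thesis by simp
    qed
    have mecke: "(\<integral>\<^sup>+m. emeasure m (A (Suc n)) * F m \<partial>attach_atoms G n y)
        = (\<integral>\<^sup>+z. indicator (A (Suc n)) z * (\<integral>\<^sup>+m. F m \<partial>attach_atom (attach_atoms G n y) z)
            \<partial>updated_shape \<nu> n y)"
      by (rule gamma_process_mecke[OF fu sets_updated_shape gamma_process_attach_atoms[OF \<nu>(1,2) G]])
        measurable
    show "(\<Prod>i=1..n. indicator (A i) (y i)) * (\<integral>\<^sup>+m. emeasure m (A (Suc n)) * F m \<partial>attach_atoms G n y)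
        = (\<integral>\<^sup>+z. ?h (y(Suc n := z)) \<partial>updated_shape \<nu> n y)"
    proof -
      have "?h (y(Suc n := z)) = (\<Prod>i=1..n. indicator (A i) (y i))
          * (indicator (A (Suc n)) z * (\<integral>\<^sup>+m. F m \<partial>attach_atom (attach_atoms G n y) z))" for z
        unfolding attach_atoms.simps aa prod.cl_ivl_Suc pr by (simp add: mult_ac)
      moreover have "(\<integral>\<^sup>+z. (\<Prod>i=1..n. indicator (A i) (y i))
          * (indicator (A (Suc n)) z * (\<integral>\<^sup>+m. F m \<partial>attach_atom (attach_atoms G n y) z))
            \<partial>updated_shape \<nu> n y)
        = (\<Prod>i=1..n. indicator (A i) (y i)) * (\<integral>\<^sup>+z. indicator (A (Suc n)) z
            * (\<integral>\<^sup>+m. F m \<partial>attach_atom (attach_atoms G n y) z) \<partial>updated_shape \<nu> n y)"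
        using m by (intro nn_integral_cmult) simp
      ultimately show ?thesis by (simp only: mecke)
    qed
  qed
  also have "\<dots> = ennreal (measure \<nu> UNIV + real n) * (\<integral>\<^sup>+y. ?h y \<partial>urn \<nu> (Suc n))"
    by (rule nn_integral_urn_Suc[OF \<nu> h, symmetric])
  also have "ennreal (pochhammer (measure \<nu> UNIV) n) * \<dots>
      = ennreal (pochhammer (measure \<nu> UNIV) (Suc n)) * (\<integral>\<^sup>+y. ?h y \<partial>urn \<nu> (Suc n))"
    using \<nu>(3) by (simp add: pochhammer_Suc ennreal_mult pochhammer_nonneg mult.assoc
        del: urn.simps ennreal_plus attach_atoms.simps prod.cl_ivl_Suc)
  finally show ?case .
qed

section \<open>The posterior\<close>

definition beta_gamma_kernel ::
    "'y::polish_space measure measure \<Rightarrow> real \<Rightarrow> real \<Rightarrow> nat \<Rightarrow> (nat \<Rightarrow> 'y) \<Rightarrow> 'y measure measure" where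
  "beta_gamma_kernel G \<theta> q n y = density (attach_atoms G n y)
     (\<lambda>m. ennreal (Gamma (\<theta> + real n) / Gamma q * measure m UNIV powr (- (\<theta> + real n - q))))"

lemma nn_integral_beta_gamma_kernel:
  assumes \<nu>: "finite_measure \<nu>" "sets \<nu> = sets borel" and G: "gamma_process_law \<nu> G"
    and [measurable]: "F \<in> borel_measurable bfm_algebra"
  shows "(\<integral>\<^sup>+m. F m \<partial>beta_gamma_kernel G \<theta> q n y)
    = (\<integral>\<^sup>+m. ennreal (Gamma (\<theta> + real n) / Gamma q * measure m UNIV powr (- (\<theta> + real n - q))) * F m
        \<partial>attach_atoms G n y)"
proof -
  note [measurable_cong] = gamma_process_lawD(1)[OF gamma_process_attach_atoms[OF \<nu> G]]
  show ?thesis unfolding beta_gamma_kernel_def by (rule nn_integral_density) measurable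
qed

lemma measurable_beta_gamma_kernel:
  fixes \<nu> :: "'y::polish_space measure"
  assumes \<nu>: "finite_measure \<nu>" "sets \<nu> = sets borel" and G: "gamma_process_law \<nu> G"
    and \<theta>: "measure \<nu> UNIV = \<theta>" "0 < \<theta>" and q: "0 < q"
  shows "beta_gamma_kernel G \<theta> q n \<in> measurable (Pi\<^sub>M {1..n} (\<lambda>_. borel)) (prob_algebra bfm_algebra)"
proof (intro measurable_prob_algebraI measurable_subprob_algebra)
  let ?w = "\<lambda>m. ennreal (Gamma (\<theta> + real n) / Gamma q * measure m (UNIV :: 'y set) powr (- (\<theta> + real n - q)))"
  fix y :: "nat \<Rightarrow> 'y"
  note Gy = gamma_process_attach_atoms[OF \<nu> G, of n y]
  note [measurable_cong] = gamma_process_lawD(1)[OF Gy]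
  have a: "measure (updated_shape \<nu> n y) UNIV = \<theta> + real n"
    using measure_updated_shape_UNIV[OF \<nu>] \<theta>(1) by simp
  show "sets (beta_gamma_kernel G \<theta> q n y) = sets bfm_algebra"
    using gamma_process_lawD[OF Gy] by (simp add: beta_gamma_kernel_def)
  show "prob_space (beta_gamma_kernel G \<theta> q n y)"
  proof (rule prob_spaceI)
    have "emeasure (beta_gamma_kernel G \<theta> q n y) (space (beta_gamma_kernel G \<theta> q n y))
        = (\<integral>\<^sup>+m. 1 \<partial>beta_gamma_kernel G \<theta> q n y)" by simp
    also have "\<dots> = (\<integral>\<^sup>+m. ?w m
        \<partial>attach_atoms G n y)"
      by (subst nn_integral_beta_gamma_kernel[OF \<nu> G]) simp_all
    also have "\<dots> = 1"
      using gamma_process_negative_moment[OF Gy, of "\<theta> + real n - q"] \<theta>(2) q unfolding a by simp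
    finally show "emeasure (beta_gamma_kernel G \<theta> q n y) (space (beta_gamma_kernel G \<theta> q n y)) = 1" .
  qed
  then show "subprob_space (beta_gamma_kernel G \<theta> q n y)" by (rule prob_space_imp_subprob_space)
next
  let ?w = "\<lambda>m. ennreal (Gamma (\<theta> + real n) / Gamma q * measure m (UNIV :: 'y set) powr (- (\<theta> + real n - q)))"
  fix B :: "'y measure set" assume B [measurable]: "B \<in> sets bfm_algebra"
  have "(\<lambda>y. \<integral>\<^sup>+m. ?w m
      * indicator B m \<partial>attach_atoms G n y) \<in> borel_measurable (Pi\<^sub>M {1..n} (\<lambda>_. borel))"
    by (rule measurable_nn_integral_attach_atoms[OF G]) (auto intro: measurable_component_singleton)
  also have "(\<lambda>y. \<integral>\<^sup>+m. ?w m
      * indicator B m \<partial>attach_atoms G n y) = (\<lambda>y. emeasure (beta_gamma_kernel G \<theta> q n y) B)"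
  proof
    fix y
    have "sets (beta_gamma_kernel G \<theta> q n y) = sets bfm_algebra"
      using gamma_process_lawD[OF gamma_process_attach_atoms[OF \<nu> G]] by (simp add: beta_gamma_kernel_def)
    then show "(\<integral>\<^sup>+m. ?w m
      * indicator B m \<partial>attach_atoms G n y) = emeasure (beta_gamma_kernel G \<theta> q n y) B"
      using B by (subst nn_integral_beta_gamma_kernel[OF \<nu> G, symmetric]) simp_all
  qed
  finally show "(\<lambda>y. emeasure (beta_gamma_kernel G \<theta> q n y) B) \<in> borel_measurable (Pi\<^sub>M {1..n} (\<lambda>_. borel))" .
qed

lemma subalgebra_vimage_algebra:
  assumes "X \<in> measurable M N"
  shows "subalgebra M (vimage_algebra (space M) X N)"
  using assms measurable_space[OF assms]
  by (auto simp: subalgebra_def sets_vimage_algebra2 Pi_iff intro: measurable_sets)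

text \<open>
  The event \<open>X \<in> B\<close> lies in the conditioning \<open>\<sigma>\<close>-algebra, so the almost sure identity for the
  conditional probabilities may be integrated over it.
\<close>

lemma cond_iid_joint:
  assumes M: "prob_space M" and X [measurable]: "X \<in> measurable M N"
    and ci: "cond_iid M X N I Y P" and I: "finite I"
    and A: "\<And>i. i \<in> I \<Longrightarrow> A i \<in> sets borel" and B [measurable]: "B \<in> sets N"
    and P: "\<And>i. i \<in> I \<Longrightarrow> (\<lambda>\<omega>. measure (P \<omega>) (A i)) \<in> borel_measurable M"
  shows "emeasure M {\<omega>\<in>space M. (\<forall>i\<in>I. Y i \<omega> \<in> A i) \<and> X \<omega> \<in> B}
    = (\<integral>\<^sup>+\<omega>. (\<Prod>i\<in>I. ennreal (measure (P \<omega>) (A i))) * indicator B (X \<omega>) \<partial>M)"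
proof -
  interpret M: prob_space M by fact
  let ?F = "vimage_algebra (space M) X N"
  interpret F: finite_measure_subalgebra M ?F
    by unfold_locales (rule subalgebra_vimage_algebra[OF X])
  let ?D = "{\<omega>\<in>space M. \<forall>i\<in>I. Y i \<omega> \<in> A i}"
  let ?C = "{\<omega>\<in>space M. X \<omega> \<in> B}"
  have Y: "Y i \<in> borel_measurable M" if "i \<in> I" for i using ci that by (simp add: cond_iid_def)
  have D [measurable]: "?D \<in> sets M"
  proof (rule sets.sets_Collect_finite_All[OF _ I])
    fix i assume "i \<in> I"
    from measurable_sets[OF Y[OF this] A[OF this]]
    show "{\<omega> \<in> space M. Y i \<omega> \<in> A i} \<in> sets M" by (simp add: vimage_def Int_def conj_commute)
  qed
  have C [measurable]: "?C \<in> sets M" by measurable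
  have CF: "?C \<in> sets ?F"
    using B measurable_space[OF X]
    by (auto simp: sets_vimage_algebra2 Pi_iff intro!: exI[of _ B])
  have ae: "AE \<omega> in M. real_cond_exp M ?F (indicator ?D) \<omega> = (\<Prod>i\<in>I. measure (P \<omega>) (A i))"
    using ci A by (simp add: cond_iid_def)
  have le1: "AE \<omega> in M. (\<Prod>i\<in>I. measure (P \<omega>) (A i)) \<le> 1"
  proof -
    have "AE \<omega> in M. real_cond_exp M ?F (indicator ?D) \<omega> \<le> 1"
      by (rule F.real_cond_exp_le_c) (auto simp: M.emeasure_eq_measure intro!: integrable_real_indicator split: split_indicator)
    with ae show ?thesis by eventually_elim simp
  qed
  have Pm: "(\<lambda>\<omega>. \<Prod>i\<in>I. measure (P \<omega>) (A i)) \<in> borel_measurable M"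
    using P by (rule borel_measurable_prod)
  have "measure M (?C \<inter> ?D) = (\<integral>\<omega>\<in>?C. indicator ?D \<omega> \<partial>M)"
    by (simp add: set_lebesgue_integral_def indicator_inter_arith[symmetric] Int_assoc)
  also have "\<dots> = (\<integral>\<omega>\<in>?C. real_cond_exp M ?F (indicator ?D) \<omega> \<partial>M)"
    using CF by (intro F.real_cond_exp_intA integrable_real_indicator) (auto simp: M.emeasure_eq_measure)
  also have "\<dots> = (\<integral>\<omega>. (\<Prod>i\<in>I. measure (P \<omega>) (A i)) * indicator ?C \<omega> \<partial>M)"
    unfolding set_lebesgue_integral_def using ae Pm
    by (intro integral_cong_AE) (auto elim!: eventually_mono)
  finally have m: "measure M (?C \<inter> ?D) = (\<integral>\<omega>. (\<Prod>i\<in>I. measure (P \<omega>) (A i)) * indicator ?C \<omega> \<partial>M)" .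
  have int: "integrable M (\<lambda>\<omega>. (\<Prod>i\<in>I. measure (P \<omega>) (A i)) * indicator ?C \<omega>)"
    using le1 Pm by (intro M.integrable_const_bound[of _ 1])
      (auto elim!: eventually_mono simp: prod_nonneg split: split_indicator)
  have "{\<omega>\<in>space M. (\<forall>i\<in>I. Y i \<omega> \<in> A i) \<and> X \<omega> \<in> B} = ?C \<inter> ?D" by auto
  then have "emeasure M {\<omega>\<in>space M. (\<forall>i\<in>I. Y i \<omega> \<in> A i) \<and> X \<omega> \<in> B}
      = ennreal (\<integral>\<omega>. (\<Prod>i\<in>I. measure (P \<omega>) (A i)) * indicator ?C \<omega> \<partial>M)"
    by (simp add: M.emeasure_eq_measure m)
  also have "\<dots> = (\<integral>\<^sup>+\<omega>. ennreal ((\<Prod>i\<in>I. measure (P \<omega>) (A i)) * indicator ?C \<omega>) \<partial>M)"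
    using int by (intro nn_integral_eq_integral[symmetric]) (auto simp: prod_nonneg)
  also have "\<dots> = (\<integral>\<^sup>+\<omega>. (\<Prod>i\<in>I. ennreal (measure (P \<omega>) (A i))) * indicator B (X \<omega>) \<partial>M)"
    by (intro nn_integral_cong) (auto simp: prod_ennreal prod_nonneg split: split_indicator)
  finally show ?thesis .
qed

text \<open>
  The joint law of the sample and \<open>\<mu>\<close>.  The integrand \<open>\<Prod>P(A\<^sub>i)\<close> is \<open>\<Prod>\<mu>(A\<^sub>i)\<close> times \<open>T\<^sup>-\<^sup>n\<close>; the
  Palm formula absorbs the product, and \<open>T\<^sup>-\<^sup>n\<close> changes the exponent of the beta-gamma weight.
  The Pochhammer symbol \<open>\<Gamma>(\<theta> + n)/\<Gamma>(\<theta>)\<close> then corrects the constant of that weight.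
\<close>

lemma beta_gamma_joint_rectangle:
  fixes \<nu> :: "'y::polish_space measure"
  assumes \<nu>: "finite_measure \<nu>" "sets \<nu> = sets borel" and G: "gamma_process_law \<nu> G"
    and \<theta>: "measure \<nu> UNIV = \<theta>" "0 < \<theta>" and q: "0 < q"
    and M: "prob_space M" and \<mu> [measurable]: "\<mu> \<in> measurable M bfm_algebra"
    and law: "distr M bfm_algebra \<mu>
      = density G (\<lambda>m. ennreal (Gamma \<theta> / Gamma q * measure m UNIV powr (- (\<theta> - q))))"
    and ci: "cond_iid M \<mu> bfm_algebra {1..n} Y (\<lambda>\<omega>. normalized (\<mu> \<omega>))"
    and A: "\<And>i. i \<in> {1..n} \<Longrightarrow> A i \<in> sets borel" and B [measurable]: "B \<in> sets bfm_algebra"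
  shows "emeasure M {\<omega>\<in>space M. (\<forall>i\<in>{1..n}. Y i \<omega> \<in> A i) \<and> \<mu> \<omega> \<in> B}
    = (\<integral>\<^sup>+y. (\<Prod>i=1..n. indicator (A i) (y i)) * emeasure (beta_gamma_kernel G \<theta> q n y) B \<partial>urn \<nu> n)"
proof -
  note [measurable_cong] = gamma_process_lawD(1)[OF G]
  have pos: "0 < measure \<nu> UNIV" using \<theta> by simp
  let ?w = "\<lambda>m. ennreal (Gamma \<theta> / Gamma q * measure m (UNIV :: 'y set) powr (- (\<theta> - q)))"
  let ?wn = "\<lambda>m. ennreal (Gamma (\<theta> + real n) / Gamma q * measure m (UNIV :: 'y set) powr (- (\<theta> + real n - q)))"
  let ?F = "\<lambda>m. ?w m * (1 / emeasure m UNIV) ^ n * indicator B m"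
  have F [measurable]: "?F \<in> borel_measurable bfm_algebra" by measurable
  have nm [measurable]: "(\<lambda>m. measure (normalized m) (A i)) \<in> borel_measurable bfm_algebra" if "i \<in> {1..n}" for i
    using measurable_compose[OF measurable_normalized measurable_measure_subprob_algebra[OF A[OF that]]] .
  have nm' [measurable]: "(\<lambda>m. \<Prod>i=1..n. ennreal (measure (normalized m) (A i))) \<in> borel_measurable bfm_algebra"
    using nm by (intro borel_measurable_prod_ennreal measurable_compose[OF _ measurable_ennreal])
  have "emeasure M {\<omega>\<in>space M. (\<forall>i\<in>{1..n}. Y i \<omega> \<in> A i) \<and> \<mu> \<omega> \<in> B}
      = (\<integral>\<^sup>+\<omega>. (\<Prod>i=1..n. ennreal (measure (normalized (\<mu> \<omega>)) (A i))) * indicator B (\<mu> \<omega>) \<partial>M)"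
    using A by (intro cond_iid_joint[OF M \<mu> ci] measurable_compose[OF \<mu> nm]) auto
  also have "\<dots> = (\<integral>\<^sup>+m. (\<Prod>i=1..n. ennreal (measure (normalized m) (A i))) * indicator B m \<partial>distr M bfm_algebra \<mu>)"
    by (rule nn_integral_distr[symmetric]) measurable
  also have "\<dots> = (\<integral>\<^sup>+m. ?w m * ((\<Prod>i=1..n. ennreal (measure (normalized m) (A i))) * indicator B m) \<partial>G)"
    unfolding law by (rule nn_integral_density) measurable
  also have "\<dots> = (\<integral>\<^sup>+m. (\<Prod>i=1..n. emeasure m (A i)) * ?F m \<partial>G)"
  proof (rule nn_integral_cong)
    fix m assume "m \<in> space G"
    then have "normalized m \<in> space (subprob_algebra borel)"
      by (intro measurable_space[OF measurable_normalized]) (simp add: gamma_process_lawD[OF G])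
    then interpret P: subprob_space "normalized m" by (simp add: space_subprob_algebra)
    have "(\<Prod>i=1..n. ennreal (measure (normalized m) (A i))) = (\<Prod>i=1..n. 1 / emeasure m UNIV * emeasure m (A i))"
      by (simp add: P.emeasure_eq_measure[symmetric] emeasure_normalized)
    also have "\<dots> = (1 / emeasure m UNIV) ^ n * (\<Prod>i=1..n. emeasure m (A i))"
      by (simp add: prod.distrib)
    finally show "?w m * ((\<Prod>i=1..n. ennreal (measure (normalized m) (A i))) * indicator B m)
        = (\<Prod>i=1..n. emeasure m (A i)) * ?F m"
      by (simp only: mult_ac)
  qed
  also have "\<dots> = ennreal (pochhammer \<theta> n)
      * (\<integral>\<^sup>+y. (\<Prod>i=1..n. indicator (A i) (y i)) * (\<integral>\<^sup>+m. ?F m \<partial>attach_atoms G n y) \<partial>urn \<nu> n)"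
    using gamma_process_palm[OF \<nu> pos G A F] unfolding \<theta>(1) .
  also have "\<dots> = (\<integral>\<^sup>+y. ennreal (pochhammer \<theta> n)
      * ((\<Prod>i=1..n. indicator (A i) (y i)) * (\<integral>\<^sup>+m. ?F m \<partial>attach_atoms G n y)) \<partial>urn \<nu> n)"
  proof (rule nn_integral_cmult[symmetric])
    have su: "sets (urn \<nu> n) = sets (Pi\<^sub>M {1..n} (\<lambda>_. borel))"
      using urn_in_prob_algebra[OF \<nu> pos, of n] by (simp add: space_prob_algebra)
    have c: "(\<lambda>y. y i) \<in> borel_measurable (urn \<nu> n)" if "i \<in> {1..n}" for i
      using measurable_component_singleton[OF that, of "\<lambda>_. borel"] su by (simp cong: measurable_cong_sets)
    show "(\<lambda>y. (\<Prod>i=1..n. indicator (A i) (y i)) * (\<integral>\<^sup>+m. ?F m \<partial>attach_atoms G n y)) \<in> borel_measurable (urn \<nu> n)"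
    proof (intro borel_measurable_times_ennreal borel_measurable_prod_ennreal measurable_nn_integral_attach_atoms[OF G F] c)
      fix i assume "i \<in> {1..n}"
      then show "(\<lambda>y. indicator (A i) (y i)) \<in> borel_measurable (urn \<nu> n)"
        using A[of i] c[of i] by measurable
    qed
  qed
  also have "\<dots> = (\<integral>\<^sup>+y. (\<Prod>i=1..n. indicator (A i) (y i)) * emeasure (beta_gamma_kernel G \<theta> q n y) B \<partial>urn \<nu> n)"
  proof (rule nn_integral_cong)
    fix y :: "nat \<Rightarrow> 'y"
    note Gy = gamma_process_attach_atoms[OF \<nu> G, of n y]
    note [measurable_cong] = gamma_process_lawD(1)[OF Gy]
    have "ennreal (pochhammer \<theta> n) * (\<integral>\<^sup>+m. ?F m \<partial>attach_atoms G n y)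
        = (\<integral>\<^sup>+m. ennreal (pochhammer \<theta> n) * ?F m \<partial>attach_atoms G n y)"
      by (rule nn_integral_cmult[symmetric]) measurable
    also have "\<dots> = (\<integral>\<^sup>+m. ?wn m * indicator B m \<partial>attach_atoms G n y)"
    proof (rule nn_integral_cong_AE)
      have "AE m in attach_atoms G n y. 0 < measure m UNIV"
        using \<theta> measure_updated_shape_UNIV[OF \<nu>, of n y] by (intro gamma_process_AE_pos[OF Gy]) simp
      then show "AE m in attach_atoms G n y. ennreal (pochhammer \<theta> n) * ?F m = ?wn m * indicator B m"
        using gamma_process_AE_finite_measure[OF Gy]
      proof eventually_elim
        case (elim m)
        then interpret m: finite_measure m by simp
        let ?T = "measure m UNIV"
        have T: "0 < ?T" by (rule elim)
        have "\<theta> \<notin> \<int>\<^sub>\<le>\<^sub>0" using \<theta>(2) by (auto elim!: nonpos_Ints_cases)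
        then have p: "pochhammer \<theta> n * (Gamma \<theta> / Gamma q) = Gamma (\<theta> + real n) / Gamma q"
          using Gamma_real_pos[OF \<theta>(2)] by (simp add: pochhammer_Gamma)
        have t: "?T powr (- (\<theta> - q)) * (1 / ?T) ^ n = ?T powr (- (\<theta> + real n - q))"
        proof -
          have "?T powr (- (\<theta> + real n - q)) = ?T powr (- (\<theta> - q) + (- real n))" by (simp add: algebra_simps)
          also have "\<dots> = ?T powr (- (\<theta> - q)) * (1 / ?T) ^ n"
            using T by (subst powr_add) (simp add: powr_minus powr_realpow power_one_over inverse_eq_divide)
          finally show ?thesis ..
        qed
        have "(1 / emeasure m UNIV) ^ n = ennreal ((1 / ?T) ^ n)"
          using T by (simp add: m.emeasure_eq_measure ennreal_power[symmetric] divide_ennreal flip: ennreal_1)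
        note e = this
        have "ennreal (pochhammer \<theta> n) * (?w m * (1 / emeasure m UNIV) ^ n)
            = ennreal (pochhammer \<theta> n * (Gamma \<theta> / Gamma q * ?T powr (- (\<theta> - q)) * (1 / ?T) ^ n))"
        proof -
          have n: "0 \<le> pochhammer \<theta> n" "0 \<le> Gamma \<theta> / Gamma q * ?T powr (- (\<theta> - q))" "0 \<le> (1 / ?T) ^ n"
            using \<theta>(2) T Gamma_real_pos[OF \<theta>(2)] Gamma_real_pos[OF q]
            by (auto intro!: pochhammer_nonneg)
          have "0 \<le> Gamma \<theta> / Gamma q * ?T powr (- (\<theta> - q)) * (1 / ?T) ^ n"
            by (rule mult_nonneg_nonneg[OF n(2,3)])
          then show ?thesis
            unfolding e ennreal_mult[OF n(2,3), symmetric] by (rule ennreal_mult[OF n(1), symmetric])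
        qed
        also have "pochhammer \<theta> n * (Gamma \<theta> / Gamma q * ?T powr (- (\<theta> - q)) * (1 / ?T) ^ n)
            = (pochhammer \<theta> n * (Gamma \<theta> / Gamma q)) * (?T powr (- (\<theta> - q)) * (1 / ?T) ^ n)"
          by (simp only: mult_ac)
        also have "\<dots> = Gamma (\<theta> + real n) / Gamma q * ?T powr (- (\<theta> + real n - q))"
          unfolding p t ..
        finally show ?case by (simp only: mult.assoc[symmetric])
      qed
    qed
    also have "\<dots> = (\<integral>\<^sup>+m. indicator B m \<partial>beta_gamma_kernel G \<theta> q n y)"
      by (rule nn_integral_beta_gamma_kernel[OF \<nu> G, symmetric]) measurable
    also have "\<dots> = emeasure (beta_gamma_kernel G \<theta> q n y) B"
      using gamma_process_lawD(1)[OF Gy] B by (intro nn_integral_indicator) (simp add: beta_gamma_kernel_def)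
    finally have e: "ennreal (pochhammer \<theta> n) * (\<integral>\<^sup>+m. ?F m \<partial>attach_atoms G n y)
        = emeasure (beta_gamma_kernel G \<theta> q n y) B" .
    show "ennreal (pochhammer \<theta> n) * ((\<Prod>i=1..n. indicator (A i) (y i)) * (\<integral>\<^sup>+m. ?F m \<partial>attach_atoms G n y))
        = (\<Prod>i=1..n. indicator (A i) (y i)) * emeasure (beta_gamma_kernel G \<theta> q n y) B"
      unfolding mult.left_commute[of "ennreal (pochhammer \<theta> n)"] e ..
  qed
  finally show ?thesis .
qed

text \<open>
  A kernel is a posterior if it disintegrates the joint law over some \<open>\<pi>\<close>: with \<open>B\<close> the whole
  space, the hypothesis says that \<open>\<pi>\<close> is the law of \<open>Z\<close>.
\<close>

lemma posterior_distributionI: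
  fixes K :: "'z \<Rightarrow> 'x measure"
  assumes M: "prob_space M" and X [measurable]: "X \<in> measurable M N" and Z [measurable]: "Z \<in> measurable M S"
    and K: "K \<in> measurable S (prob_algebra N)" and \<pi>: "sets \<pi> = sets S"
    and joint: "\<And>D B. D \<in> sets S \<Longrightarrow> B \<in> sets N \<Longrightarrow>
      emeasure M {\<omega>\<in>space M. Z \<omega> \<in> D \<and> X \<omega> \<in> B} = (\<integral>\<^sup>+y. indicator D y * emeasure (K y) B \<partial>\<pi>)"
  shows "posterior_distribution M X N Z S K"
  unfolding posterior_distribution_def
proof (intro conjI ballI K)
  interpret M: prob_space M by fact
  let ?F = "vimage_algebra (space M) Z S"
  interpret F: finite_measure_subalgebra M ?F
    by unfold_locales (rule subalgebra_vimage_algebra[OF Z])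
  note [measurable_cong] = \<pi>
  have sp: "space \<pi> = space S" using \<pi> by (rule sets_eq_imp_space_eq)
  have Kp: "prob_space (K y)" "sets (K y) = sets N" if "y \<in> space S" for y
    using measurable_space[OF K that] by (simp_all add: space_prob_algebra)
  have \<pi>_eq: "\<pi> = distr M S Z"
  proof (rule measure_eqI)
    fix D assume "D \<in> sets \<pi>"
    then have D [measurable]: "D \<in> sets S" using \<pi> by simp
    have "emeasure (distr M S Z) D = emeasure M {\<omega>\<in>space M. Z \<omega> \<in> D \<and> X \<omega> \<in> space N}"
      using measurable_space[OF X] by (subst emeasure_distr) (auto intro!: arg_cong[where f = "emeasure M"])
    also have "\<dots> = (\<integral>\<^sup>+y. indicator D y * emeasure (K y) (space N) \<partial>\<pi>)"
      by (rule joint) simp_all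
    also have "\<dots> = (\<integral>\<^sup>+y. indicator D y \<partial>\<pi>)"
    proof (rule nn_integral_cong)
      fix y assume "y \<in> space \<pi>"
      then have y: "y \<in> space S" by (simp add: sp)
      show "indicator D y * emeasure (K y) (space N) = indicator D y"
        using prob_space.emeasure_space_1[OF Kp(1)[OF y]] sets_eq_imp_space_eq[OF Kp(2)[OF y]] by simp
    qed
    finally show "emeasure \<pi> D = emeasure (distr M S Z) D" by simp
  qed (simp add: \<pi>)
  fix B assume B [measurable]: "B \<in> sets N"
  have KB [measurable]: "(\<lambda>y. measure (K y) B) \<in> borel_measurable S"
    by (rule measurable_compose[OF K measurable_measure_prob_algebra[OF B]])
  let ?E = "{\<omega>\<in>space M. X \<omega> \<in> B}"
  have E [measurable]: "?E \<in> sets M" by measurable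
  have KZ: "(\<lambda>\<omega>. measure (K (Z \<omega>)) B) \<in> borel_measurable M" by measurable
  show "AE \<omega> in M. real_cond_exp M ?F (indicator ?E) \<omega> = measure (K (Z \<omega>)) B"
  proof (rule F.real_cond_exp_charact)
    fix C assume "C \<in> sets ?F"
    then obtain D where D [measurable]: "D \<in> sets S" and C: "C = Z -` D \<inter> space M"
      using measurable_space[OF Z] by (auto simp: sets_vimage_algebra2 Pi_iff)
    have Cm [measurable]: "C \<in> sets M" unfolding C by measurable
    have "ennreal (\<integral>\<omega>\<in>C. indicator ?E \<omega> \<partial>M) = emeasure M {\<omega>\<in>space M. Z \<omega> \<in> D \<and> X \<omega> \<in> B}"
    proof -
      have "C \<inter> ?E = {\<omega>\<in>space M. Z \<omega> \<in> D \<and> X \<omega> \<in> B}" by (auto simp: C)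
      moreover have "(\<integral>\<omega>\<in>C. indicator ?E \<omega> \<partial>M) = measure M (C \<inter> ?E)"
        by (simp add: set_lebesgue_integral_def indicator_inter_arith[symmetric] Int_assoc)
      ultimately show ?thesis by (simp add: M.emeasure_eq_measure)
    qed
    also have "\<dots> = (\<integral>\<^sup>+y. indicator D y * emeasure (K y) B \<partial>distr M S Z)"
      using joint[OF D B] unfolding \<pi>_eq .
    also have "\<dots> = (\<integral>\<^sup>+y. ennreal (indicator D y * measure (K y) B) \<partial>distr M S Z)"
    proof (rule nn_integral_cong)
      fix y assume "y \<in> space (distr M S Z)"
      then interpret prob_space "K y" by (intro Kp) simp
      show "indicator D y * emeasure (K y) B = ennreal (indicator D y * measure (K y) B)"
        by (simp add: emeasure_eq_measure split: split_indicator)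
    qed
    also have "\<dots> = (\<integral>\<^sup>+\<omega>. ennreal (indicator D (Z \<omega>) * measure (K (Z \<omega>)) B) \<partial>M)"
      by (rule nn_integral_distr) measurable
    also have "\<dots> = (\<integral>\<^sup>+\<omega>. ennreal (indicator C \<omega> * measure (K (Z \<omega>)) B) \<partial>M)"
      by (intro nn_integral_cong) (simp add: C split: split_indicator)
    also have "\<dots> = ennreal (\<integral>\<omega>\<in>C. measure (K (Z \<omega>)) B \<partial>M)"
    proof -
      have "integrable M (\<lambda>\<omega>. indicator C \<omega> * measure (K (Z \<omega>)) B)"
      proof (rule M.integrable_const_bound[of _ 1])
        show "AE \<omega> in M. norm (indicator C \<omega> * measure (K (Z \<omega>)) B) \<le> 1"
          using measurable_space[OF Z] Kp(1)
          by (intro AE_I2) (auto simp: prob_space.prob_le_1 split: split_indicator)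
      qed (use KZ in measurable)
      then show ?thesis
        unfolding set_lebesgue_integral_def by (subst nn_integral_eq_integral) simp_all
    qed
    finally show "(\<integral>\<omega>\<in>C. indicator ?E \<omega> \<partial>M) = (\<integral>\<omega>\<in>C. measure (K (Z \<omega>)) B \<partial>M)"
      by (subst (asm) ennreal_inj) (auto simp: set_lebesgue_integral_def intro!: integral_nonneg_AE)
  next
    show "integrable M (indicator ?E :: _ \<Rightarrow> real)"
      by (intro integrable_real_indicator) (auto simp: M.emeasure_eq_measure)
    show "integrable M (\<lambda>\<omega>. measure (K (Z \<omega>)) B)"
      using measurable_space[OF Z] Kp(1) KZ
      by (intro M.integrable_const_bound[of _ 1] AE_I2) (auto simp: prob_space.prob_le_1)
    show "(\<lambda>\<omega>. measure (K (Z \<omega>)) B) \<in> borel_measurable ?F"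
      using measurable_space[OF Z] by (intro measurable_compose[OF measurable_vimage_algebra1 KB]) auto
  qed
qed

text \<open>
  For a fixed event \<open>\<mu> \<in> B\<close>, both sides of the disintegration are finite measures in the event of
  the sample, so they agree because they do on rectangles.
\<close>

theorem beta_gamma_posterior:
  fixes \<nu> :: "'y::polish_space measure"
  assumes \<nu>: "finite_measure \<nu>" "sets \<nu> = sets borel" and G: "gamma_process_law \<nu> G"
    and \<theta>: "measure \<nu> UNIV = \<theta>" "0 < \<theta>" and q: "0 < q"
    and M: "prob_space M" and \<mu> [measurable]: "\<mu> \<in> measurable M bfm_algebra"
    and law: "distr M bfm_algebra \<mu>
      = density G (\<lambda>m. ennreal (Gamma \<theta> / Gamma q * measure m UNIV powr (- (\<theta> - q))))"
    and ci: "cond_iid M \<mu> bfm_algebra {1..n} Y (\<lambda>\<omega>. normalized (\<mu> \<omega>))"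
  shows "posterior_distribution M \<mu> bfm_algebra (\<lambda>\<omega>. \<lambda>i\<in>{1..n}. Y i \<omega>) (Pi\<^sub>M {1..n} (\<lambda>_. borel))
    (beta_gamma_kernel G \<theta> q n)"
proof -
  interpret M: prob_space M by fact
  let ?S = "Pi\<^sub>M {1..n} (\<lambda>_. borel :: 'y measure)"
  let ?Z = "\<lambda>\<omega>. \<lambda>i\<in>{1..n}. Y i \<omega>"
  let ?K = "beta_gamma_kernel G \<theta> q n"
  have pos: "0 < measure \<nu> UNIV" using \<theta> by simp
  have K: "?K \<in> measurable ?S (prob_algebra bfm_algebra)"
    by (rule measurable_beta_gamma_kernel[OF \<nu> G \<theta> q])
  have "Y i \<in> borel_measurable M" if "i \<in> {1..n}" for i
    using ci that by (simp add: cond_iid_def)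
  then have Z [measurable]: "?Z \<in> measurable M ?S"
    by (intro measurable_restrict)
  have su: "sets (urn \<nu> n) = sets ?S"
    using urn_in_prob_algebra[OF \<nu> pos, of n] by (simp add: space_prob_algebra)
  note [measurable_cong] = su
  show ?thesis
  proof (rule posterior_distributionI[OF M \<mu> Z K su])
    fix D B assume D [measurable]: "D \<in> sets ?S" and B [measurable]: "B \<in> sets (bfm_algebra :: 'y measure measure)"
    have KB: "(\<lambda>y. emeasure (?K y) B) \<in> borel_measurable ?S"
      by (rule measurable_compose[OF measurable_prob_algebraD[OF K] measurable_emeasure_subprob_algebra[OF B]])
    define L where "L = distr (density M (\<lambda>\<omega>. indicator B (\<mu> \<omega>))) ?S ?Z"
    define L' where "L' = density (urn \<nu> n) (\<lambda>y. emeasure (?K y) B)"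
    have L_D: "emeasure L D = emeasure M {\<omega>\<in>space M. ?Z \<omega> \<in> D \<and> \<mu> \<omega> \<in> B}"
      if [measurable]: "D \<in> sets ?S" for D
    proof -
      have "emeasure L D = (\<integral>\<^sup>+\<omega>. indicator B (\<mu> \<omega>) * indicator (?Z -` D \<inter> space M) \<omega> \<partial>M)"
        unfolding L_def using measurable_sets[OF Z that]
        by (subst emeasure_distr, measurable, subst emeasure_density) simp_all
      also have "\<dots> = (\<integral>\<^sup>+\<omega>. indicator {\<omega>\<in>space M. ?Z \<omega> \<in> D \<and> \<mu> \<omega> \<in> B} \<omega> \<partial>M)"
        by (intro nn_integral_cong) (simp split: split_indicator)
      also have "\<dots> = emeasure M {\<omega>\<in>space M. ?Z \<omega> \<in> D \<and> \<mu> \<omega> \<in> B}"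
        by (rule nn_integral_indicator) measurable
      finally show ?thesis .
    qed
    have L'_D: "emeasure L' D = (\<integral>\<^sup>+y. indicator D y * emeasure (?K y) B \<partial>urn \<nu> n)"
      if [measurable]: "D \<in> sets ?S" for D
    proof -
      have "(\<lambda>y. emeasure (?K y) B) \<in> borel_measurable (urn \<nu> n)"
        using KB unfolding measurable_cong_sets[OF su refl] .
      then show ?thesis
        unfolding L'_def by (subst emeasure_density) (simp_all add: mult.commute)
    qed
    have "L = L'"
    proof (rule measure_eqI_PiM_finite[where A = "\<lambda>_. space ?S"])
      show "sets L = sets ?S" "sets L' = sets ?S" by (simp_all add: L_def L'_def su)
      fix A assume A: "\<And>i. i \<in> {1..n} \<Longrightarrow> A i \<in> sets (borel :: 'y measure)"
      then have PA: "Pi\<^sub>E {1..n} A \<in> sets ?S" by (intro sets_PiM_I_finite) auto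
      have rect: "{\<omega>\<in>space M. ?Z \<omega> \<in> Pi\<^sub>E {1..n} A \<and> \<mu> \<omega> \<in> B}
          = {\<omega>\<in>space M. (\<forall>i\<in>{1..n}. Y i \<omega> \<in> A i) \<and> \<mu> \<omega> \<in> B}"
        by (simp only: restrict_PiE_iff)
      have "emeasure L (Pi\<^sub>E {1..n} A)
          = (\<integral>\<^sup>+y. (\<Prod>i=1..n. indicator (A i) (y i)) * emeasure (?K y) B \<partial>urn \<nu> n)"
        unfolding L_D[OF PA] rect by (rule beta_gamma_joint_rectangle[OF \<nu> G \<theta> q M \<mu> law ci A B])
      also have "\<dots> = (\<integral>\<^sup>+y. indicator (Pi\<^sub>E {1..n} A) y * emeasure (?K y) B \<partial>urn \<nu> n)"
      proof (rule nn_integral_cong)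
        fix y assume "y \<in> space (urn \<nu> n)"
        then have "y \<in> extensional {1..n}"
          using sets_eq_imp_space_eq[OF su] by (simp add: space_PiM PiE_iff)
        moreover have "Pi\<^sub>E {1..n} A = {y \<in> extensional {1..n}. \<forall>i\<in>{1..n}. y i \<in> A i}"
          by (rule set_eqI) (simp only: PiE_iff mem_Collect_eq conj_commute)
        ultimately have "indicator (Pi\<^sub>E {1..n} A) y = (\<Prod>i=1..n. indicator (A i) (y i) :: ennreal)"
          using indicator_all_eq_prod[of "{1..n}" "extensional {1..n}" "\<lambda>i y. y i" A y] by simp
        then show "(\<Prod>i=1..n. indicator (A i) (y i)) * emeasure (?K y) B
            = indicator (Pi\<^sub>E {1..n} A) y * emeasure (?K y) B" by simp
      qed
      also have "\<dots> = emeasure L' (Pi\<^sub>E {1..n} A)" by (rule L'_D[OF PA, symmetric])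
      finally show "emeasure L (Pi\<^sub>E {1..n} A) = emeasure L' (Pi\<^sub>E {1..n} A)" .
    next
      show "emeasure L (space ?S) \<noteq> \<infinity>" for i :: nat
        by (subst L_D) (simp_all add: M.emeasure_eq_measure)
    qed (auto simp: space_PiM intro!: prod_algebraI_finite)
    then show "emeasure M {\<omega>\<in>space M. ?Z \<omega> \<in> D \<and> \<mu> \<omega> \<in> B}
        = (\<integral>\<^sup>+y. indicator D y * emeasure (?K y) B \<partial>urn \<nu> n)"
      using L_D[OF D] L'_D[OF D] by simp
  qed
qed

lemma prod_over_blocks:
  fixes f :: "'y \<Rightarrow> real"
  assumes "\<And>x. 0 < f x"
  shows "(\<Prod>z\<in>y ` {1..n}. f z powr (- real (card (block n y z)))) = (\<Prod>i=1..n. 1 / f (y i))"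
proof -
  have "(\<Prod>i=1..n. 1 / f (y i)) = (\<Prod>z\<in>y ` {1..n}. \<Prod>i | i \<in> {1..n} \<and> y i = z. 1 / f (y i))"
    by (rule prod.image_gen) simp
  also have "\<dots> = (\<Prod>z\<in>y ` {1..n}. f z powr (- real (card (block n y z))))"
  proof (rule prod.cong)
    fix z
    have "(\<Prod>i | i \<in> {1..n} \<and> y i = z. 1 / f (y i)) = (\<Prod>i\<in>block n y z. 1 / f z)"
      unfolding block_def by (rule prod.cong) auto
    also have "\<dots> = f z powr (- real (card (block n y z)))"
      using assms[of z] by (simp add: powr_minus powr_realpow power_one_over inverse_eq_divide)
    finally show "(\<Prod>i | i \<in> {1..n} \<and> y i = z. 1 / f (y i)) = f z powr (- real (card (block n y z)))" .
  qed simp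
  finally show ?thesis ..
qed

lemma posterior_laplace:
  fixes \<nu> :: "'y::polish_space measure"
  assumes \<nu>: "finite_measure \<nu>" "sets \<nu> = sets borel" and G: "gamma_process_law \<nu> G"
    and \<theta>: "measure \<nu> UNIV = \<theta>" "0 < \<theta>" and q: "0 < q" and m: "0 < \<theta> + real n - q"
    and g [measurable]: "g \<in> borel_measurable borel" and g0: "\<And>x. 0 \<le> g x"
    and fin: "(\<integral>\<^sup>+x. ennreal (ln (1 + g x)) \<partial>\<nu>) < \<infinity>"
  shows "laplace_functional (beta_gamma_kernel G \<theta> q n y) g
    = (\<integral>u. exp (- (\<integral>x. ln (1 + u * g x) \<partial>\<nu>))
          * (\<Prod>z\<in>y ` {1..n}. (1 + u * g z) powr (- real (card (block n y z)))) \<partial>beta_distr q (\<theta> + real n - q))"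
proof -
  note [measurable_cong] = \<nu>(2) sets_updated_shape
  let ?\<nu> = "updated_shape \<nu> n y"
  let ?R = "\<lambda>u. exp (- (\<integral>x. ln (1 + u * g x) \<partial>\<nu>))
    * (\<Prod>z\<in>y ` {1..n}. (1 + u * g z) powr (- real (card (block n y z))))"
  interpret nu: finite_measure \<nu> by fact
  interpret up: finite_measure ?\<nu> by (rule finite_measure_updated_shape[OF \<nu>])
  have int: "integrable \<nu> (\<lambda>x. ln (1 + g x))"
    using fin g0 by (intro integrableI_nonneg) auto
  have int': "integrable ?\<nu> (\<lambda>x. ln (1 + g x))"
    using \<nu>(2) _ _ int by (rule integral_updated_shape(1)) (simp_all add: g0)
  have a: "measure ?\<nu> UNIV = q + (\<theta> + real n - q)"
    using measure_updated_shape_UNIV[OF \<nu>] \<theta>(1) by simp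
  have "laplace_functional (beta_gamma_kernel G \<theta> q n y) g
      = (\<integral>u. exp (- (\<integral>x. ln (1 + u * g x) \<partial>?\<nu>)) \<partial>beta_distr q (\<theta> + real n - q))"
    using beta_gamma_laplace[OF finite_measure_updated_shape[OF \<nu>] sets_updated_shape
        gamma_process_attach_atoms[OF \<nu> G] g g0 int' m q a]
    by (simp add: beta_gamma_kernel_def)
  also have "\<dots> = (\<integral>u. ?R u \<partial>beta_distr q (\<theta> + real n - q))"
  proof (rule integral_cong_AE)
    have meas: "(\<lambda>u. \<integral>x. ln (1 + u * g x) \<partial>\<nu>) \<in> borel_measurable borel"
      "(\<lambda>u. \<integral>x. ln (1 + u * g x) \<partial>?\<nu>) \<in> borel_measurable borel"
      by (rule nu.borel_measurable_lebesgue_integral up.borel_measurable_lebesgue_integral, measurable)+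
    note meas [measurable]
    have sb: "sets (beta_distr q (\<theta> + real n - q)) = sets borel" by (simp add: beta_distr_def)
    note [measurable_cong] = sb
    show "(\<lambda>u. exp (- (\<integral>x. ln (1 + u * g x) \<partial>?\<nu>))) \<in> borel_measurable (beta_distr q (\<theta> + real n - q))"
      by measurable
    show "(\<lambda>u. ?R u)
        \<in> borel_measurable (beta_distr q (\<theta> + real n - q))"
      by measurable
    have eq: "exp (- (\<integral>x. ln (1 + u * g x) \<partial>?\<nu>)) = ?R u" if u: "0 < u" for u
    proof -
      have p: "0 < 1 + u * g x" for x
        using u g0[of x] by (intro add_pos_nonneg mult_nonneg_nonneg) auto
      have "integrable \<nu> (\<lambda>x. ln (1 + u * g x))"
        using integrable_ln_1_plus[OF \<nu> g g0 int, of u 0] u by simp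
      then have "(\<integral>x. ln (1 + u * g x) \<partial>?\<nu>) = (\<integral>x. ln (1 + u * g x) \<partial>\<nu>) + (\<Sum>i=1..n. ln (1 + u * g (y i)))"
        using u g0 \<nu>(2) by (intro integral_updated_shape(2)) auto
      then have "exp (- (\<integral>x. ln (1 + u * g x) \<partial>?\<nu>))
          = exp (- (\<integral>x. ln (1 + u * g x) \<partial>\<nu>)) * (\<Prod>i=1..n. exp (- ln (1 + u * g (y i))))"
        by (simp add: exp_diff exp_sum exp_minus prod_dividef divide_inverse prod_inversef[symmetric])
      also have "(\<Prod>i=1..n. exp (- ln (1 + u * g (y i)))) = (\<Prod>i=1..n. 1 / (1 + u * g (y i)))"
        using p by (simp add: exp_minus inverse_eq_divide)
      also have "\<dots> = (\<Prod>z\<in>y ` {1..n}. (1 + u * g z) powr (- real (card (block n y z))))"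
        by (rule prod_over_blocks[symmetric]) (rule p)
      finally show ?thesis .
    qed
    show "AE u in beta_distr q (\<theta> + real n - q). exp (- (\<integral>x. ln (1 + u * g x) \<partial>?\<nu>)) = ?R u"
      unfolding beta_distr_def
      by (subst AE_density, simp, intro AE_I2 impI eq) (simp split: split_indicator_asm)
  qed
  finally show ?thesis .
qed

theorem proposition3p2:
  fixes H :: "'y::polish_space measure"
    and M :: "'w measure"
    and \<mu> :: "'w \<Rightarrow> 'y measure"
    and Y :: "nat \<Rightarrow> 'w \<Rightarrow> 'y"
    and \<theta> q :: real
    and n :: nat
  assumes "prob_space H" and "sets H = sets borel" and "non_atomic H"
    and "\<theta> > 0" and "q > 0"
    and "prob_space M"
    and "\<mu> \<in> measurable M bfm_algebra"
    and "beta_gamma_law (scale_measure (ennreal \<theta>) H) (\<theta> - q) (distr M bfm_algebra \<mu>)"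
    and "cond_iid M \<mu> bfm_algebra {1..n} Y (\<lambda>\<omega>. normalized (\<mu> \<omega>))"
  shows "dirichlet_process_law (scale_measure (ennreal \<theta>) H)
           (distr M (subprob_algebra borel) (\<lambda>\<omega>. normalized (\<mu> \<omega>)))
    \<and> (\<exists>K. posterior_distribution M \<mu> bfm_algebra
              (\<lambda>\<omega>. \<lambda>i\<in>{1..n}. Y i \<omega>) (Pi\<^sub>M {1..n} (\<lambda>_. borel)) K
          \<and> (\<forall>y\<in>space (Pi\<^sub>M {1..n} (\<lambda>_. borel)).
               beta_gamma_law (updated_shape (scale_measure (ennreal \<theta>) H) n y)
                 (\<theta> + real n - q) (K y)
             \<and> (\<forall>G. gamma_process_law (updated_shape (scale_measure (ennreal \<theta>) H) n y) G \<longrightarrow>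
                  K y = density G (\<lambda>m. ennreal (Gamma (\<theta> + real n) / Gamma q
                                     * measure m UNIV powr (- (\<theta> + real n - q)))))
             \<and> (\<theta> + real n - q > 0 \<longrightarrow>
                  (\<forall>g\<in>borel_measurable borel.
                     (\<forall>x. 0 \<le> g x) \<longrightarrow>
                     (\<integral>\<^sup>+x. ennreal (ln (1 + g x)) \<partial>scale_measure (ennreal \<theta>) H) < \<infinity> \<longrightarrow>
                     laplace_functional (K y) g
                     = (\<integral>u. exp (- (\<integral>x. ln (1 + u * g x) \<partial>scale_measure (ennreal \<theta>) H))
                           * (\<Prod>z\<in>y ` {1..n}. (1 + u * g z) powr (- real (card (block n y z))))
                          \<partial>beta_distr q (\<theta> + real n - q))))))"
proof -
  interpret H: prob_space H by fact
  define \<nu> where "\<nu> = scale_measure (ennreal \<theta>) H"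
  have sets_\<nu>: "sets \<nu> = sets borel" using assms(2) by (simp add: \<nu>_def)
  have "space H = UNIV" using sets_eq_imp_space_eq[OF assms(2)] by simp
  then have "emeasure \<nu> UNIV = ennreal \<theta>"
    using H.emeasure_space_1 by (simp add: \<nu>_def)
  then have \<theta>: "measure \<nu> UNIV = \<theta>" and fin: "finite_measure \<nu>"
    using \<open>\<theta> > 0\<close> sets_eq_imp_space_eq[OF sets_\<nu>] by (auto simp: measure_def intro!: finite_measureI)
  from assms(8) obtain G where G: "gamma_process_law \<nu> G" and
    law: "distr M bfm_algebra \<mu> = density G (\<lambda>m. ennreal (Gamma \<theta> / Gamma q * measure m UNIV powr (- (\<theta> - q))))"
    unfolding \<nu>_def[symmetric] beta_gamma_law_def \<theta> by auto
  let ?K = "beta_gamma_kernel G \<theta> q n"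
  have "dirichlet_process_law \<nu> (distr (distr M bfm_algebra \<mu>) (subprob_algebra borel) normalized)"
    using assms(4,5,8) by (intro dirichlet_process_law_of_beta_gamma[OF fin sets_\<nu>, of "\<theta> - q"]) (auto simp: \<theta> \<nu>_def[symmetric])
  also have "distr (distr M bfm_algebra \<mu>) (subprob_algebra borel) normalized
      = distr M (subprob_algebra borel) (\<lambda>\<omega>. normalized (\<mu> \<omega>))"
    using assms(7) by (subst distr_distr) (simp_all add: comp_def)
  finally have dirichlet: "dirichlet_process_law \<nu> (distr M (subprob_algebra borel) (\<lambda>\<omega>. normalized (\<mu> \<omega>)))" .
  have posterior: "posterior_distribution M \<mu> bfm_algebra
      (\<lambda>\<omega>. \<lambda>i\<in>{1..n}. Y i \<omega>) (Pi\<^sub>M {1..n} (\<lambda>_. borel)) ?K"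
    by (rule beta_gamma_posterior[OF fin sets_\<nu> G \<theta> assms(4-7) law assms(9)])
  have unique: "?K y = density G' (\<lambda>m. ennreal (Gamma (\<theta> + real n) / Gamma q
      * measure m UNIV powr (- (\<theta> + real n - q))))"
    if "gamma_process_law (updated_shape \<nu> n y) G'" for y G'
    using gamma_process_law_unique[OF that gamma_process_attach_atoms[OF fin sets_\<nu> G]]
    by (simp add: beta_gamma_kernel_def)
  have bg: "beta_gamma_law (updated_shape \<nu> n y) (\<theta> + real n - q) (?K y)" for y
    unfolding beta_gamma_law_def measure_updated_shape_UNIV[OF fin sets_\<nu>] \<theta>
    using gamma_process_attach_atoms[OF fin sets_\<nu> G, of n y]
    by (intro exI[of _ "attach_atoms G n y"]) (simp add: beta_gamma_kernel_def)
  show ?thesis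
    unfolding \<nu>_def[symmetric]
    using dirichlet posterior unique bg posterior_laplace[OF fin sets_\<nu> G \<theta> assms(4,5)]
    by (intro conjI exI[of _ ?K] ballI allI impI) simp_all
qed

end
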